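(* Let $0<\alpha<1$ be fixed, and put $M=\lfloor\alpha n\log n\rfloor$, where $n$ ranges over all sufficiently large integers. Let $$\mu_{n,M}=\frac{(n-1)\,(n-1)!\,S(M-1,n-1)}{n^M}.$$ Then, as $n\to\infty$, $$\mu_{n,M}T_{n,M}\Rightarrow\mathrm{Exp}(1).$$ Consequently, for every fixed integer $r\ge1$, $$\mathbb E\big[(\mu_{n,M}T_{n,M})^r\big]\to r!,$$ and $$\log T_{n,M}=n^{1-\alpha}+o_{\mathbb P}(n^{1-\alpha}),\qquad \log\mathbb E\,T_{n,M}=n^{1-\alpha}+o(n^{1-\alpha}).$$ If $\alpha>1/2$, then $$n^{-\alpha}e^{-n^{1-\alpha}}\,T_{n,M}\Rightarrow\mathrm{Exp}(1),$$ and in particular $$\mathbb E\,T_{n,M}\sim n^\alpha e^{n^{1-\alpha}},\qquad \mathrm{Var}(T_{n,M})\sim n^{2\alpha}e^{2n^{1-\alpha}}.$$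
   Context: $[n]=\{1,\dots,n\}$. In the expiring coupon collector started empty, coupons $X_1,X_2,\dots$ are iid uniform on $[n]$, one drawn at each time, and each coupon stays active for exactly $M$ draws. The completion time (first time all $n$ types are simultaneously active) is $T_{n,M}=\inf\{t\ge n:\{X_{\max(1,t-M+1)},\dots,X_t\}=[n]\}$. $S(\cdot,\cdot)$ denotes a Stirling number of the second kind. $\log$ is the natural logarithm, $\mathrm{Exp}(1)$ is the exponential distribution with mean $1$, $\Rightarrow$ denotes convergence in distribution, $a_n\sim b_n$ means $a_n/b_n\to1$, and $Y_n=o_{\mathbb P}(c_n)$ means $Y_n/c_n\to0$ in probability. *)

theory Defs
  imports "HOL-Probability.Probability" "HOL-Combinatorics.Stirling"
begin

text \<open>Draws are numbered from \<open>1\<close>; \<open>X 0\<close> is never used.\<close>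

definition iid_uniform_coupons :: "'a measure \<Rightarrow> nat \<Rightarrow> (nat \<Rightarrow> 'a \<Rightarrow> nat) \<Rightarrow> bool" where
  "iid_uniform_coupons P n X \<longleftrightarrow>
     prob_space P \<and>
     prob_space.indep_vars P (\<lambda>_. count_space UNIV) X {1..} \<and>
     (\<forall>i\<ge>1. distr P (count_space UNIV) (X i) = measure_pmf (pmf_of_set {1..n}))"

text \<open>
  The index \<open>t + 1 - M\<close> is truncated at \<open>0\<close>, which is harmless under \<open>max 1\<close>.
  The infimum is taken in \<^typ>\<open>enat\<close>, so it is \<open>\<infinity>\<close> if the collection is never complete.
\<close>

definition completion_time :: "nat \<Rightarrow> nat \<Rightarrow> (nat \<Rightarrow> 'a \<Rightarrow> nat) \<Rightarrow> 'a \<Rightarrow> enat" where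
  "completion_time n M X \<omega> =
     Inf (enat ` {t. n \<le> t \<and> (\<lambda>i. X i \<omega>) ` {max 1 (t + 1 - M)..t} = {1..n}})"

text \<open>
  Real-valued version, meaningful only where the completion time is finite:
  \<^term>\<open>the_enat \<infinity>\<close> is unspecified.
\<close>

definition completion_time_real :: "nat \<Rightarrow> nat \<Rightarrow> (nat \<Rightarrow> 'a \<Rightarrow> nat) \<Rightarrow> 'a \<Rightarrow> real" where
  "completion_time_real n M X \<omega> = real (the_enat (completion_time n M X \<omega>))"

definition coupon_rate :: "nat \<Rightarrow> nat \<Rightarrow> real" where
  "coupon_rate n M =
     real (n - 1) * fact (n - 1) * real (Stirling (M - 1) (n - 1)) / real n ^ M"

definition conv_in_distr ::
  "(nat \<Rightarrow> 'a measure) \<Rightarrow> (nat \<Rightarrow> 'a \<Rightarrow> real) \<Rightarrow> real measure \<Rightarrow> bool" where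
  "conv_in_distr P Y Q \<longleftrightarrow> weak_conv_m (\<lambda>n. distr (P n) borel (Y n)) Q"

definition Exp1 :: "real measure" where
  "Exp1 = density lborel (exponential_density 1)"

definition conv_in_prob_0 :: "(nat \<Rightarrow> 'a measure) \<Rightarrow> (nat \<Rightarrow> 'a \<Rightarrow> real) \<Rightarrow> bool" where
  "conv_in_prob_0 P Y \<longleftrightarrow>
     (\<forall>\<epsilon>>0. (\<lambda>n. measure (P n) {\<omega> \<in> space (P n). \<bar>Y n \<omega>\<bar> > \<epsilon>}) \<longlonglongrightarrow> 0)"

definition smallo_prob ::
  "(nat \<Rightarrow> 'a measure) \<Rightarrow> (nat \<Rightarrow> 'a \<Rightarrow> real) \<Rightarrow> (nat \<Rightarrow> real) \<Rightarrow> bool" where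
  "smallo_prob P Y c \<longleftrightarrow> conv_in_prob_0 P (\<lambda>n \<omega>. Y n \<omega> / c n)"

end

theory Submission
  imports Defs "HOL-Real_Asymp.Real_Asymp"
begin

text \<open>
  Full windows come in clumps, and \<open>\<mu> = coupon_rate n M\<close> is the probability that a window of \<open>M\<close>
  draws is full while the next one is not, that is, the rate at which clumps end. Cut time into
  blocks of length \<open>L = n ^ 5\<close>. Windows crossing block boundaries are negligible, so the blocks are
  essentially independent, and each contains a full window with probability \<open>q\<close>, where
  \<open>q / (L * \<mu>) \<longlonglongrightarrow> 1\<close>. This gives the exponential limit and a uniform exponential tail,
  hence convergence of all moments.

  The lower bound for \<open>q\<close> requires that a clump which has ended rarely revives. Within
  \<open>K = n powr ((1 + \<alpha>) / 2)\<close> steps the type just lost would have to reappear, which has probability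
  at most \<open>K / n\<close>. After more than \<open>K\<close> steps, many types of the old window have expired and all of
  them would have to be drawn again.

  The rate itself is found from the probability \<open>lone m n\<close> that the first point of a uniform
  surjection is alone in its fibre. Log-concavity of the surjection numbers confines it between
  \<open>(1 - 1 / n) ^ m\<close> and a nearly equal upper bound, and the probability \<open>p m\<close> that \<open>m\<close> draws
  cover all types satisfies \<open>p m = (1 - lone m n) * p (m + 1)\<close>.
\<close>

section \<open>Surjection numbers\<close>

text \<open>Counting all full windows instead of clump ends would overshoot by the mean clump size,
  cover divided by \<mu>, which is about n powr \<alpha>. Since \<mu> is itself the normalisation,
  the exponential limit uses only crude facts: cover is at most 4 * n * \<mu> and is exponentially
  small in a power of n. The precise size of \<mu> enters for the logarithms and for \<alpha> > 1/2.
  The exponent of \<open>K\<close> lies halfway between \<alpha> and 1. It has to be below 1 so that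
  \<open>K / n\<close> tends to 0, and above \<alpha> because one step loses a type with probability
  about n powr (- \<alpha>), so that K steps lose many. The threshold 1/2 arises because ln cover is
  - n * lone up to a relative error of order lone * ln n, with lone about n powr (- \<alpha>). The
  absolute error n powr (1 - 2 * \<alpha>) * ln n vanishes exactly for \<alpha> > 1/2. Until the
  coupon process appears, every probability is an average over the finite set of words of a given
  length. Independence is then concatenation of words, and measure theory is confined to identifying
  the law of the first N draws.\<close>

definition surj_num :: "nat \<Rightarrow> nat \<Rightarrow> real" where
  "surj_num m n = fact n * real (Stirling m n)"

lemma surj_num_0_0 [simp]: "surj_num 0 0 = 1"
  and surj_num_Suc_0 [simp]: "surj_num (Suc m) 0 = 0"
  and surj_num_0_Suc [simp]: "surj_num 0 (Suc n) = 0"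
  by (simp_all add: surj_num_def)

lemma surj_num_Suc_Suc:
  "surj_num (Suc m) (Suc n) = real (Suc n) * (surj_num m (Suc n) + surj_num m n)"
  by (simp add: surj_num_def algebra_simps)

lemma surj_num_nonneg [simp]: "0 \<le> surj_num m n"
  by (simp add: surj_num_def)

lemma surj_num_less: "m < n \<Longrightarrow> surj_num m n = 0"
  by (simp add: surj_num_def)

lemma surj_num_pos: "1 \<le> n \<Longrightarrow> n \<le> m \<Longrightarrow> 0 < surj_num m n"
proof (induction m arbitrary: n)
  case (Suc m)
  then obtain k where n: "n = Suc k" by (cases n) auto
  show ?case
  proof (cases "k = 0")
    case True
    have "surj_num (Suc m) (Suc 0) = 1" by (simp only: surj_num_def Stirling_1) simp
    then show ?thesis using True n by simp
  next
    case False
    then have "0 < surj_num m k" using Suc n by auto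
    then show ?thesis
      by (simp add: n surj_num_Suc_Suc add_nonneg_pos)
  qed
qed simp

text \<open>Sort the maps by the number j of points sent to one extra type, which may or may not be
  hit. Times \<open>Suc n\<close> the right side is \<open>surj_num (Suc m) (Suc n)\<close>, so the
  summands also describe how many further points share the fibre of the first one.\<close>

lemma binomial_sum_surj_num:
  "(\<Sum>j\<le>m. real (m choose j) * surj_num (m - j) n) = surj_num m (Suc n) + surj_num m n"
proof (induction m arbitrary: n)
  case (Suc m)
  define b where "b = (\<lambda>n. \<Sum>j\<le>m. real (m choose j) * surj_num (m - j) n)"
  have "(\<Sum>j\<le>Suc m. real (Suc m choose j) * surj_num (Suc m - j) n)
      = surj_num (Suc m) n + (\<Sum>j\<le>m. real (Suc m choose Suc j) * surj_num (m - j) n)"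
    by (subst sum.atMost_Suc_shift) simp
  also have "(\<Sum>j\<le>m. real (Suc m choose Suc j) * surj_num (m - j) n)
      = b n + (\<Sum>j\<le>m. real (m choose Suc j) * surj_num (m - j) n)"
    by (simp add: b_def algebra_simps sum.distrib)
  also have "surj_num (Suc m) n + (b n + (\<Sum>j\<le>m. real (m choose Suc j) * surj_num (m - j) n))
      = b n + (\<Sum>j\<le>Suc m. real (m choose j) * surj_num (Suc m - j) n)"
    by (subst sum.atMost_Suc_shift) simp
  also have "(\<Sum>j\<le>Suc m. real (m choose j) * surj_num (Suc m - j) n)
      = (\<Sum>j\<le>m. real (m choose j) * surj_num (Suc (m - j)) n)"
    by (simp add: Suc_diff_le)
  finally have *: "(\<Sum>j\<le>Suc m. real (Suc m choose j) * surj_num (Suc m - j) n)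
      = b n + (\<Sum>j\<le>m. real (m choose j) * surj_num (Suc (m - j)) n)" .
  have b: "b n = surj_num m (Suc n) + surj_num m n" for n
    unfolding b_def by (rule Suc.IH)
  show ?case
  proof (cases n)
    case 0
    have "(\<Sum>j\<le>m. real (m choose j) * surj_num (Suc (m - j)) n) = 0"
      by (simp add: 0)
    then show ?thesis using * 0 by (simp add: b surj_num_Suc_Suc)
  next
    case (Suc k)
    have "(\<Sum>j\<le>m. real (m choose j) * surj_num (Suc (m - j)) n) = real n * (b n + b k)"
      by (simp add: Suc surj_num_Suc_Suc b_def sum_distrib_left sum.distrib[symmetric] algebra_simps)
    then show ?thesis using * by (simp add: b Suc surj_num_Suc_Suc algebra_simps)
  qed
qed (cases n, auto)

section \<open>Log-concavity of the surjection numbers in both arguments\<close>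

text \<open>The additive part of the recurrence for \<open>surj_num\<close>. Besides the two given
  inequalities it takes \<open>a * d \<le> b * c\<close>, which is their product divided by
  \<open>b * c\<close>; the last two assumptions exclude internal zeros, where this division
  fails.\<close>

lemma log_concave_step:
  fixes a b c d :: real
  assumes "0 \<le> a" "0 \<le> b" "0 \<le> c" "0 \<le> d"
    and "a * c \<le> b\<^sup>2" "b * d \<le> c\<^sup>2" "b = 0 \<Longrightarrow> d = 0" "c = 0 \<Longrightarrow> d = 0"
  shows "(a + b) * (c + d) \<le> (b + c)\<^sup>2"
proof -
  have "a * d \<le> b * c"
  proof (cases "b * c = 0")
    case True
    then show ?thesis using assms by auto
  next
    case False
    then have bc: "0 < b * c" using assms by (simp add: less_le)
    have "(a * d) * (b * c) \<le> (b * c) * (b * c)"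
      using mult_mono[OF assms(5,6)] assms by (simp add: power2_eq_square algebra_simps)
    then show ?thesis using bc by (simp add: mult_le_cancel_right)
  qed
  then show ?thesis using assms(5,6) by (simp add: power2_eq_square algebra_simps)
qed

lemma surj_num_log_concave:
  "surj_num m n * surj_num m (Suc (Suc n)) \<le> (surj_num m (Suc n))\<^sup>2"
proof (induction m arbitrary: n)
  case 0
  then show ?case by simp
next
  case (Suc m)
  show ?case
  proof (cases n)
    case 0
    then show ?thesis by simp
  next
    case (Suc k)
    define a b c d where "a = surj_num m k" "b = surj_num m (Suc k)"
      "c = surj_num m (Suc (Suc k))" "d = surj_num m (Suc (Suc (Suc k)))"
    note abcd = this
    have z: "b = 0 \<Longrightarrow> d = 0" "c = 0 \<Longrightarrow> d = 0"
      using surj_num_pos[of "Suc k" m] surj_num_pos[of "Suc (Suc k)" m]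
        surj_num_less[of m "Suc (Suc (Suc k))"] unfolding abcd
      by (force simp: not_less)+
    have "(a + b) * (c + d) \<le> (b + c)\<^sup>2"
      using Suc.IH[of k] Suc.IH[of "Suc k"] z
      by (intro log_concave_step) (auto simp: abcd)
    \<comment> \<open>The prefactors of the recurrence form a log-concave sequence
      themselves.\<close>
    moreover have "real (k + 1) * real (k + 3) \<le> (real (k + 2))\<^sup>2"
      by (simp add: power2_eq_square algebra_simps)
    ultimately have "(real (k + 1) * real (k + 3)) * ((a + b) * (c + d)) \<le> (real (k + 2))\<^sup>2 * (b + c)\<^sup>2"
      by (intro mult_mono) (auto simp: abcd)
    moreover have "surj_num (Suc m) (Suc k) = real (k+1) * (a + b)"
      "surj_num (Suc m) (Suc (Suc k)) = real (k+2) * (b + c)"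
      "surj_num (Suc m) (Suc (Suc (Suc k))) = real (k+3) * (c + d)"
      by (simp_all add: surj_num_Suc_Suc abcd algebra_simps)
    ultimately show ?thesis
      by (simp add: Suc power_mult_distrib mult_ac)
  qed
qed

text \<open>Expanding both \<open>Suc m\<close> terms by the recurrence and cancelling the common
  product leaves log-concavity in the number of types. The factor n / (n + 1) is kept because it
  becomes the decay rate of \<open>fail_ratio\<close>.\<close>

lemma surj_num_cross:
  "real (Suc n) * (surj_num (Suc m) n * surj_num m (Suc n))
     \<le> real n * (surj_num (Suc m) (Suc n) * surj_num m n)"
proof (cases n)
  case (Suc k)
  have "surj_num m k * surj_num m (Suc (Suc k)) + surj_num m (Suc k) * surj_num m (Suc (Suc k))
      \<le> surj_num m (Suc k) * surj_num m (Suc k) + surj_num m (Suc k) * surj_num m (Suc (Suc k))"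
    using surj_num_log_concave[of m k] by (simp add: power2_eq_square)
  then have "(real n * real (Suc n)) * ((surj_num m n + surj_num m k) * surj_num m (Suc n))
      \<le> (real n * real (Suc n)) * ((surj_num m (Suc n) + surj_num m n) * surj_num m n)"
    by (intro mult_left_mono) (simp_all add: Suc algebra_simps)
  then show ?thesis
    by (simp only: Suc surj_num_Suc_Suc) (simp add: mult_ac)
qed (cases m, auto)

lemma surj_num_cross':
  "surj_num (Suc m) n * surj_num m (Suc n) \<le> surj_num (Suc m) (Suc n) * surj_num m n"
proof -
  have "real (Suc n) * (surj_num (Suc m) n * surj_num m (Suc n))
      \<le> real (Suc n) * (surj_num (Suc m) (Suc n) * surj_num m n)"
    by (rule order_trans[OF surj_num_cross], intro mult_right_mono) auto
  then show ?thesis by (rule mult_left_le_imp_le) simp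
qed

text \<open>Expanding one factor on each side reduces the claim to \<open>surj_num_cross'\<close>
  with one type less.\<close>

lemma surj_num_log_concave_length:
  "surj_num (Suc (Suc m)) n * surj_num m n \<le> (surj_num (Suc m) n)\<^sup>2"
proof (cases n)
  case (Suc k)
  have "real n * ((surj_num (Suc m) n + surj_num (Suc m) k) * surj_num m n)
      \<le> real n * ((surj_num m n + surj_num m k) * surj_num (Suc m) n)"
    using surj_num_cross'[of m k] by (intro mult_left_mono) (simp_all add: Suc algebra_simps)
  moreover have "surj_num (Suc (Suc m)) n = real n * (surj_num (Suc m) n + surj_num (Suc m) k)"
    "surj_num (Suc m) n = real n * (surj_num m n + surj_num m k)"
    by (simp_all add: Suc surj_num_Suc_Suc)
  ultimately show ?thesis by (simp add: power2_eq_square mult_ac)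
qed auto

text \<open>For a uniform surjection from \<open>Suc m\<close> points onto \<open>n\<close> types, the probability that
  the first point is the only one of its type.\<close>

definition lone :: "nat \<Rightarrow> nat \<Rightarrow> real" where
  "lone m n = real n * surj_num m (n - 1) / surj_num (Suc m) n"

definition cover :: "nat \<Rightarrow> nat \<Rightarrow> real" where
  "cover m n = surj_num m n / real n ^ m"

lemma lone_nonneg [simp]: "0 \<le> lone m n"
  by (simp add: lone_def)

lemma cover_nonneg [simp]: "0 \<le> cover m n"
  by (simp add: cover_def)

lemma cover_pos: "1 \<le> n \<Longrightarrow> n \<le> m \<Longrightarrow> 0 < cover m n"
  by (simp add: cover_def surj_num_pos)

lemma one_minus_lone:
  assumes "1 \<le> n" "n \<le> m"
  shows "1 - lone m n = real n * surj_num m n / surj_num (Suc m) n"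
proof -
  obtain k where k: "n = Suc k" using assms by (cases n) auto
  have "0 < surj_num (Suc m) n" using assms by (simp add: surj_num_pos)
  then show ?thesis
    by (simp add: lone_def k field_simps surj_num_Suc_Suc)
qed

lemma lone_less_1: "1 \<le> n \<Longrightarrow> n \<le> m \<Longrightarrow> lone m n < 1"
  using one_minus_lone[of n m] surj_num_pos[of n m] surj_num_pos[of n "Suc m"]
  by (smt (verit, best) divide_pos_pos le_SucI mult_pos_pos of_nat_0_less_iff zero_less_one order.strict_trans2 less_numeral_extra(1))

text \<open>Deleting the first of m + 1 covering draws leaves a covering word unless that draw was
  alone in its type. Iterated towards infinite length, where \<open>cover\<close> tends to 1, this
  turns \<open>cover\<close> into a product of factors \<open>1 - lone\<close>.\<close>

lemma cover_Suc:
  assumes "1 \<le> n" "n \<le> m"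
  shows "cover m n = (1 - lone m n) * cover (Suc m) n"
proof -
  have "0 < surj_num (Suc m) n" using assms by (simp add: surj_num_pos)
  then show ?thesis
    using assms by (simp add: one_minus_lone cover_def)
qed

text \<open>Surjectivity favours small fibres: a surjection of m - j points onto k = n - 1 types
  extends to m points in \<open>k ^ j\<close> ways, so taking j more points into the first fibre
  costs at least that factor. What remains is the binomial sum for an unconditioned map, whose first
  point is alone with probability \<open>(1 - 1 / n) ^ m\<close>.\<close>

lemma lone_ge:
  assumes "2 \<le> n" "n \<le> Suc m"
  shows "(1 - 1 / real n) ^ m \<le> lone m n"
proof -
  obtain k where n: "n = Suc k" and k: "1 \<le> k" using assms by (cases n) auto
  have mono: "surj_num (m - j) k \<le> surj_num m k / real k ^ j" if "j \<le> m" for j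
    using that
  proof (induction j)
    case (Suc j)
    obtain l where l: "k = Suc l" using k by (cases k) auto
    have "real k * surj_num (m - Suc j) k \<le> surj_num (Suc (m - Suc j)) k"
      by (simp add: l surj_num_Suc_Suc distrib_left del: of_nat_Suc)
    also have "Suc (m - Suc j) = m - j" using Suc by simp
    also have "surj_num (m - j) k \<le> surj_num m k / real k ^ j" using Suc by simp
    finally have "surj_num (m - Suc j) k \<le> surj_num m k / real k ^ j / real k"
      using k by (simp add: le_divide_eq mult_ac)
    then show ?case by (simp add: mult.commute)
  qed simp
  have "surj_num (Suc m) n = real n * (\<Sum>j\<le>m. real (m choose j) * surj_num (m - j) k)"
    by (simp only: binomial_sum_surj_num n surj_num_Suc_Suc)
  also have "\<dots> \<le> real n * (\<Sum>j\<le>m. real (m choose j) * (surj_num m k / real k ^ j))"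
    by (intro mult_left_mono sum_mono) (auto intro: mono)
  also have "\<dots> = real n * (surj_num m k * (\<Sum>j\<le>m. real (m choose j) * (1 / real k) ^ j))"
    by (simp add: sum_distrib_left power_one_over field_simps)
  also have "(\<Sum>j\<le>m. real (m choose j) * (1 / real k) ^ j) = (1 + 1 / real k) ^ m"
    using binomial_ring[of "1 / real k" 1 m] by (simp add: add.commute)
  also have "1 + 1 / real k = real n / real k" using k n by (simp add: field_simps)
  finally have "surj_num (Suc m) n \<le> real n * (surj_num m k * (real n / real k) ^ m)" .
  then have "surj_num (Suc m) n * (real k / real n) ^ m
      \<le> real n * (surj_num m k * (real n / real k) ^ m) * (real k / real n) ^ m"
    by (intro mult_right_mono) auto
  also have "\<dots> = real n * surj_num m k * ((real n / real k) * (real k / real n)) ^ m"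
    by (simp only: power_mult_distrib mult_ac)
  also have "(real n / real k) * (real k / real n) = 1" using k n by simp
  finally have "surj_num (Suc m) n * (real k / real n) ^ m \<le> real n * surj_num m k" by simp
  moreover have "real k / real n = 1 - 1 / real n" using n k by (simp add: field_simps)
  moreover have "0 < surj_num (Suc m) n" using assms by (intro surj_num_pos) auto
  ultimately show ?thesis by (simp add: lone_def n field_simps)
qed

text \<open>These are the odds \<open>lone / (1 - lone)\<close>, for which
  \<open>surj_num_cross\<close> gives geometric decay in m directly.\<close>

definition fail_ratio :: "nat \<Rightarrow> nat \<Rightarrow> real" where
  "fail_ratio m n = surj_num m (n - 1) / surj_num m n"

lemma fail_ratio_nonneg [simp]: "0 \<le> fail_ratio m n"
  by (simp add: fail_ratio_def)

lemma fail_ratio_Suc_le: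
  assumes "1 \<le> n" "n \<le> m"
  shows "fail_ratio (Suc m) n \<le> (1 - 1 / real n) * fail_ratio m n"
proof -
  obtain k where n: "n = Suc k" using assms by (cases n) auto
  have pos: "0 < surj_num m n" "0 < surj_num (Suc m) n" using assms by (auto intro!: surj_num_pos)
  have "1 - 1 / real n = real k / real n" using n by (simp add: field_simps)
  moreover have "surj_num (Suc m) k / surj_num (Suc m) n \<le> real k / real n * (surj_num m k / surj_num m n)"
    using surj_num_cross[of k m] pos assms by (simp add: divide_simps n) (simp add: mult_ac)
  ultimately show ?thesis
    by (simp add: fail_ratio_def n)
qed

lemma fail_ratio_conv_lone:
  assumes "1 \<le> n" "n \<le> m"
  shows "fail_ratio m n = lone m n / (1 - lone m n)"
  unfolding one_minus_lone[OF assms] using assms surj_num_pos[of n m] surj_num_pos[of n "Suc m"]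
  by (auto simp: lone_def fail_ratio_def)

lemma lone_conv_fail_ratio:
  assumes "1 \<le> n" "n \<le> m"
  shows "lone m n = fail_ratio m n / (1 + fail_ratio m n)"
  using lone_less_1[OF assms] unfolding fail_ratio_conv_lone[OF assms]
  by (simp add: field_simps)

text \<open>Chebyshev's sum inequality by symmetrisation: \<open>g i j + g j i\<close> equals
  \<open>t i * t j * ((i - j) * (\<rho> i - \<rho> j))\<close>, and the last two factors have
  opposite signs.\<close>

lemma weighted_chebyshev_sum:
  fixes t \<rho> :: "nat \<Rightarrow> real"
  assumes t: "\<And>j. j \<in> A \<Longrightarrow> 0 \<le> t j"
    and \<rho>: "\<And>i j. i \<in> A \<Longrightarrow> j \<in> A \<Longrightarrow> i \<le> j \<Longrightarrow> \<rho> j \<le> \<rho> i"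
  shows "(\<Sum>j\<in>A. real j * (\<rho> j * t j)) * (\<Sum>j\<in>A. t j)
      \<le> (\<Sum>j\<in>A. \<rho> j * t j) * (\<Sum>j\<in>A. real j * t j)"
proof -
  define g where "g = (\<lambda>i j. real i * (\<rho> i * t i) * t j - (\<rho> i * t i) * (real j * t j))"
  have "g i j + g j i \<le> 0" if "i \<in> A" "j \<in> A" for i j
  proof -
    have "(real i - real j) * (\<rho> i - \<rho> j) \<le> 0"
      using \<rho>[of i j] \<rho>[of j i] that by (cases "i \<le> j") (auto simp: mult_le_0_iff)
    then have "(t i * t j) * ((real i - real j) * (\<rho> i - \<rho> j)) \<le> 0"
      using t that by (simp add: mult_nonneg_nonpos)
    then show ?thesis by (simp add: g_def algebra_simps)
  qed
  then have "(\<Sum>i\<in>A. \<Sum>j\<in>A. g i j + g j i) \<le> 0"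
    by (intro sum_nonpos) auto
  also have "(\<Sum>i\<in>A. \<Sum>j\<in>A. g i j + g j i) = (\<Sum>i\<in>A. \<Sum>j\<in>A. g i j) + (\<Sum>i\<in>A. \<Sum>j\<in>A. g j i)"
    by (simp add: sum.distrib)
  also have "(\<Sum>i\<in>A. \<Sum>j\<in>A. g j i) = (\<Sum>i\<in>A. \<Sum>j\<in>A. g i j)"
    by (rule sum.swap)
  finally have "(\<Sum>i\<in>A. \<Sum>j\<in>A. g i j) \<le> 0" by simp
  then show ?thesis
    by (simp add: g_def sum_subtractf sum_product)
qed

text \<open>The size of the fibre of a fixed type under a uniform surjection of \<open>m + 2\<close> points onto
  \<open>n + 1\<close> types has mean \<open>(m + 2) / (n + 1)\<close>. By log-concavity it is dominated by a
  binomial variable with odds \<open>y = (1 - lone m n) / n\<close> conditioned to be positive,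
  and comparing the two means gives a nearly sharp bound.\<close>

lemma lone_le:
  assumes n: "1 \<le> n" "n \<le> m"
  shows "lone m n * (1 + (1 - lone m n) / real n) ^ Suc m \<le> 1"
proof -
  \<comment> \<open>The largest of the ratios \<open>surj_num i n / surj_num (Suc i) n\<close> over
    \<open>i \<le> m\<close>, by log-concavity in the length; dividing the fibre weights by
    \<open>y ^ j\<close> therefore makes them decreasing in j.\<close>
  define y where "y = surj_num m n / surj_num (Suc m) n"
  have pos: "0 < surj_num m n" "0 < surj_num (Suc m) n" "0 < surj_num (Suc (Suc m)) (Suc n)"
    using n by (auto intro!: surj_num_pos)
  then have y: "0 < y" by (simp add: y_def)
  have yv: "y = (1 - lone m n) / real n"
    using n by (simp add: one_minus_lone y_def)
  have cross: "surj_num i n * surj_num (Suc m) n \<le> surj_num m n * surj_num (Suc i) n" if "i \<le> m" for i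
    using that
  proof (induction rule: inc_induct)
    case (step i)
    show ?case
    proof (cases "surj_num (Suc i) n = 0")
      case True
      then have "i < n" using surj_num_pos[of n "Suc i"] n by (force simp: not_less)
      then show ?thesis using surj_num_less[of i n] by simp
    next
      case False
      then have p: "0 < surj_num (Suc i) n" by (simp add: less_le)
      have "(surj_num i n * surj_num (Suc m) n) * surj_num (Suc i) n
          \<le> surj_num i n * (surj_num m n * surj_num (Suc (Suc i)) n)"
        using mult_left_mono[OF step.IH, of "surj_num i n"] by (simp add: mult_ac)
      also have "\<dots> \<le> surj_num m n * (surj_num (Suc i) n)\<^sup>2"
        using mult_left_mono[OF surj_num_log_concave_length[of i n], of "surj_num m n"] by (simp add: mult_ac)
      finally have "(surj_num i n * surj_num (Suc m) n) * surj_num (Suc i) n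
          \<le> (surj_num m n * surj_num (Suc i) n) * surj_num (Suc i) n"
        by (simp add: power2_eq_square mult_ac)
      then show ?thesis using p by (rule mult_right_le_imp_le)
    qed
  qed simp
  define M where "M = Suc (Suc m)"
  define t where "t = (\<lambda>j. real (M choose j) * y ^ j)"
  \<comment> \<open>The fibre-size weights \<open>(M choose j) * surj_num (M - j) n\<close> factor
    as \<open>\<rho> j * t j\<close>. The index 0 is left out of \<open>A\<close> because a
    surjection has no empty fibre.\<close>
  define \<rho> where "\<rho> = (\<lambda>j. surj_num (M - j) n / y ^ j)"
  define A where "A = {1..M}"
  have \<rho>_Suc: "\<rho> (Suc j) \<le> \<rho> j" if "1 \<le> j" "Suc j \<le> M" for j
  proof -
    define i where "i = M - Suc j"
    have i: "M - j = Suc i" "i \<le> m" using that by (auto simp: i_def M_def)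
    have "surj_num i n \<le> y * surj_num (Suc i) n"
      using cross[OF i(2)] pos by (simp add: y_def field_simps)
    then have "surj_num i n / (y * y ^ j) \<le> (y * surj_num (Suc i) n) / (y * y ^ j)"
      using y by (intro divide_right_mono) auto
    then show ?thesis using y by (simp add: \<rho>_def i i_def[symmetric])
  qed
  have \<rho>: "\<rho> j \<le> \<rho> i" if "i \<in> A" "j \<in> A" "i \<le> j" for i j
    using that(3) that(1,2)
    by (induction j rule: dec_induct) (auto simp: A_def intro: order_trans[OF \<rho>_Suc])
  have b: "\<rho> j * t j = real (M choose j) * surj_num (M - j) n" for j
    using y by (simp add: \<rho>_def t_def)
  have split0: "(\<Sum>j\<in>A. f j) = (\<Sum>j\<le>M. f j) - f 0" for f :: "nat \<Rightarrow> real"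
  proof -
    have "{..M} = insert 0 A" by (auto simp: A_def)
    then show ?thesis by (simp add: A_def)
  qed
  have sum_b: "(\<Sum>j\<in>A. \<rho> j * t j) = surj_num M (Suc n)"
    unfolding b split0 binomial_sum_surj_num by simp
  have shift: "(\<Sum>j\<in>A. f j) = (\<Sum>j\<le>Suc m. f (Suc j))" for f :: "nat \<Rightarrow> real"
    unfolding A_def M_def atMost_atLeast0 One_nat_def by (rule sum.shift_bounds_cl_Suc_ivl)
  have absorb: "real (Suc j) * real (M choose Suc j) = real M * real (Suc m choose j)" for j
    using Suc_times_binomial[of j "Suc m"] unfolding M_def by (simp only: of_nat_mult[symmetric])
  have "(\<Sum>j\<in>A. real j * (\<rho> j * t j))
      = (\<Sum>j\<le>Suc m. real M * (real (Suc m choose j) * surj_num (Suc m - j) n))"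
    unfolding shift b using absorb by (intro sum.cong) (simp_all add: M_def mult.assoc[symmetric])
  also have "\<dots> = real M * (surj_num (Suc m) (Suc n) + surj_num (Suc m) n)"
    unfolding sum_distrib_left[symmetric] binomial_sum_surj_num ..
  also have "\<dots> = real M * (surj_num M (Suc n) / real (Suc n))"
    by (simp add: M_def surj_num_Suc_Suc del: of_nat_Suc)
  finally have sum_jb: "(\<Sum>j\<in>A. real j * (\<rho> j * t j)) = real M * (surj_num M (Suc n) / real (Suc n))" .
  have binom: "(\<Sum>j\<le>k. real (k choose j) * y ^ j) = (1 + y) ^ k" for k
    using binomial_ring[of y 1 k] by (simp add: add.commute)
  have sum_t: "(\<Sum>j\<in>A. t j) = (1 + y) ^ M - 1"
    unfolding split0 t_def binom by simp
  have "(\<Sum>j\<in>A. real j * t j) = (\<Sum>j\<le>Suc m. real M * y * (real (Suc m choose j) * y ^ j))"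
    unfolding shift t_def
  proof (intro sum.cong refl)
    fix j
    have "real (Suc j) * (real (M choose Suc j) * y ^ Suc j) = (real (Suc j) * real (M choose Suc j)) * y * y ^ j"
      by (simp only: power_Suc mult_ac)
    then show "real (Suc j) * (real (M choose Suc j) * y ^ Suc j) = real M * y * (real (Suc m choose j) * y ^ j)"
      unfolding absorb by (simp only: mult_ac)
  qed
  also have "\<dots> = real M * y * (1 + y) ^ Suc m"
    unfolding sum_distrib_left[symmetric] binom ..
  finally have sum_jt: "(\<Sum>j\<in>A. real j * t j) = real M * y * (1 + y) ^ Suc m" .
  have "(\<Sum>j\<in>A. real j * (\<rho> j * t j)) * (\<Sum>j\<in>A. t j)
      \<le> (\<Sum>j\<in>A. \<rho> j * t j) * (\<Sum>j\<in>A. real j * t j)"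
    using y by (intro weighted_chebyshev_sum \<rho>) (auto simp: t_def)
  then have "(real M * surj_num M (Suc n)) * (((1 + y) ^ M - 1) / real (Suc n))
      \<le> (real M * surj_num M (Suc n)) * (y * (1 + y) ^ Suc m)"
    unfolding sum_jb sum_t sum_b sum_jt by (simp only: times_divide_eq_right times_divide_eq_left mult_ac)
  then have "((1 + y) ^ M - 1) / real (Suc n) \<le> y * (1 + y) ^ Suc m"
    by (rule mult_left_le_imp_le) (use pos in \<open>simp add: M_def\<close>)
  then have "(1 + y) ^ M - 1 \<le> real (Suc n) * (y * (1 + y) ^ Suc m)"
    by (simp add: divide_le_eq mult.commute del: of_nat_Suc)
  \<comment> \<open>With \<open>M = Suc (Suc m)\<close> one factor 1 + y splits off, and (1 + y) -
    (n + 1) * y = 1 - n * y.\<close>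
  then have "(1 - real n * y) * (1 + y) ^ Suc m \<le> 1"
    by (simp add: M_def algebra_simps)
  moreover have "1 - real n * y = lone m n" using n by (simp add: yv)
  ultimately show ?thesis by (simp only: yv)
qed

section \<open>Random words\<close>

definition words :: "nat \<Rightarrow> nat \<Rightarrow> nat list set" where
  "words n N = {w. length w = N \<and> set w \<subseteq> {1..n}}"

definition mean :: "nat \<Rightarrow> nat \<Rightarrow> (nat list \<Rightarrow> real) \<Rightarrow> real" where
  "mean n N f = (\<Sum>w\<in>words n N. f w) / real n ^ N"

definition freq :: "nat \<Rightarrow> nat \<Rightarrow> (nat list \<Rightarrow> bool) \<Rightarrow> real" where
  "freq n N Q = mean n N (\<lambda>w. of_bool (Q w))"

lemma words_length: "w \<in> words n N \<Longrightarrow> length w = N"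
  and words_set: "w \<in> words n N \<Longrightarrow> set w \<subseteq> {1..n}"
  by (auto simp: words_def)

lemma finite_words [simp]: "finite (words n N)"
  using finite_lists_length_eq[of "{1..n}" N] by (simp add: words_def conj_commute)

lemma card_words: "card (words n N) = n ^ N"
  using card_lists_length_eq[of "{1..n}" N] by (simp add: words_def conj_commute)

lemma sum_words_append:
  fixes f :: "nat list \<Rightarrow> real"
  shows "(\<Sum>w\<in>words n (a + b). f w) = (\<Sum>u\<in>words n a. \<Sum>v\<in>words n b. f (u @ v))"
proof -
  have "(\<Sum>u\<in>words n a. \<Sum>v\<in>words n b. f (u @ v)) = (\<Sum>(u, v)\<in>words n a \<times> words n b. f (u @ v))"
    by (simp add: sum.cartesian_product)
  also have "\<dots> = (\<Sum>w\<in>words n (a + b). f w)"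
  proof (rule sum.reindex_bij_witness[where i = "\<lambda>w. (take a w, drop a w)" and j = "\<lambda>(u, v). u @ v"])
    fix w assume "w \<in> words n (a + b)"
    then show "(take a w, drop a w) \<in> words n a \<times> words n b"
      by (auto simp: words_def dest: in_set_takeD in_set_dropD)
  qed (auto simp: words_def)
  finally show ?thesis ..
qed

lemma mean_append: "mean n (a + b) f = mean n a (\<lambda>u. mean n b (\<lambda>v. f (u @ v)))"
  by (simp add: mean_def sum_words_append power_add sum_divide_distrib mult.commute)

lemma mean_0 [simp]: "mean n 0 f = f []"
proof -
  have "words n 0 = {[]}" by (auto simp: words_def)
  then show ?thesis by (simp add: mean_def)
qed

lemma mean_singleton: "mean n (Suc 0) f = (\<Sum>x\<in>{1..n}. f [x]) / real n"
proof -
  have "words n (Suc 0) = (\<lambda>x. [x]) ` {1..n}" by (auto simp: words_def length_Suc_conv)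
  then show ?thesis by (simp add: mean_def sum.reindex inj_on_def)
qed

lemma mean_Cons: "mean n (Suc N) f = (\<Sum>x\<in>{1..n}. mean n N (\<lambda>w. f (x # w))) / real n"
  using mean_append[of n "Suc 0" N f] by (simp add: mean_singleton)

lemma mean_const: "1 \<le> n \<Longrightarrow> mean n N (\<lambda>_. c) = c"
  by (simp add: mean_def card_words)

lemma mean_mono: "(\<And>w. w \<in> words n N \<Longrightarrow> f w \<le> g w) \<Longrightarrow> mean n N f \<le> mean n N g"
  unfolding mean_def by (intro divide_right_mono sum_mono) auto

lemma mean_cong: "(\<And>w. w \<in> words n N \<Longrightarrow> f w = g w) \<Longrightarrow> mean n N f = mean n N g"
  unfolding mean_def by (intro arg_cong2[of _ _ _ _ "(/)"] sum.cong) auto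

lemma mean_nonneg: "(\<And>w. w \<in> words n N \<Longrightarrow> 0 \<le> f w) \<Longrightarrow> 0 \<le> mean n N f"
  unfolding mean_def by (intro divide_nonneg_nonneg sum_nonneg) auto

lemma mean_add: "mean n N (\<lambda>w. f w + g w) = mean n N f + mean n N g"
  by (simp add: mean_def sum.distrib add_divide_distrib)

lemma mean_diff: "mean n N (\<lambda>w. f w - g w) = mean n N f - mean n N g"
  by (simp add: mean_def sum_subtractf diff_divide_distrib)

lemma mean_cmult: "mean n N (\<lambda>w. c * f w) = c * mean n N f"
  by (simp add: mean_def sum_distrib_left)

lemma mean_cmult_right: "mean n N (\<lambda>w. f w * c) = mean n N f * c"
  by (simp add: mean_def sum_distrib_right)

lemma mean_sum: "mean n N (\<lambda>w. \<Sum>i\<in>I. f i w) = (\<Sum>i\<in>I. mean n N (f i))"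
  unfolding mean_def by (subst sum.swap) (simp add: sum_divide_distrib)

lemma mean_swap:
  "mean n a (\<lambda>u. mean n b (\<lambda>v. f u v)) = mean n b (\<lambda>v. mean n a (\<lambda>u. f u v))"
  unfolding mean_def sum_divide_distrib by (subst sum.swap) (simp add: mult.commute)

lemma mean_square_le:
  assumes "1 \<le> n"
  shows "(mean n N f)\<^sup>2 \<le> mean n N (\<lambda>w. (f w)\<^sup>2)"
proof -
  define c where "c = mean n N f"
  have "0 \<le> mean n N (\<lambda>w. (f w - c)\<^sup>2)" by (intro mean_nonneg) auto
  also have "mean n N (\<lambda>w. (f w - c)\<^sup>2) = mean n N (\<lambda>w. ((f w)\<^sup>2 - 2 * c * f w) + c\<^sup>2)"
    by (intro mean_cong) (simp add: power2_eq_square algebra_simps)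
  also have "\<dots> = mean n N (\<lambda>w. (f w)\<^sup>2) - 2 * c * c + c\<^sup>2"
    by (simp add: mean_add mean_diff mean_cmult mean_const[OF assms] c_def)
  finally show ?thesis by (simp add: c_def power2_eq_square)
qed

lemma mean_take_mult_drop:
  "mean n (a + b) (\<lambda>w. f (take a w) * g (drop a w)) = mean n a f * mean n b g"
proof -
  have "mean n (a + b) (\<lambda>w. f (take a w) * g (drop a w)) = mean n a (\<lambda>u. mean n b (\<lambda>v. f u * g v))"
    unfolding mean_append by (intro mean_cong) (simp add: words_length)
  then show ?thesis by (simp add: mean_cmult mean_cmult_right)
qed

lemma mean_take: "1 \<le> n \<Longrightarrow> a \<le> N \<Longrightarrow> mean n N (\<lambda>w. f (take a w)) = mean n a f"
  using mean_take_mult_drop[of n a "N - a" f "\<lambda>_. 1"] by (simp add: mean_const)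

lemma mean_drop: "1 \<le> n \<Longrightarrow> a \<le> N \<Longrightarrow> mean n N (\<lambda>w. f (drop a w)) = mean n (N - a) f"
  using mean_take_mult_drop[of n a "N - a" "\<lambda>_. 1" f] by (simp add: mean_const)

lemma mean_subword:
  assumes "1 \<le> n" "a + b \<le> N"
  shows "mean n N (\<lambda>w. f (take b (drop a w))) = mean n b f"
  using assms mean_drop[of n a N "\<lambda>w. f (take b w)"] mean_take[of n b "N - a" f] by simp

lemma mean_subwords_mult:
  assumes n: "1 \<le> n" and "a + b \<le> a'" "a' + b' \<le> N"
  shows "mean n N (\<lambda>w. f (take b (drop a w)) * g (take b' (drop a' w))) = mean n b f * mean n b' g"
proof -
  have "mean n N (\<lambda>w. f (take b (drop a w)) * g (take b' (drop a' w)))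
      = mean n (a' + (N - a')) (\<lambda>w. f (take b (drop a (take a' w))) * g (take b' (drop a' w)))"
    using assms by (simp add: drop_take)
  also have "\<dots> = mean n a' (\<lambda>w. f (take b (drop a w))) * mean n (N - a') (\<lambda>w. g (take b' w))"
    by (rule mean_take_mult_drop)
  finally show ?thesis using assms by (simp add: mean_subword mean_take)
qed

lemma freq_nonneg [simp]: "0 \<le> freq n N Q"
  unfolding freq_def by (intro mean_nonneg) auto

lemma freq_mono:
  "(\<And>w. w \<in> words n N \<Longrightarrow> Q w \<Longrightarrow> R w) \<Longrightarrow> freq n N Q \<le> freq n N R"
  unfolding freq_def by (intro mean_mono) auto

lemma freq_cong:
  "(\<And>w. w \<in> words n N \<Longrightarrow> Q w = R w) \<Longrightarrow> freq n N Q = freq n N R"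
  unfolding freq_def by (intro mean_cong) auto

lemma freq_compl: "1 \<le> n \<Longrightarrow> freq n N (\<lambda>w. \<not> Q w) = 1 - freq n N Q"
  using mean_diff[of n N "\<lambda>_. 1" "\<lambda>w. of_bool (Q w)"]
  by (simp add: freq_def mean_const of_bool_not_iff)

lemma freq_le_1: "1 \<le> n \<Longrightarrow> freq n N Q \<le> 1"
  using freq_compl[of n N Q] freq_nonneg[of n N "\<lambda>w. \<not> Q w"] by linarith

lemma freq_disj_le: "freq n N (\<lambda>w. Q w \<or> R w) \<le> freq n N Q + freq n N R"
  unfolding freq_def mean_add[symmetric] by (intro mean_mono) auto

lemma freq_Bex_le:
  assumes "finite I"
  shows "freq n N (\<lambda>w. \<exists>i\<in>I. Q i w) \<le> (\<Sum>i\<in>I. freq n N (Q i))"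
  using assms
proof (induction I rule: finite_induct)
  case (insert i I)
  have "freq n N (\<lambda>w. \<exists>j\<in>insert i I. Q j w) \<le> freq n N (Q i) + freq n N (\<lambda>w. \<exists>j\<in>I. Q j w)"
    using freq_disj_le[of n N "Q i" "\<lambda>w. \<exists>j\<in>I. Q j w"] by simp
  then show ?case using insert by simp
qed (simp add: freq_def mean_def)

lemma freq_conj_diff: "freq n N (\<lambda>w. Q w \<and> \<not> R w) = freq n N Q - freq n N (\<lambda>w. Q w \<and> R w)"
  unfolding freq_def mean_diff[symmetric] by (intro mean_cong) auto

section \<open>Covering words and prescribed letters\<close>

definition full :: "nat \<Rightarrow> nat list \<Rightarrow> bool" where
  "full n w \<longleftrightarrow> {1..n} \<subseteq> set w"

text \<open>After the first letter x, the rest maps onto A, or onto \<open>A - {x}\<close> if x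
  occurs only once. The weight f is arbitrary since the decomposition serves both the count of
  surjective words and the generating function of lost types.\<close>

lemma sum_surj_words_Suc:
  fixes f :: "nat list \<Rightarrow> real"
  assumes A: "finite A"
  shows "(\<Sum>w | length w = Suc m \<and> set w = A. f w)
    = (\<Sum>x\<in>A. (\<Sum>u | length u = m \<and> set u = A. f (x # u)) + (\<Sum>u | length u = m \<and> set u = A - {x}. f (x # u)))"
proof -
  define U where "U = (\<lambda>B :: nat set. {u :: nat list. length u = m \<and> set u = B})"
  have fin: "finite (U B)" if "finite B" for B
    unfolding U_def by (rule finite_subset[OF _ finite_lists_length_eq[OF that, of m]]) auto
  have "(\<Sum>x\<in>A. (\<Sum>u\<in>U A. f (x # u)) + (\<Sum>u\<in>U (A - {x}). f (x # u)))
      = (\<Sum>x\<in>A. \<Sum>u\<in>U A \<union> U (A - {x}). f (x # u))"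
  proof (rule sum.cong[OF refl])
    fix x assume "x \<in> A"
    then have "U A \<inter> U (A - {x}) = {}" by (auto simp: U_def)
    then show "(\<Sum>u\<in>U A. f (x # u)) + (\<Sum>u\<in>U (A - {x}). f (x # u)) = (\<Sum>u\<in>U A \<union> U (A - {x}). f (x # u))"
      using A by (simp add: sum.union_disjoint fin)
  qed
  also have "\<dots> = (\<Sum>(x, u)\<in>Sigma A (\<lambda>x. U A \<union> U (A - {x})). f (x # u))"
    using A by (simp add: sum.Sigma fin)
  also have "\<dots> = (\<Sum>w | length w = Suc m \<and> set w = A. f w)"
  proof (rule sum.reindex_bij_witness[where i = "\<lambda>w. (hd w, tl w)" and j = "\<lambda>(x, u). x # u"])
    fix w assume "w \<in> {w. length w = Suc m \<and> set w = A}"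
    then obtain x u where w: "w = x # u" "length u = m" "insert x (set u) = A"
      by (cases w) auto
    then have "set u = A \<or> set u = A - {x}" by (cases "x \<in> set u") auto
    then show "(hd w, tl w) \<in> Sigma A (\<lambda>x. U A \<union> U (A - {x}))"
      using w by (auto simp: U_def)
    show "(case (hd w, tl w) of (x, u) \<Rightarrow> x # u) = w" using w by simp
  next
    fix p assume "p \<in> Sigma A (\<lambda>x. U A \<union> U (A - {x}))"
    then show "(case p of (x, u) \<Rightarrow> x # u) \<in> {w. length w = Suc m \<and> set w = A}"
      by (cases p) (auto simp: U_def)
  qed auto
  finally show ?thesis unfolding U_def ..
qed

lemma card_surj_words:
  "finite A \<Longrightarrow> real (card {w. length w = m \<and> set w = (A :: nat set)}) = surj_num m (card A)"
proof (induction m arbitrary: A)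
  case 0
  show ?case
  proof (cases "A = {}")
    case True
    then have "{w. length w = 0 \<and> set w = A} = {[]}" by auto
    then show ?thesis using True by simp
  next
    case False
    then have "{w. length w = 0 \<and> set w = A} = {}" by auto
    moreover obtain k where "card A = Suc k" using False 0 by (cases "card A") auto
    ultimately show ?thesis by (simp only: card.empty surj_num_0_Suc of_nat_0)
  qed
next
  case (Suc m)
  show ?case
  proof (cases "card A")
    case 0
    then have "A = {}" using Suc.prems by simp
    then have "{w. length w = Suc m \<and> set w = A} = {}" by auto
    then show ?thesis using 0 by (simp only: card.empty surj_num_Suc_0 of_nat_0)
  next
    case (Suc k)
    have "real (card {w. length w = Suc m \<and> set w = A}) = (\<Sum>w | length w = Suc m \<and> set w = A. 1)"
      by (simp only: card_eq_sum of_nat_sum of_nat_1)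
    also have "\<dots> = (\<Sum>x\<in>A. surj_num m (card A) + surj_num m k)"
      unfolding sum_surj_words_Suc[OF Suc.prems]
    proof (rule sum.cong[OF refl])
      fix x assume "x \<in> A"
      then have "card (A - {x}) = k" using Suc Suc.prems by simp
      then show "(\<Sum>u | length u = m \<and> set u = A. 1) + (\<Sum>u | length u = m \<and> set u = A - {x}. 1)
          = surj_num m (card A) + surj_num m k"
        using Suc.IH[of A] Suc.IH[of "A - {x}"] Suc.prems
        by (simp only: card_eq_sum of_nat_sum of_nat_1 finite_Diff)
    qed
    also have "\<dots> = surj_num (Suc m) (card A)"
      by (simp add: Suc surj_num_Suc_Suc)
    finally show ?thesis .
  qed
qed

lemma words_full_eq: "{w \<in> words n M. full n w} = {w. length w = M \<and> set w = {1..n}}"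
  by (auto simp: words_def full_def)

lemma sum_of_bool_words: "(\<Sum>w\<in>words n N. of_bool (Q w) * f w) = (\<Sum>w | w \<in> words n N \<and> Q w. f w :: real)"
  by (intro sum.mono_neutral_cong_right) auto

lemma freq_full: "freq n M (full n) = cover M n"
  using sum_of_bool_words[where n = n and N = M and Q = "full n" and f = "\<lambda>_. 1"] card_surj_words[of "{1..n}" M]
  by (simp add: freq_def mean_def cover_def words_full_eq)

lemma freq_member_le:
  assumes "1 \<le> n"
  shows "freq n K (\<lambda>v. c \<in> set v) \<le> real K / real n"
proof (induction K)
  case (Suc K)
  have "freq n (Suc K) (\<lambda>v. c \<in> set v) \<le> mean n (Suc K) (\<lambda>v. of_bool (hd v = c) + of_bool (c \<in> set (tl v)))"
    unfolding freq_def by (intro mean_mono) (auto simp: words_def length_Suc_conv)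
  also have "\<dots> = (\<Sum>x\<in>{1..n}. of_bool (x = c) + freq n K (\<lambda>v. c \<in> set v)) / real n"
    by (simp only: mean_Cons mean_add mean_const[OF assms] freq_def list.sel sum.distrib add_divide_distrib)
  also have "\<dots> = ((\<Sum>x\<in>{1..n}. of_bool (x = c)) + real n * freq n K (\<lambda>v. c \<in> set v)) / real n"
    by (simp add: sum.distrib)
  also have "(\<Sum>x\<in>{1..n}. of_bool (x = c) :: real) \<le> 1"
    by (cases "c \<in> {1..n}") (auto simp: of_bool_def)
  finally have "freq n (Suc K) (\<lambda>v. c \<in> set v) \<le> (1 + real n * freq n K (\<lambda>v. c \<in> set v)) / real n"
    using assms by (simp add: divide_right_mono)
  also have "\<dots> \<le> (1 + real K) / real n"
    using Suc.IH assms by (intro divide_right_mono) (auto simp: field_simps)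
  finally show ?case by simp
qed (simp add: freq_def)

lemma freq_not_member:
  assumes "1 \<le> n" "c \<in> {1..n}"
  shows "freq n K (\<lambda>v. c \<notin> set v) = (1 - 1 / real n) ^ K"
proof (induction K)
  case (Suc K)
  have "freq n (Suc K) (\<lambda>v. c \<notin> set v) = (\<Sum>x\<in>{1..n}. of_bool (x \<noteq> c) * freq n K (\<lambda>v. c \<notin> set v)) / real n"
    unfolding freq_def mean_Cons mean_cmult[symmetric]
    by (intro arg_cong2[of _ _ _ _ "(/)"] sum.cong mean_cong) auto
  also have "(\<Sum>x\<in>{1..n}. of_bool (x \<noteq> c) :: real) = real n - 1"
  proof -
    have "(\<Sum>x\<in>{1..n}. of_bool (x \<noteq> c) :: real) = (\<Sum>x\<in>{1..n}. 1 - of_bool (x = c))"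
      by (intro sum.cong) auto
    then show ?thesis using assms by (simp add: sum_subtractf of_bool_def)
  qed
  then have "(\<Sum>x\<in>{1..n}. of_bool (x \<noteq> c) * freq n K (\<lambda>v. c \<notin> set v)) = (real n - 1) * freq n K (\<lambda>v. c \<notin> set v)"
    by (simp only: sum_distrib_right[symmetric])
  finally show ?case using assms Suc.IH by (simp add: field_simps)
qed (simp add: freq_def)

lemma one_minus_cover_le:
  assumes "1 \<le> n"
  shows "1 - cover m n \<le> real n * (1 - 1 / real n) ^ m"
proof -
  have "1 - cover m n = freq n m (\<lambda>w. \<exists>c\<in>{1..n}. c \<notin> set w)"
    unfolding freq_full[symmetric] freq_compl[OF assms, symmetric]
    by (intro freq_cong) (auto simp: full_def)
  also have "\<dots> \<le> (\<Sum>c\<in>{1..n}. freq n m (\<lambda>w. c \<notin> set w))"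
    by (rule freq_Bex_le) simp
  finally show ?thesis using assms by (simp add: freq_not_member)
qed

lemma cover_le_1: "1 \<le> n \<Longrightarrow> cover m n \<le> 1"
  using freq_le_1[of n m "full n"] by (simp add: freq_full)

text \<open>Heuristically a union bound over the positions of the letters of D:
  \<open>K ^ card D\<close> choices, each of probability \<open>1 / n ^ card D\<close>. The
  induction conditions on whether the first letter lies in D.\<close>

lemma freq_superset_le:
  assumes n: "1 \<le> n"
  shows "D \<subseteq> {1..n} \<Longrightarrow> freq n K (\<lambda>v. D \<subseteq> set v) \<le> (real K / real n) ^ card D"
proof (induction K arbitrary: D)
  case 0
  then have "finite D" using finite_subset by blast
  then show ?case by (cases "D = {}") (auto simp: freq_def)
next
  case (Suc K)
  have fin: "finite D" using Suc.prems finite_subset by blast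
  define d where "d = card D"
  define q where "q = real K / real n"
  have dn: "d \<le> n" using card_mono[OF _ Suc.prems] by (simp add: d_def)
  have step: "freq n K (\<lambda>v. D \<subseteq> set (x # v)) \<le> (if x \<in> D then q ^ (d - 1) else q ^ d)" for x
  proof -
    have "freq n K (\<lambda>v. D \<subseteq> set (x # v)) = freq n K (\<lambda>v. D - {x} \<subseteq> set v)"
      by (intro freq_cong) auto
    also have "\<dots> \<le> q ^ card (D - {x})"
      unfolding q_def using Suc.prems by (intro Suc.IH) auto
    finally show ?thesis using fin by (cases "x \<in> D") (simp_all add: d_def)
  qed
  have "freq n (Suc K) (\<lambda>v. D \<subseteq> set v) = (\<Sum>x\<in>{1..n}. freq n K (\<lambda>v. D \<subseteq> set (x # v))) / real n"
    by (simp add: freq_def mean_Cons)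
  also have "\<dots> \<le> (\<Sum>x\<in>{1..n}. if x \<in> D then q ^ (d - 1) else q ^ d) / real n"
    by (intro divide_right_mono sum_mono step) auto
  also have "(\<Sum>x\<in>{1..n}. if x \<in> D then q ^ (d - 1) else q ^ d)
      = real d * q ^ (d - 1) + real (n - d) * q ^ d"
  proof -
    have "{1..n} \<inter> D = D" "{1..n} \<inter> - D = {1..n} - D" using Suc.prems by auto
    then show ?thesis
      using Suc.prems fin by (simp add: sum.If_cases card_Diff_subset d_def)
  qed
  also have "(real d * q ^ (d - 1) + real (n - d) * q ^ d) / real n \<le> (q + 1 / real n) ^ d"
  proof (cases d)
    case 0
    then show ?thesis using n by simp
  next
    case (Suc e)
    have "(real d * q ^ e + real (n - d) * q ^ d) / real n \<le> (real d * q ^ e + real n * q ^ d) / real n"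
      by (intro divide_right_mono add_mono mult_right_mono) (auto simp: q_def)
    also have "\<dots> = q ^ d + real d * q ^ e / real n"
      using n by (simp add: field_simps)
    also have "\<dots> \<le> (q + 1 / real n) ^ d"
    proof -
      have q0: "0 \<le> q" by (simp add: q_def)
      \<comment> \<open>The first two terms of the binomial expansion.\<close>
      have "q ^ Suc e + real (Suc e) * q ^ e * h \<le> (q + h) ^ Suc e" if "0 \<le> h" for h
      proof (induction e)
        case (Suc e)
        have "q ^ Suc (Suc e) + real (Suc (Suc e)) * q ^ Suc e * h
            \<le> (q + h) * (q ^ Suc e + real (Suc e) * q ^ e * h)"
          using q0 that by (simp add: algebra_simps)
        also have "\<dots> \<le> (q + h) * (q + h) ^ Suc e"
          using Suc q0 that by (intro mult_left_mono) auto
        finally show ?case by simp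
      qed simp
      from this[of "1 / real n"] show ?thesis using Suc by simp
    qed
    finally show ?thesis using Suc by simp
  qed
  also have "q + 1 / real n = real (Suc K) / real n" by (simp add: q_def add_divide_distrib)
  finally show ?case by (simp add: d_def)
qed

section \<open>Leaving and re-entering a full window\<close>

definition leave :: "nat \<Rightarrow> nat \<Rightarrow> nat list \<Rightarrow> bool" where
  "leave n M w \<longleftrightarrow> full n (take M w) \<and> \<not> full n (take M (drop 1 w))"

lemma leave_Cons_snoc:
  assumes "length b = m" "x \<in> {1..n}" "y \<in> {1..n}" "set b \<subseteq> {1..n}"
  shows "leave n (Suc m) (x # b @ [y]) \<longleftrightarrow> set b = {1..n} - {x} \<and> y \<noteq> x"
  using assms by (auto simp: leave_def full_def)

text \<open>The lost type is the first letter x, the m middle letters map onto exactly the other n -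
  1 types, and the incoming letter differs from x; these three requirements are the three factors of
  the rate.\<close>

lemma freq_leave:
  assumes n: "1 \<le> n"
  shows "freq n (Suc (Suc m)) (leave n (Suc m)) = coupon_rate n (Suc m)"
proof -
  have "freq n (Suc (Suc m)) (leave n (Suc m))
      = (\<Sum>x\<in>{1..n}. mean n (m + 1) (\<lambda>w. of_bool (leave n (Suc m) (x # w)))) / real n"
    by (simp add: freq_def mean_Cons)
  also have "\<dots> = (\<Sum>x\<in>{1..n}. surj_num m (n - 1) / real n ^ m * ((real n - 1) / real n)) / real n"
  proof (intro arg_cong2[of _ _ _ _ "(/)"] sum.cong refl)
    fix x assume x: "x \<in> {1..n}"
    have "mean n (m + 1) (\<lambda>w. of_bool (leave n (Suc m) (x # w)))
        = mean n m (\<lambda>b. mean n 1 (\<lambda>v. of_bool (set b = {1..n} - {x}) * of_bool (x \<notin> set v)))"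
      unfolding mean_append
    proof (intro mean_cong)
      fix b v assume b: "b \<in> words n m" and v: "v \<in> words n 1"
      then obtain y where y: "v = [y]" by (auto simp: words_def length_Suc_conv)
      show "of_bool (leave n (Suc m) (x # b @ v)) = of_bool (set b = {1..n} - {x}) * (of_bool (x \<notin> set v) :: real)"
        using leave_Cons_snoc[of b m x n y] b v x unfolding y by (auto simp: words_def)
    qed
    also have "\<dots> = mean n m (\<lambda>b. of_bool (set b = {1..n} - {x})) * freq n 1 (\<lambda>v. x \<notin> set v)"
      unfolding mean_cmult mean_cmult_right freq_def ..
    also have "freq n 1 (\<lambda>v. x \<notin> set v) = (real n - 1) / real n"
      using freq_not_member[OF n x, of 1] n by (simp add: field_simps)
    also have "mean n m (\<lambda>b. of_bool (set b = {1..n} - {x})) = surj_num m (n - 1) / real n ^ m"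
    proof -
      have "{w \<in> words n m. set w = {1..n} - {x}} = {w. length w = m \<and> set w = {1..n} - {x}}"
        by (auto simp: words_def)
      then show ?thesis
        using sum_of_bool_words[where n = n and N = m and Q = "\<lambda>b. set b = {1..n} - {x}" and f = "\<lambda>_. 1"]
          card_surj_words[of "{1..n} - {x}" m] x
        by (simp add: mean_def)
    qed
    finally show "mean n (m + 1) (\<lambda>w. of_bool (leave n (Suc m) (x # w)))
        = surj_num m (n - 1) / real n ^ m * ((real n - 1) / real n)" .
  qed
  also have "\<dots> = coupon_rate n (Suc m)"
    using n by (simp add: coupon_rate_def surj_num_def field_simps of_nat_diff)
  finally show ?thesis .
qed

text \<open>A full window ends its clump when its first draw is alone in its type and the incoming
  draw is of another type.\<close>

lemma coupon_rate_eq: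
  assumes "1 \<le> n" "n \<le> Suc m"
  shows "coupon_rate n (Suc m) = (1 - 1 / real n) * lone m n * cover (Suc m) n"
proof -
  have "0 < surj_num (Suc m) n" using assms by (intro surj_num_pos) auto
  then show ?thesis using assms
    by (simp add: coupon_rate_def lone_def cover_def surj_num_def[of m] of_nat_diff field_simps)
qed

text \<open>The lost type is determined by the first \<open>Suc M\<close> letters, of which the K
  letters after them are independent.\<close>

lemma freq_leave_return_le:
  assumes n: "1 \<le> n" and M: "1 \<le> M"
  shows "freq n (Suc M + K) (\<lambda>w. leave n M (take (Suc M) w) \<and> hd w \<in> set (drop (Suc M) w))
    \<le> freq n (Suc M) (leave n M) * (real K / real n)"
proof -
  have "freq n (Suc M + K) (\<lambda>w. leave n M (take (Suc M) w) \<and> hd w \<in> set (drop (Suc M) w))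
      = mean n (Suc M) (\<lambda>u. of_bool (leave n M u) * freq n K (\<lambda>v. hd u \<in> set v))"
    unfolding freq_def mean_append mean_cmult[symmetric]
    by (intro mean_cong) (auto simp: words_def hd_append)
  also have "\<dots> \<le> mean n (Suc M) (\<lambda>u. of_bool (leave n M u) * (real K / real n))"
    by (intro mean_mono mult_left_mono freq_member_le n) auto
  finally show ?thesis by (simp only: mean_cmult_right freq_def)
qed

text \<open>Removing the points of a uniform surjection one by one is a Markov chain on (length, image);
  the exponent of \<open>\<theta>\<close> counts the types lost in the first \<open>i\<close> steps.\<close>

lemma sum_surj_words_lost_le:
  fixes \<theta> s :: real
  assumes \<theta>: "0 \<le> \<theta>" "\<theta> \<le> 1 / 2" and s: "0 \<le> s" "s \<le> 1"
    and lone: "\<And>m k. n0 < k \<Longrightarrow> k \<le> Suc m \<Longrightarrow> m \<le> mmax \<Longrightarrow> 2 * s \<le> lone m k"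
  shows "finite (A :: nat set) \<Longrightarrow> n0 \<le> card A \<Longrightarrow> i + m \<le> Suc mmax \<Longrightarrow>
    (\<Sum>w | length w = i + m \<and> set w = A. \<theta> ^ card (A - set (drop i w)))
      \<le> surj_num (i + m) (card A) * ((1 - s) ^ i + \<theta> ^ (card A - n0))"
proof (induction i arbitrary: A)
  case 0
  have "(\<Sum>w | length w = 0 + m \<and> set w = A. \<theta> ^ card (A - set (drop 0 w)))
      \<le> (\<Sum>w | length w = 0 + m \<and> set w = A. 1 + \<theta> ^ (card A - n0))"
    using \<theta> by (intro sum_mono) auto
  also have "\<dots> = surj_num (0 + m) (card A) * (1 + \<theta> ^ (card A - n0))"
    by (simp only: sum_constant card_surj_words[OF 0(1)])
  finally show ?case by simp
next
  case (Suc i)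
  define l where "l = i + m"
  define g where "g = (\<lambda>k. (1 - s) ^ i + \<theta> ^ (k - n0))"
  have g0: "0 \<le> g k" for k using \<theta> s by (simp add: g_def)
  show ?case
  \<comment> \<open>At n0 types the bound on \<open>lone\<close> is no longer available, but there
    the second summand is \<open>\<theta> ^ 0 = 1\<close> and the claim is trivial.\<close>
  proof (cases "card A = n0")
    case True
    have "(\<Sum>w | length w = Suc i + m \<and> set w = A. \<theta> ^ card (A - set (drop (Suc i) w)))
        \<le> (\<Sum>w | length w = Suc i + m \<and> set w = A. 1)"
      using \<theta> by (intro sum_mono power_le_one) auto
    also have "\<dots> = surj_num (Suc i + m) (card A)"
      by (simp only: sum_constant card_surj_words[OF Suc.prems(1)] mult_1_right)
    also have "\<dots> \<le> surj_num (Suc i + m) (card A) * ((1 - s) ^ Suc i + \<theta> ^ (card A - n0))"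
      using mult_left_mono[of 1 "(1 - s) ^ Suc i + \<theta> ^ (card A - n0)" "surj_num (Suc i + m) (card A)"] s
      by (simp add: True)
    finally show ?thesis .
  next
    case False
    then obtain k where k: "card A = Suc k" "n0 \<le> k" using Suc.prems by (cases "card A") auto
    have IH1: "(\<Sum>u | length u = l \<and> set u = A. \<theta> ^ card (A - set (drop i u))) \<le> surj_num l (Suc k) * g (Suc k)"
      using Suc.IH[of A] Suc.prems k by (simp add: l_def g_def)
    have rest: "(\<Sum>u | length u = l \<and> set u = A. \<theta> ^ card (A - set (drop (Suc i) (x # u))))
          + (\<Sum>u | length u = l \<and> set u = A - {x}. \<theta> ^ card (A - set (drop (Suc i) (x # u))))
        \<le> surj_num l (Suc k) * g (Suc k) + \<theta> * (surj_num l k * g k)" if x: "x \<in> A" for x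
    proof (intro add_mono)
      have "(\<Sum>u | length u = l \<and> set u = A - {x}. \<theta> ^ card (A - set (drop (Suc i) (x # u))))
          = (\<Sum>u | length u = l \<and> set u = A - {x}. \<theta> * \<theta> ^ card ((A - {x}) - set (drop i u)))"
      proof (intro sum.cong refl)
        fix u assume "u \<in> {u. length u = l \<and> set u = A - {x}}"
        then have "set (drop i u) \<subseteq> A - {x}" using set_drop_subset[of i u] by auto
        then have "A - set (drop i u) = insert x ((A - {x}) - set (drop i u))" using x by auto
        moreover have "finite ((A - {x}) - set (drop i u))" "x \<notin> (A - {x}) - set (drop i u)"
          using Suc.prems by auto
        ultimately have "card (A - set (drop i u)) = Suc (card ((A - {x}) - set (drop i u)))"
          by (metis card_insert_disjoint)
        then show "\<theta> ^ card (A - set (drop (Suc i) (x # u))) = \<theta> * \<theta> ^ card ((A - {x}) - set (drop i u))"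
          by simp
      qed
      also have "\<dots> = \<theta> * (\<Sum>u | length u = l \<and> set u = A - {x}. \<theta> ^ card ((A - {x}) - set (drop i u)))"
        by (simp only: sum_distrib_left)
      also have "\<dots> \<le> \<theta> * (surj_num l k * g k)"
      proof (intro mult_left_mono)
        show "(\<Sum>u | length u = l \<and> set u = A - {x}. \<theta> ^ card ((A - {x}) - set (drop i u))) \<le> surj_num l k * g k"
          using Suc.IH[of "A - {x}"] Suc.prems k x by (simp add: l_def g_def)
      qed (use \<theta> in auto)
      finally show "(\<Sum>u | length u = l \<and> set u = A - {x}. \<theta> ^ card (A - set (drop (Suc i) (x # u))))
          \<le> \<theta> * (surj_num l k * g k)" .
    qed (use IH1 in simp)
    have "(\<Sum>w | length w = Suc i + m \<and> set w = A. \<theta> ^ card (A - set (drop (Suc i) w)))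
        \<le> (\<Sum>x\<in>A. surj_num l (Suc k) * g (Suc k) + \<theta> * (surj_num l k * g k))"
      unfolding add_Suc sum_surj_words_Suc[OF Suc.prems(1)] using rest
      by (intro sum_mono) (simp only: l_def)
    also have "\<dots> = real (Suc k) * surj_num l (Suc k) * g (Suc k) + \<theta> * (real (Suc k) * surj_num l k * g k)"
      by (simp only: sum_constant k) (simp add: algebra_simps)
    also have "\<dots> \<le> surj_num (Suc l) (Suc k) * ((1 - s) ^ Suc i + \<theta> ^ (Suc k - n0))"
    proof (cases "surj_num (Suc l) (Suc k) = 0")
      case True
      then have "surj_num l (Suc k) = 0 \<and> surj_num l k = 0"
        by (simp add: surj_num_Suc_Suc add_nonneg_eq_0_iff del: of_nat_Suc)
      then show ?thesis using True by simp
    next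
      case False
      define S where "S = surj_num (Suc l) (Suc k)"
      have S: "0 < S" using False by (simp add: S_def less_le)
      define v where "v = lone l (Suc k)"
      have kl: "k \<le> l" using False surj_num_less[of "Suc l" "Suc k"] by (force simp: not_less)
      have v: "2 * s \<le> v" unfolding v_def using kl k Suc.prems by (intro lone) (auto simp: l_def)
      have e2: "real (Suc k) * surj_num l k = S * v"
        using S by (simp add: v_def lone_def S_def)
      have "real (Suc k) * surj_num l (Suc k) = S - real (Suc k) * surj_num l k"
        by (simp add: S_def surj_num_Suc_Suc algebra_simps)
      then have e1: "real (Suc k) * surj_num l (Suc k) = S * (1 - v)"
        unfolding e2 by (simp add: algebra_simps)
      have "\<theta> * \<theta> ^ (k - n0) = \<theta> ^ (Suc k - n0)" using k by (simp add: Suc_diff_le)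
      then have "(1 - v) * g (Suc k) + \<theta> * v * g k = (1 - s) ^ i * (1 - v * (1 - \<theta>)) + \<theta> ^ (Suc k - n0)"
        by (simp add: g_def algebra_simps)
      \<comment> \<open>A step loses a type with probability \<open>v \<ge> 2 * s\<close> and then
        earns a factor \<open>\<theta> \<le> 1 / 2\<close>, so its mean factor
        \<open>1 - v * (1 - \<theta>)\<close> is at most \<open>1 - s\<close>. This is the origin of
        the 2 in the assumption on \<open>lone\<close>.\<close>
      also have "\<dots> \<le> (1 - s) ^ i * (1 - s) + \<theta> ^ (Suc k - n0)"
      proof -
        have "2 * s * (1 / 2) \<le> v * (1 - \<theta>)" using v \<theta> s by (intro mult_mono) auto
        then show ?thesis using s by (intro add_right_mono mult_left_mono) auto
      qed
      finally have "S * ((1 - v) * g (Suc k) + \<theta> * v * g k) \<le> S * ((1 - s) ^ Suc i + \<theta> ^ (Suc k - n0))"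
        using S by (intro mult_left_mono) (auto simp: mult.commute)
      then show ?thesis unfolding e1 e2 S_def[symmetric] by (simp add: algebra_simps)
    qed
    finally show ?thesis by (simp add: l_def k)
  qed
qed

definition both_full :: "nat \<Rightarrow> nat \<Rightarrow> nat \<Rightarrow> real" where
  "both_full n M d = freq n (M + d) (\<lambda>w. full n (take M w) \<and> full n (drop d w))"

lemma both_full_eq:
  assumes d: "d \<le> M"
  shows "both_full n M d = mean n (M - d) (\<lambda>b. (freq n d (\<lambda>a. full n (a @ b)))\<^sup>2)"
proof -
  have "both_full n M d = mean n (d + ((M - d) + d)) (\<lambda>w. of_bool (full n (take M w) \<and> full n (drop d w)))"
    using d by (simp add: both_full_def freq_def add.commute[of d M])
  \<comment> \<open>Fullness depends only on the set of letters, so \<open>b @ c\<close> may be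
    replaced by \<open>c @ b\<close>; the two unshared pieces then play the same role and a square
    appears.\<close>
  also have "\<dots> = mean n d (\<lambda>a. mean n (M - d) (\<lambda>b. mean n d (\<lambda>c. of_bool (full n (a @ b)) * of_bool (full n (c @ b)))))"
    unfolding mean_append by (intro mean_cong) (use d in \<open>auto simp: words_def full_def\<close>)
  also have "\<dots> = mean n d (\<lambda>a. mean n (M - d) (\<lambda>b. of_bool (full n (a @ b)) * freq n d (\<lambda>c. full n (c @ b))))"
    by (simp only: mean_cmult freq_def)
  also have "\<dots> = mean n (M - d) (\<lambda>b. (freq n d (\<lambda>a. full n (a @ b)))\<^sup>2)"
    by (subst mean_swap) (simp only: mean_cmult_right freq_def power2_eq_square)
  finally show ?thesis .
qed

text \<open>Given the letters shared by two windows, these are conditionally independent. Hence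
  \<open>both_full\<close> is a second moment of a conditional probability, which decreases with the
  amount of conditioning by Jensen's inequality.\<close>

lemma both_full_antimono:
  assumes n: "1 \<le> n" and d: "K \<le> d" "d \<le> M"
  shows "both_full n M d \<le> both_full n M K"
proof -
  define f where "f = (\<lambda>b. freq n K (\<lambda>a. full n (a @ b)))"
  have "both_full n M d = mean n (M - d) (\<lambda>b. (mean n (d - K) (\<lambda>e. f (e @ b)))\<^sup>2)"
  proof (subst both_full_eq[OF d(2)], intro mean_cong arg_cong[where f = "\<lambda>x. x\<^sup>2"])
    fix b
    have "freq n d (\<lambda>a. full n (a @ b)) = mean n (K + (d - K)) (\<lambda>a. of_bool (full n (a @ b)))"
      using d by (simp add: freq_def)
    also have "\<dots> = mean n (d - K) (\<lambda>e. f (e @ b))"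
      unfolding mean_append by (subst mean_swap) (simp add: f_def freq_def)
    finally show "freq n d (\<lambda>a. full n (a @ b)) = mean n (d - K) (\<lambda>e. f (e @ b))" .
  qed
  also have "\<dots> \<le> mean n (M - d) (\<lambda>b. mean n (d - K) (\<lambda>e. (f (e @ b))\<^sup>2))"
    by (intro mean_mono mean_square_le n)
  also have "\<dots> = mean n (d - K + (M - d)) (\<lambda>b. (f b)\<^sup>2)"
    unfolding mean_append by (rule mean_swap)
  also have "d - K + (M - d) = M - K" using d by simp
  also have "mean n (M - K) (\<lambda>b. (f b)\<^sup>2) = both_full n M K"
    using both_full_eq[of K M n] d by (simp add: f_def)
  finally show ?thesis .
qed

text \<open>The second window has to redraw every type missing from the shared letters, at a cost of
  at most \<open>K / n\<close> per type. Only one of the two equal factors is bounded this way; the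
  other keeps the first window full, hence a uniform surjection. The cutoff n0 separates two cases:
  n - n0 types get lost, or more than n0 remain and each step loses one with probability at least
  \<open>(1 - 1 / n0) ^ (M - 1)\<close>.\<close>

lemma both_full_le:
  assumes n: "2 \<le> n" and K: "K \<le> M" "2 * K \<le> n" and n0: "2 \<le> n0" "n0 \<le> n" and M: "1 \<le> M"
  shows "both_full n M K \<le> cover M n *
    ((1 - (1 - 1 / real n0) ^ (M - 1) / 2) ^ K + (real K / real n) ^ (n - n0))"
proof -
  define \<theta> where "\<theta> = real K / real n"
  define s where "s = (1 - 1 / real n0) ^ (M - 1) / 2"
  have \<theta>: "0 \<le> \<theta>" "\<theta> \<le> 1 / 2" using K n by (simp_all add: \<theta>_def field_simps)
  have b: "0 \<le> 1 - 1 / real n0" "1 - 1 / real n0 \<le> 1" using n0 by (simp_all add: field_simps)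
  have s: "0 \<le> s" "s \<le> 1"
    using b power_le_one[OF b, of "M - 1"] by (simp_all add: s_def)
  have lone: "2 * s \<le> lone m k" if "n0 < k" "k \<le> Suc m" "m \<le> M - 1" for m k
  proof -
    have "2 * s \<le> (1 - 1 / real n0) ^ m"
      using b that unfolding s_def by (simp add: power_decreasing)
    also have "\<dots> \<le> (1 - 1 / real k) ^ m"
      using b that n0 by (intro power_mono) (auto simp: frac_le)
    also have "\<dots> \<le> lone m k" using that n0 by (intro lone_ge) auto
    finally show ?thesis .
  qed
  have "both_full n M K = mean n (M - K) (\<lambda>b. freq n K (\<lambda>a. full n (a @ b)) * freq n K (\<lambda>a. full n (a @ b)))"
    by (simp only: both_full_eq[OF K(1)] power2_eq_square)
  also have "\<dots> \<le> mean n (M - K) (\<lambda>b. freq n K (\<lambda>a. full n (a @ b)) * \<theta> ^ card ({1..n} - set b))"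
  proof (intro mean_mono mult_left_mono)
    fix b
    have "freq n K (\<lambda>a. full n (a @ b)) = freq n K (\<lambda>a. {1..n} - set b \<subseteq> set a)"
      by (intro freq_cong) (auto simp: full_def)
    also have "\<dots> \<le> \<theta> ^ card ({1..n} - set b)"
      unfolding \<theta>_def using n by (intro freq_superset_le) auto
    finally show "freq n K (\<lambda>a. full n (a @ b)) \<le> \<theta> ^ card ({1..n} - set b)" .
  qed simp
  also have "\<dots> = mean n (K + (M - K)) (\<lambda>w. of_bool (full n w) * \<theta> ^ card ({1..n} - set (drop K w)))"
    unfolding mean_append freq_def mean_cmult_right[symmetric]
    by (subst mean_swap) (intro mean_cong, auto simp: words_def)
  also have "K + (M - K) = M" using K by simp
  also have "mean n M (\<lambda>w. of_bool (full n w) * \<theta> ^ card ({1..n} - set (drop K w)))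
      = (\<Sum>w | length w = M \<and> set w = {1..n}. \<theta> ^ card ({1..n} - set (drop K w))) / real n ^ M"
    unfolding mean_def sum_of_bool_words words_full_eq[unfolded Collect_conj_eq Collect_mem_eq] by (simp add: words_full_eq)
  also have "\<dots> \<le> surj_num M n * ((1 - s) ^ K + \<theta> ^ (n - n0)) / real n ^ M"
    using sum_surj_words_lost_le[OF \<theta> s lone, where A = "{1..n}" and i = K and m = "M - K"] n0 K M
    by (intro divide_right_mono) auto
  finally show ?thesis by (simp add: cover_def s_def \<theta>_def)
qed

section \<open>Words without a full window\<close>

definition window :: "nat \<Rightarrow> nat \<Rightarrow> 'a list \<Rightarrow> 'a list" where
  "window M i w = take M (drop i w)"

text \<open>Only windows of length exactly M count, so every word shorter than M is unfilled; the
  link to completion times hence starts at time M.\<close>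

definition unfilled :: "nat \<Rightarrow> nat \<Rightarrow> nat list \<Rightarrow> bool" where
  "unfilled n M w \<longleftrightarrow> (\<forall>i. i + M \<le> length w \<longrightarrow> \<not> full n (window M i w))"

definition miss :: "nat \<Rightarrow> nat \<Rightarrow> nat \<Rightarrow> real" where
  "miss n M t = freq n t (unfilled n M)"

lemma miss_nonneg [simp]: "0 \<le> miss n M t"
  by (simp add: miss_def)

lemma miss_le_1: "1 \<le> n \<Longrightarrow> miss n M t \<le> 1"
  by (simp add: miss_def freq_le_1)

lemma unfilled_appendD:
  assumes "unfilled n M (u @ v)"
  shows "unfilled n M u" "unfilled n M v"
proof -
  show "unfilled n M u"
    unfolding unfilled_def
  proof (intro allI impI)
    fix i assume i: "i + M \<le> length u"
    then have "window M i (u @ v) = window M i u" by (simp add: window_def)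
    moreover have "i + M \<le> length (u @ v)" using i by simp
    ultimately show "\<not> full n (window M i u)" using assms unfolding unfilled_def by metis
  qed
  show "unfilled n M v"
    unfolding unfilled_def
  proof (intro allI impI)
    fix i assume i: "i + M \<le> length v"
    have "window M (length u + i) (u @ v) = window M i v" by (simp add: window_def)
    then show "\<not> full n (window M i v)" using assms i unfolding unfilled_def
      by (metis add.assoc add_le_cancel_left length_append)
  qed
qed

lemma freq_append_conj: "freq n (a + b) (\<lambda>w. Q (take a w) \<and> R (drop a w)) = freq n a Q * freq n b R"
  using mean_take_mult_drop[of n a b "\<lambda>w. of_bool (Q w)" "\<lambda>w. of_bool (R w)"]
  by (simp add: freq_def of_bool_conj)

lemma miss_add_le: "miss n M (a + b) \<le> miss n M a * miss n M b"
  unfolding miss_def freq_append_conj[symmetric]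
  by (intro freq_mono) (metis append_take_drop_id unfilled_appendD)

lemma miss_antimono:
  assumes "1 \<le> n" "s \<le> t"
  shows "miss n M t \<le> miss n M s"
proof -
  have "miss n M t \<le> miss n M s * miss n M (t - s)"
    using miss_add_le[of n M s "t - s"] assms by simp
  also have "\<dots> \<le> miss n M s" using assms by (simp add: mult_left_le miss_le_1)
  finally show ?thesis .
qed

lemma miss_mult_le: "1 \<le> n \<Longrightarrow> miss n M (k * L) \<le> miss n M L ^ k"
proof (induction k)
  case 0
  then show ?case by (simp add: miss_le_1)
next
  case (Suc k)
  have "miss n M (Suc k * L) \<le> miss n M L * miss n M (k * L)"
    using miss_add_le[of n M L "k * L"] by simp
  also have "\<dots> \<le> miss n M L * miss n M L ^ k" using Suc by (intro mult_left_mono) auto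
  finally show ?case by simp
qed

lemma freq_window: "1 \<le> n \<Longrightarrow> i + M \<le> N \<Longrightarrow> freq n N (\<lambda>w. Q (window M i w)) = freq n M Q"
  using mean_subword[of n i M N "\<lambda>w. of_bool (Q w)"] by (simp add: freq_def window_def)

text \<open>If neither part contains a full window, a full window of the whole word must cross the
  cut. At most M starting positions do, each full with probability \<open>cover M n\<close>.\<close>

lemma miss_add_ge:
  assumes n: "1 \<le> n"
  shows "miss n M a * miss n M b - real M * cover M n \<le> miss n M (a + b)"
proof -
  define I where "I = {i. a < i + M \<and> i < a \<and> i + M \<le> a + b}"
  have IM: "I \<subseteq> {a - M..<a}" by (auto simp: I_def)
  then have fin: "finite I" using finite_subset by blast
  have "card I \<le> card {a - M..<a}" using IM by (intro card_mono) auto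
  then have cI: "card I \<le> M" by simp
  have "miss n M a * miss n M b \<le> freq n (a + b) (\<lambda>w. unfilled n M w \<or> (\<exists>i\<in>I. full n (window M i w)))"
    unfolding miss_def freq_append_conj[symmetric]
  proof (intro freq_mono)
    fix w assume w: "w \<in> words n (a + b)" and u: "unfilled n M (take a w) \<and> unfilled n M (drop a w)"
    show "unfilled n M w \<or> (\<exists>i\<in>I. full n (window M i w))"
    proof (rule ccontr)
      assume *: "\<not> ?thesis"
      then obtain i where i: "i + M \<le> a + b" "full n (window M i w)" "i \<notin> I"
        using words_length[OF w] by (auto simp: unfilled_def)
      then consider "i + M \<le> a" | "a \<le> i" by (auto simp: I_def)
      then show False
      proof cases
        case 1
        then have "window M i (take a w) = window M i w" by (simp add: window_def drop_take)
        then show False using u i 1 words_length[OF w] by (force simp: unfilled_def)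
      next
        case 2
        then have "window M (i - a) (drop a w) = window M i w" by (simp add: window_def)
        moreover have "i - a + M \<le> length (drop a w)" using 2 i words_length[OF w] by simp
        ultimately show False using u i unfolding unfilled_def by metis
      qed
    qed
  qed
  also have "\<dots> \<le> miss n M (a + b) + freq n (a + b) (\<lambda>w. \<exists>i\<in>I. full n (window M i w))"
    unfolding miss_def by (rule freq_disj_le)
  also have "freq n (a + b) (\<lambda>w. \<exists>i\<in>I. full n (window M i w)) \<le> (\<Sum>i\<in>I. freq n (a + b) (\<lambda>w. full n (window M i w)))"
    by (rule freq_Bex_le[OF fin])
  also have "\<dots> = (\<Sum>i\<in>I. cover M n)"
    by (intro sum.cong) (auto simp: freq_window[OF n] freq_full I_def)
  also have "\<dots> \<le> real M * cover M n"
    using cI by (simp add: mult_right_mono)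
  finally show ?thesis by simp
qed

lemma miss_mult_ge:
  assumes n: "1 \<le> n"
  shows "miss n M L ^ k - real k * (real M * cover M n) \<le> miss n M (k * L)"
proof (induction k)
  case 0
  have "freq n 0 (unfilled n M) = 1 \<or> M = 0"
    by (auto simp: freq_def unfilled_def)
  then show ?case
  proof
    assume "M = 0"
    have "\<not> full n []" using n by (auto simp: full_def)
    then show ?thesis by (simp add: miss_def freq_def unfilled_def window_def \<open>M = 0\<close>)
  qed (simp add: miss_def)
next
  case (Suc k)
  have "miss n M L ^ Suc k - real k * (real M * cover M n)
      \<le> miss n M L * (miss n M L ^ k - real k * (real M * cover M n))"
    using miss_le_1[OF n, of M L] mult_right_mono[of "miss n M L" 1 "real k * (real M * cover M n)"]
    by (simp add: algebra_simps)
  also have "\<dots> \<le> miss n M L * miss n M (k * L)"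
    using Suc by (intro mult_left_mono) auto
  also have "\<dots> \<le> miss n M (Suc k * L) + real M * cover M n"
    using miss_add_ge[OF n, of M L "k * L"] by simp
  finally show ?case by (simp add: algebra_simps)
qed

abbreviation rate :: "nat \<Rightarrow> nat \<Rightarrow> real" where
  "rate n M \<equiv> freq n (Suc M) (leave n M)"

lemma leave_window:
  "leave n M (window (Suc M) i w) \<longleftrightarrow> full n (window M i w) \<and> \<not> full n (window M (Suc i) w)"
  by (simp add: leave_def window_def drop_take)

text \<open>The last full window either sits at the end of the word, or is followed by a window that
  is not full and so marks a clump end. A union bound over these places finishes.\<close>

lemma one_minus_miss_le:
  assumes n: "1 \<le> n" and L: "M \<le> L"
  shows "1 - miss n M L \<le> cover M n + real L * rate n M"
proof -
  have "1 - miss n M L = freq n L (\<lambda>w. \<not> unfilled n M w)"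
    by (simp add: miss_def freq_compl[OF n])
  also have "\<dots> \<le> freq n L (\<lambda>w. full n (window M (L - M) w)
      \<or> (\<exists>i\<in>{..<L - M}. leave n M (window (Suc M) i w)))"
  proof (intro freq_mono)
    fix w assume w: "w \<in> words n L" and nu: "\<not> unfilled n M w"
    define S where "S = {i. i + M \<le> L \<and> full n (window M i w)}"
    have "finite S" by (rule finite_subset[of _ "{..L}"]) (auto simp: S_def)
    moreover have "S \<noteq> {}" using nu words_length[OF w] by (auto simp: S_def unfilled_def)
    ultimately have m: "Max S \<in> S" "\<And>j. j \<in> S \<Longrightarrow> j \<le> Max S" by auto
    have "Suc (Max S) \<notin> S" using m(2)[of "Suc (Max S)"] by auto
    then show "full n (window M (L - M) w) \<or> (\<exists>i\<in>{..<L - M}. leave n M (window (Suc M) i w))"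
    proof (cases "Max S = L - M")
      case False
      then have "Max S < L - M" using m(1) by (auto simp: S_def)
      moreover have "leave n M (window (Suc M) (Max S) w)"
        using m(1) \<open>Suc (Max S) \<notin> S\<close> \<open>Max S < L - M\<close> by (auto simp: leave_window S_def)
      ultimately show ?thesis by blast
    qed (use m(1) in \<open>auto simp: S_def\<close>)
  qed
  also have "\<dots> \<le> freq n L (\<lambda>w. full n (window M (L - M) w))
      + freq n L (\<lambda>w. \<exists>i\<in>{..<L - M}. leave n M (window (Suc M) i w))"
    by (rule freq_disj_le)
  also have "freq n L (\<lambda>w. \<exists>i\<in>{..<L - M}. leave n M (window (Suc M) i w))
      \<le> (\<Sum>i\<in>{..<L - M}. freq n L (\<lambda>w. leave n M (window (Suc M) i w)))"
    by (rule freq_Bex_le) simp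
  also have "\<dots> = (\<Sum>i\<in>{..<L - M}. rate n M)"
    by (intro sum.cong refl freq_window[OF n]) auto
  also have "\<dots> \<le> real L * rate n M" by (auto intro!: mult_right_mono)
  also have "freq n L (\<lambda>w. full n (window M (L - M) w)) = cover M n"
    using freq_window[OF n, of "L - M" M L "full n"] L by (simp add: freq_full)
  finally show ?thesis by simp
qed

text \<open>The type c lost at i is absent from the window at \<open>Suc i\<close>. A full window at
  \<open>i + d\<close> must find c among its letters beyond that window, and for
  \<open>d \<le> K\<close> these are among the next K letters.\<close>

lemma leave_return:
  assumes l: "leave n M (window (Suc M) i w)" and f: "full n (window M (i + d) w)"
    and d: "1 \<le> d" "d \<le> K" and w: "i + Suc M + K \<le> length w" "set w \<subseteq> {1..n}" and M: "1 \<le> M"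
  shows "hd (window (Suc M + K) i w) \<in> set (drop (Suc M) (window (Suc M + K) i w))"
proof -
  have nth: "set (window b a w) = {w ! j | j. a \<le> j \<and> j < a + b}" if "a + b \<le> length w" for a b
  proof -
    have "window b a w = map (\<lambda>k. w ! (a + k)) [0..<b]"
      using that by (intro nth_equalityI) (auto simp: window_def)
    then have "set (window b a w) = {w ! (a + k) | k. k < b}" by auto
    also have "\<dots> = {w ! j | j. a \<le> j \<and> j < a + b}"
      by (auto simp: le_iff_add)
    finally show ?thesis .
  qed
  have full: "full n (window M i w)" "\<not> full n (window M (Suc i) w)"
    using l by (auto simp: leave_window)
  define c where "c = w ! i"
  have hd: "hd (window (Suc M + K) i w) = c"
    using w by (simp add: window_def c_def hd_drop_conv_nth hd_take)
  have "set (window M i w) \<subseteq> insert c (set (window M (Suc i) w))"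
    using w by (subst (1 2) nth) (auto simp: c_def Suc_le_eq le_less)
  then have notin: "c \<notin> set (window M (Suc i) w)"
    using full by (auto simp: full_def)
  have "c \<in> set w" using w by (simp add: c_def)
  then have "c \<in> {1..n}" using w by blast
  then have "c \<in> set (window M (i + d) w)" using f by (auto simp: full_def)
  then obtain j where j: "c = w ! j" "i + d \<le> j" "j < i + d + M"
    using w d by (subst (asm) nth) auto
  have "i + Suc M \<le> j"
  proof (rule ccontr)
    assume "\<not> i + Suc M \<le> j"
    then have "c \<in> set (window M (Suc i) w)" using j d w by (subst nth) auto
    then show False using notin by simp
  qed
  moreover have "drop (Suc M) (window (Suc M + K) i w) = window K (i + Suc M) w"
    by (simp add: window_def drop_take add.commute)
  ultimately show ?thesis
    unfolding hd using j d w by (simp only:) (subst nth, auto)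
qed

text \<open>The three terms are returns within \<open>K\<close> steps, for which the type just lost must reappear;
  returns within \<open>M\<close> steps; and later ones, whose windows are disjoint from the first.\<close>

lemma freq_leave_refill_le:
  assumes n: "1 \<le> n" and M: "1 \<le> M" and K: "K \<le> M" and i: "i + Suc M + M \<le> L"
  shows "freq n L (\<lambda>w. leave n M (window (Suc M) i w) \<and> (\<exists>u\<in>{i<..L - M}. full n (window M u w)))
    \<le> rate n M * (real K / real n) + real M * both_full n M K + real L * (rate n M * cover M n)"
proof -
  define R1 where "R1 = (\<lambda>w. leave n M (take (Suc M) w) \<and> hd w \<in> set (drop (Suc M) w))"
  have "freq n L (\<lambda>w. leave n M (window (Suc M) i w) \<and> (\<exists>u\<in>{i<..L - M}. full n (window M u w)))
    \<le> freq n L (\<lambda>w. R1 (window (Suc M + K) i w)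
      \<or> (\<exists>d\<in>{K<..M}. full n (window M i w) \<and> full n (window M (i + d) w))
      \<or> (\<exists>u\<in>{i + M<..L - M}. leave n M (window (Suc M) i w) \<and> full n (window M u w)))"
  proof (intro freq_mono)
    fix w assume w: "w \<in> words n L"
      and a: "leave n M (window (Suc M) i w) \<and> (\<exists>u\<in>{i<..L - M}. full n (window M u w))"
    then obtain u where u: "i < u" "u \<le> L - M" "full n (window M u w)" by auto
    consider "u \<le> i + K" | "i + K < u" "u \<le> i + M" | "i + M < u" by linarith
    then show "R1 (window (Suc M + K) i w)
      \<or> (\<exists>d\<in>{K<..M}. full n (window M i w) \<and> full n (window M (i + d) w))
      \<or> (\<exists>u\<in>{i + M<..L - M}. leave n M (window (Suc M) i w) \<and> full n (window M u w))"
    proof cases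
      case 1
      have "take (Suc M) (window (Suc M + K) i w) = window (Suc M) i w" by (simp add: window_def)
      then have "R1 (window (Suc M + K) i w)"
        using leave_return[of n M i w "u - i" K] a u 1 K i M words_length[OF w] words_set[OF w]
        by (simp add: R1_def)
      then show ?thesis by blast
    next
      case 2
      then have "u - i \<in> {K<..M}" "full n (window M (i + (u - i)) w)" using u by auto
      then show ?thesis using a by (auto simp: leave_window)
    next
      case 3
      then show ?thesis using a u by auto
    qed
  qed
  also have "\<dots> \<le> freq n L (\<lambda>w. R1 (window (Suc M + K) i w))
      + (freq n L (\<lambda>w. \<exists>d\<in>{K<..M}. full n (window M i w) \<and> full n (window M (i + d) w))
      + freq n L (\<lambda>w. \<exists>u\<in>{i + M<..L - M}. leave n M (window (Suc M) i w) \<and> full n (window M u w)))"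
    by (intro order_trans[OF freq_disj_le] add_left_mono freq_disj_le)
  also have "freq n L (\<lambda>w. R1 (window (Suc M + K) i w)) \<le> rate n M * (real K / real n)"
    using freq_leave_return_le[OF n M, of K] i K
    by (subst freq_window[OF n]) (auto simp: R1_def)
  also have "freq n L (\<lambda>w. \<exists>d\<in>{K<..M}. full n (window M i w) \<and> full n (window M (i + d) w))
      \<le> (\<Sum>d\<in>{K<..M}. freq n L (\<lambda>w. full n (window M i w) \<and> full n (window M (i + d) w)))"
    by (rule freq_Bex_le) simp
  also have "\<dots> \<le> (\<Sum>d\<in>{K<..M}. both_full n M K)"
  proof (intro sum_mono)
    fix d assume d: "d \<in> {K<..M}"
    have "freq n L (\<lambda>w. full n (window M i w) \<and> full n (window M (i + d) w))
        = freq n L (\<lambda>w. (\<lambda>z. full n (take M z) \<and> full n (drop d z)) (window (M + d) i w))"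
      by (intro freq_cong) (simp add: window_def drop_take add.commute)
    also have "\<dots> = both_full n M d"
      unfolding both_full_def using d i by (intro freq_window[OF n]) auto
    also have "\<dots> \<le> both_full n M K" using d by (intro both_full_antimono n) auto
    finally show "freq n L (\<lambda>w. full n (window M i w) \<and> full n (window M (i + d) w)) \<le> both_full n M K" .
  qed
  also have "\<dots> \<le> real M * both_full n M K"
    by (auto intro!: mult_right_mono simp: both_full_def)
  also have "freq n L (\<lambda>w. \<exists>u\<in>{i + M<..L - M}. leave n M (window (Suc M) i w) \<and> full n (window M u w))
      \<le> (\<Sum>u\<in>{i + M<..L - M}. freq n L (\<lambda>w. leave n M (window (Suc M) i w) \<and> full n (window M u w)))"
    by (rule freq_Bex_le) simp
  also have "\<dots> = (\<Sum>u\<in>{i + M<..L - M}. rate n M * cover M n)"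
  proof (intro sum.cong refl)
    fix u assume u: "u \<in> {i + M<..L - M}"
    then have "i + Suc M \<le> u" "u + M \<le> L" using i by auto
    then show "freq n L (\<lambda>w. leave n M (window (Suc M) i w) \<and> full n (window M u w)) = rate n M * cover M n"
      using mean_subwords_mult[OF n, of i "Suc M" u M L "\<lambda>w. of_bool (leave n M w)" "\<lambda>w. of_bool (full n w)"] i
      by (simp add: freq_def freq_full[symmetric] window_def of_bool_conj)
  qed
  also have "\<dots> \<le> real L * (rate n M * cover M n)"
    by (auto intro!: mult_right_mono mult_nonneg_nonneg)
  finally show ?thesis by simp
qed

text \<open>The events \<open>D i\<close>, a clump end at i with no later full window, exclude each
  other, so their probabilities add up to at most that of a full window. Positions stop at
  \<open>L - 2 * M\<close> to leave room for the further letters inspected by the return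
  estimate.\<close>

lemma one_minus_miss_ge:
  assumes n: "1 \<le> n" and M: "1 \<le> M" and K: "K \<le> M"
  shows "real (L - 2 * M) * (rate n M - (rate n M * (real K / real n) + real M * both_full n M K + real L * (rate n M * cover M n)))
    \<le> 1 - miss n M L"
proof -
  define D where "D = (\<lambda>i w. leave n M (window (Suc M) i w) \<and> \<not> (\<exists>u\<in>{i<..L - M}. full n (window M u w)))"
  define I where "I = {..<L - 2 * M}"
  have "real (L - 2 * M) * (rate n M - (rate n M * (real K / real n) + real M * both_full n M K + real L * (rate n M * cover M n)))
      = (\<Sum>i\<in>I. rate n M - (rate n M * (real K / real n) + real M * both_full n M K + real L * (rate n M * cover M n)))"
    by (simp add: I_def)
  also have "\<dots> \<le> (\<Sum>i\<in>I. freq n L (D i))"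
  proof (intro sum_mono)
    fix i assume i: "i \<in> I"
    then have "i + Suc M + M \<le> L" by (auto simp: I_def)
    have "freq n L (D i) = rate n M - freq n L (\<lambda>w. leave n M (window (Suc M) i w) \<and> (\<exists>u\<in>{i<..L - M}. full n (window M u w)))"
      unfolding D_def freq_conj_diff using i by (subst freq_window[OF n]) (auto simp: I_def)
    then show "rate n M - (rate n M * (real K / real n) + real M * both_full n M K + real L * (rate n M * cover M n)) \<le> freq n L (D i)"
      using freq_leave_refill_le[OF n M K \<open>i + Suc M + M \<le> L\<close>] by linarith
  qed
  also have "\<dots> = mean n L (\<lambda>w. \<Sum>i\<in>I. of_bool (D i w))"
    by (simp add: mean_sum freq_def)
  also have "\<dots> \<le> freq n L (\<lambda>w. \<not> unfilled n M w)"
    unfolding freq_def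
  proof (intro mean_mono)
    fix w assume w: "w \<in> words n L"
    define J where "J = {i \<in> I. D i w}"
    have J: "i + M \<le> L \<and> full n (window M i w)" if "i \<in> J" for i
      using that by (auto simp: J_def D_def I_def leave_window)
    have "i = j" if "i \<in> J" "j \<in> J" for i j
    proof (rule ccontr)
      assume "i \<noteq> j"
      then have "i < j \<or> j < i" by auto
      then show False using J[OF that(1)] J[OF that(2)] that by (auto simp: J_def D_def)
    qed
    then have "card J \<le> 1" by (intro card_le_Suc0_iff_eq[THEN iffD2, simplified One_nat_def[symmetric]]) (auto simp: J_def I_def)
    moreover have "card J = 0" if "unfilled n M w"
    proof -
      have "J = {}" using J that words_length[OF w] unfolding unfilled_def by blast
      then show ?thesis by simp
    qed
    moreover have "(\<Sum>i\<in>I. of_bool (D i w)) = real (card J)"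
      by (simp add: J_def I_def Int_def)
    ultimately show "(\<Sum>i\<in>I. of_bool (D i w)) \<le> (of_bool (\<not> unfilled n M w) :: real)"
      by (cases "unfilled n M w") auto
  qed
  also have "\<dots> = 1 - miss n M L" by (simp add: miss_def freq_compl[OF n])
  finally show ?thesis .
qed

section \<open>Asymptotics of the rate\<close>

lemma cover_tendsto_1:
  assumes n: "1 \<le> n"
  shows "(\<lambda>N. cover (m + N) n) \<longlonglongrightarrow> 1"
proof (rule tendsto_sandwich)
  have b: "0 \<le> 1 - 1 / real n" "1 - 1 / real n < 1" using n by (simp_all add: field_simps)
  have "(\<lambda>N. 1 - real n * ((1 - 1 / real n) ^ m * (1 - 1 / real n) ^ N)) \<longlonglongrightarrow> 1 - real n * ((1 - 1 / real n) ^ m * 0)"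
    using b by (intro tendsto_intros LIMSEQ_realpow_zero)
  then show "(\<lambda>N. 1 - real n * (1 - 1 / real n) ^ (m + N)) \<longlonglongrightarrow> 1"
    by (simp add: power_add)
  show "\<forall>\<^sub>F N in sequentially. 1 - real n * (1 - 1 / real n) ^ (m + N) \<le> cover (m + N) n"
  proof (intro always_eventually allI)
    fix N show "1 - real n * (1 - 1 / real n) ^ (m + N) \<le> cover (m + N) n"
      using one_minus_cover_le[OF n, of "m + N"] by linarith
  qed
  show "\<forall>\<^sub>F N in sequentially. cover (m + N) n \<le> 1"
    using cover_le_1[OF n] by simp
qed simp

text \<open>With f the odds, \<open>1 - lone = 1 / (1 + f) \<ge> exp (- f)\<close>. Along increasing
  lengths the odds decay geometrically with ratio 1 - 1 / n, so they sum to at most n times the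
  first one, and the telescoping product ends at the limit 1 of \<open>cover\<close>.\<close>

lemma cover_ge:
  assumes n: "1 \<le> n" "n \<le> m"
  shows "exp (- (real n * fail_ratio m n)) \<le> cover m n"
proof -
  define a where "a = 1 - 1 / real n"
  have a: "0 \<le> a" "a < 1" using n by (simp_all add: a_def field_simps)
  have fr: "fail_ratio (m + k) n \<le> a ^ k * fail_ratio m n" for k
  proof (induction k)
    case (Suc k)
    have "fail_ratio (m + Suc k) n \<le> a * fail_ratio (m + k) n"
      using fail_ratio_Suc_le[of n "m + k"] n by (simp add: a_def)
    also have "\<dots> \<le> a * (a ^ k * fail_ratio m n)" using a Suc by (intro mult_left_mono) auto
    finally show ?case by simp
  qed simp
  have prod: "exp (- (\<Sum>k<N. fail_ratio (m + k) n)) * cover (m + N) n \<le> cover m n" for N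
  proof (induction N)
    case (Suc N)
    define f where "f = fail_ratio (m + N) n"
    have "1 - lone (m + N) n = 1 / (1 + f)"
      using lone_conv_fail_ratio[of n "m + N"] n fail_ratio_nonneg[of "m + N" n]
      by (simp add: f_def field_simps add_nonneg_eq_0_iff)
    moreover have "exp (- f) \<le> 1 / (1 + f)"
      using exp_ge_add_one_self[of f] fail_ratio_nonneg[of "m + N" n]
      by (simp add: exp_minus f_def inverse_eq_divide frac_le add_pos_nonneg)
    ultimately have "exp (- f) \<le> 1 - lone (m + N) n" by simp
    then have "exp (- f) * cover (Suc (m + N)) n \<le> (1 - lone (m + N) n) * cover (Suc (m + N)) n"
      by (rule mult_right_mono) simp
    then have "exp (- f) * cover (m + Suc N) n \<le> cover (m + N) n"
      using cover_Suc[of n "m + N"] n by simp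
    then have "exp (- (\<Sum>k<N. fail_ratio (m + k) n)) * (exp (- f) * cover (m + Suc N) n)
        \<le> exp (- (\<Sum>k<N. fail_ratio (m + k) n)) * cover (m + N) n"
      by (intro mult_left_mono) auto
    also have "\<dots> \<le> cover m n" by (rule Suc)
    finally show ?case by (simp add: f_def exp_add[symmetric] exp_diff exp_minus field_simps)
  qed simp
  have "exp (- (real n * fail_ratio m n)) * cover (m + N) n \<le> cover m n" for N
  proof -
    have "(\<Sum>k<N. fail_ratio (m + k) n) \<le> (\<Sum>k<N. a ^ k) * fail_ratio m n"
      unfolding sum_distrib_right by (intro sum_mono fr)
    also have "(\<Sum>k<N. a ^ k) \<le> real n"
    proof -
      have "(\<Sum>k<N. a ^ k) \<le> (\<Sum>k. a ^ k)" using a by (intro sum_le_suminf summable_geometric) auto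
      also have "\<dots> = real n" using a n by (simp add: suminf_geometric a_def)
      finally show ?thesis .
    qed
    finally have "exp (- (real n * fail_ratio m n)) \<le> exp (- (\<Sum>k<N. fail_ratio (m + k) n))"
      by (simp add: mult_right_mono)
    then show ?thesis using prod[of N] by (meson cover_nonneg mult_right_mono order_trans)
  qed
  moreover have "(\<lambda>N. exp (- (real n * fail_ratio m n)) * cover (m + N) n) \<longlonglongrightarrow> exp (- (real n * fail_ratio m n)) * 1"
    by (intro tendsto_intros cover_tendsto_1 n)
  ultimately show ?thesis by (intro LIMSEQ_le_const2[of _ "exp (- (real n * fail_ratio m n))"]) auto
qed

text \<open>The same telescoping with \<open>1 - lone \<le> exp (- lone)\<close> and the lower bound
  of \<open>lone_ge\<close>, whose geometric series sums to
  \<open>n * (1 - 1 / n) ^ m\<close>.\<close>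

lemma cover_le:
  assumes n: "2 \<le> n" "n \<le> m"
  shows "cover m n \<le> exp (- (real n * (1 - 1 / real n) ^ m))"
proof -
  define a where "a = 1 - 1 / real n"
  have a: "0 \<le> a" "a < 1" using n by (simp_all add: a_def field_simps)
  have prod: "cover m n \<le> exp (- (\<Sum>k<N. a ^ (m + k))) * cover (m + N) n" for N
  proof (induction N)
    case (Suc N)
    have "a ^ (m + N) \<le> lone (m + N) n" using lone_ge[of n "m + N"] n by (simp add: a_def)
    then have "1 - lone (m + N) n \<le> exp (- (a ^ (m + N)))"
      using exp_ge_add_one_self[of "- (a ^ (m + N))"] by linarith
    then have "cover (m + N) n \<le> exp (- (a ^ (m + N))) * cover (m + Suc N) n"
      using cover_Suc[of n "m + N"] n by (simp add: mult_right_mono)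
    then have "exp (- (\<Sum>k<N. a ^ (m + k))) * cover (m + N) n
        \<le> exp (- (\<Sum>k<N. a ^ (m + k))) * (exp (- (a ^ (m + N))) * cover (m + Suc N) n)"
      by (intro mult_left_mono) auto
    with Suc have "cover m n \<le> exp (- (\<Sum>k<N. a ^ (m + k))) * (exp (- (a ^ (m + N))) * cover (m + Suc N) n)"
      by (rule order_trans)
    also have "\<dots> = exp (- (\<Sum>k<Suc N. a ^ (m + k))) * cover (m + Suc N) n"
      by (simp only: mult.assoc[symmetric] exp_add[symmetric]) simp
    finally show ?case .
  qed simp
  have "cover m n \<le> exp (- (a ^ m * (\<Sum>k<N. a ^ k)))" for N
  proof -
    have "cover m n \<le> exp (- (\<Sum>k<N. a ^ (m + k))) * 1"
      using n by (intro order_trans[OF prod[of N]] mult_left_mono cover_le_1) auto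
    then show ?thesis by (simp add: power_add sum_distrib_left)
  qed
  moreover have "(\<lambda>N. \<Sum>k<N. a ^ k) \<longlonglongrightarrow> 1 / (1 - a)"
    using geometric_sums[of a] a by (simp add: sums_def)
  then have "(\<lambda>N. exp (- (a ^ m * (\<Sum>k<N. a ^ k)))) \<longlonglongrightarrow> exp (- (a ^ m * (1 / (1 - a))))"
    by (intro tendsto_intros)
  ultimately have "cover m n \<le> exp (- (a ^ m * (1 / (1 - a))))"
    by (intro LIMSEQ_le_const) auto
  then show ?thesis using n by (simp add: a_def mult.commute)
qed

text \<open>The inequality \<open>v \<le> exp (- \<beta> (1 - v))\<close> also holds near the spurious root \<open>v = 1\<close>, which
  \<open>v < 1\<close> and \<open>\<beta> > 2\<close> exclude.\<close>

lemma lone_le_exp: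
  assumes n: "1 \<le> n" "n \<le> m" and \<beta>: "2 < \<beta>" "\<beta> \<le> real (Suc m) / real n * (1 - 1 / real n)"
  shows "lone m n \<le> exp (- \<beta> + \<beta> * exp (- \<beta> / 2))"
    and "lone m n \<le> c \<Longrightarrow> lone m n \<le> exp (- \<beta> + \<beta> * c)"
proof -
  define v where "v = lone m n"
  define y where "y = (1 - v) / real n"
  have v: "0 \<le> v" "v < 1" using lone_less_1[OF n] by (simp_all add: v_def)
  have y: "0 \<le> y" "y \<le> 1" "y \<le> 1 / real n" using v n by (simp_all add: y_def field_simps)
  \<comment> \<open>The bound \<open>ln (1 + y) \<ge> y - y\<^sup>2\<close> with
    \<open>y \<le> 1 / n\<close> costs the factor 1 - 1 / n that is built into the assumption on
    \<beta>.\<close>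
  have "exp (\<beta> * (1 - v)) \<le> (1 + y) ^ Suc m"
  proof -
    have "\<beta> * (1 - v) \<le> real (Suc m) / real n * (1 - 1 / real n) * (1 - v)"
      using \<beta> v by (intro mult_right_mono) auto
    also have "\<dots> = real (Suc m) * (y * (1 - 1 / real n))"
      by (simp add: y_def)
    also have "\<dots> \<le> real (Suc m) * (y - y\<^sup>2)"
    proof (rule mult_left_mono)
      have "y * y \<le> y * (1 / real n)" using y by (intro mult_left_mono) auto
      then show "y * (1 - 1 / real n) \<le> y - y\<^sup>2" by (simp only: right_diff_distrib power2_eq_square mult_1_right)
    qed simp
    also have "\<dots> \<le> real (Suc m) * ln (1 + y)"
      by (rule mult_left_mono[OF ln_one_plus_pos_lower_bound[OF y(1,2)]]) simp
    finally have *: "\<beta> * (1 - v) \<le> real (Suc m) * ln (1 + y)" .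
    have "exp (real (Suc m) * ln (1 + y)) = exp (ln (1 + y)) ^ Suc m" by (rule exp_of_nat_mult)
    also have "exp (ln (1 + y)) = 1 + y" using y by simp
    finally show ?thesis using * by (metis exp_le_cancel_iff)
  qed
  then have "v * exp (\<beta> * (1 - v)) \<le> v * (1 + y) ^ Suc m" using v by (intro mult_left_mono) auto
  also have "\<dots> \<le> 1" using lone_le[OF n] by (simp add: v_def y_def)
  finally have key: "v \<le> exp (- (\<beta> * (1 - v)))"
    by (simp only: exp_minus inverse_eq_divide pos_le_divide_eq exp_gt_zero)
  have "1 < \<beta> * (1 - v)"
  proof (rule ccontr)
    define x where "x = \<beta> * (1 - v)"
    assume "\<not> 1 < \<beta> * (1 - v)"
    then have x: "0 < x" "x \<le> 1" using v \<beta> by (auto simp: x_def)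
    have "exp (- x) \<le> 1 - x / 2"
    proof -
      have "x * x \<le> x" using x by (intro mult_left_le) auto
      then have "1 \<le> (1 + x) * (1 - x / 2)" by (simp add: algebra_simps)
      also have "\<dots> \<le> exp x * (1 - x / 2)" using x by (intro mult_right_mono exp_ge_add_one_self) auto
      finally show ?thesis by (simp add: exp_minus field_simps)
    qed
    with key have "x / 2 \<le> 1 - v" by (simp add: x_def)
    then have "\<beta> * (1 - v) \<le> 2 * (1 - v)" by (simp add: x_def)
    then have "\<beta> \<le> 2" by (rule mult_right_le_imp_le) (use v in simp)
    then show False using \<beta> by simp
  qed
  \<comment> \<open>The implicit inequality \<open>key\<close> now improves in rounds:
    \<open>v \<le> exp (- 1) \<le> 1 / 2\<close>, then \<open>v \<le> exp (- \<beta> / 2)\<close>,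
    which is fed in once more. The second claim leaves this last input free, for a further
    round.\<close>
  then have "exp (- (\<beta> * (1 - v))) \<le> exp (- 1)" by simp
  with key have "v \<le> exp (- 1)" by (rule order_trans)
  also have "exp (- 1) \<le> (1 / 2 :: real)"
    using exp_ge_add_one_self[of 1] by (simp add: exp_minus field_simps)
  finally have "\<beta> * (1 / 2) \<le> \<beta> * (1 - v)" using \<beta> by (intro mult_left_mono) auto
  then have "exp (- (\<beta> * (1 - v))) \<le> exp (- \<beta> / 2)" by simp
  with key have "v \<le> exp (- \<beta> / 2)" by (rule order_trans)
  moreover have c: "v \<le> exp (- \<beta> + \<beta> * c)" if "v \<le> c" for c
  proof -
    have "\<beta> * v \<le> \<beta> * c" using that \<beta> by (intro mult_left_mono) auto
    then have "- (\<beta> * (1 - v)) \<le> - \<beta> + \<beta> * c" by (simp add: algebra_simps)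
    then show ?thesis using key by (meson exp_le_cancel_iff order_trans)
  qed
  ultimately show "lone m n \<le> exp (- \<beta> + \<beta> * exp (- \<beta> / 2))" by (simp add: v_def)
  show "lone m n \<le> exp (- \<beta> + \<beta> * c)" if "lone m n \<le> c" using c[of c] that by (simp add: v_def)
qed

section \<open>Asymptotics of \<open>V\<close>, \<open>C\<close> and \<open>R\<close>\<close>

locale subcritical_window =
  fixes \<alpha> :: real and M :: "nat \<Rightarrow> nat"
  assumes \<alpha>: "0 < \<alpha>" "\<alpha> < 1"
    and M_def: "M = (\<lambda>n. nat \<lfloor>\<alpha> * real n * ln (real n)\<rfloor>)"
begin

text \<open>A closed-form lower bound for \<open>M n / n * (1 - 1 / n)\<close>; the
  \<open>- 1\<close> absorbs the floor in \<open>M n\<close>.\<close>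

definition \<beta> :: "nat \<Rightarrow> real" where
  "\<beta> n = (\<alpha> * real n * ln (real n) - 1) / real n * (1 - 1 / real n)"

text \<open>This is \<open>(1 - 1 / n) ^ M n\<close> with the exponent before rounding down, hence a
  lower bound free of floors.\<close>

definition low :: "nat \<Rightarrow> real" where
  "low n = exp (\<alpha> * real n * ln (real n) * ln (1 - 1 / real n))"

definition up :: "nat \<Rightarrow> real" where
  "up n = exp (- \<beta> n + \<beta> n * exp (- \<beta> n / 2))"

text \<open>One more round of the bound, with \<open>V n \<le> 2 * n powr (- \<alpha>)\<close> as
  input. Up to logarithms the relative error drops from n powr (- \<alpha> / 2) in \<open>up\<close>
  to n powr (- \<alpha>); against the size n powr (1 - \<alpha>) of \<open>ln (C n)\<close>, the
  former would only suffice for \<alpha> > 2/3, the latter for \<alpha> > 1/2.\<close>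

definition up2 :: "nat \<Rightarrow> real" where
  "up2 n = exp (- \<beta> n + 2 * \<beta> n * real n powr (- \<alpha>))"

definition V :: "nat \<Rightarrow> real" where
  "V n = lone (M n - 1) n"

lemma M_le: "1 \<le> n \<Longrightarrow> real (M n) \<le> \<alpha> * real n * ln (real n)"
  using \<alpha> by (simp add: M_def of_nat_floor)

lemma M_ge: "\<alpha> * real n * ln (real n) - 1 \<le> real (M n)"
  unfolding M_def by linarith

lemma eventually_M_gt: "\<forall>\<^sub>F n in sequentially. n < M n"
proof -
  have "\<forall>\<^sub>F n in sequentially. real n < \<alpha> * real n * ln (real n) - 1"
    using \<alpha> by real_asymp
  then show ?thesis
  proof eventually_elim
    case (elim n)
    then have "real n < real (M n)" using M_ge[of n] by linarith
    then show ?case by simp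
  qed
qed

lemma eventually_\<beta>_gt: "\<forall>\<^sub>F n in sequentially. 2 < \<beta> n"
  unfolding \<beta>_def using \<alpha> by real_asymp

lemma low_le_power:
  assumes "2 \<le> n" "real m \<le> \<alpha> * real n * ln (real n)"
  shows "low n \<le> (1 - 1 / real n) ^ m"
proof -
  have b: "0 < 1 - 1 / real n" "1 - 1 / real n \<le> 1" using assms by (simp_all add: field_simps)
  then have "ln (1 - 1 / real n) \<le> 0" by simp
  then have "low n \<le> exp (real m * ln (1 - 1 / real n))"
    unfolding low_def using assms by (simp add: mult_right_mono_neg)
  also have "\<dots> = (1 - 1 / real n) ^ m" using b by (simp add: exp_of_nat_mult)
  finally show ?thesis .
qed

lemma eventually_V_bounds: "\<forall>\<^sub>F n in sequentially. low n \<le> V n \<and> V n \<le> up n \<and> (\<forall>c\<ge>V n. V n \<le> exp (- \<beta> n + \<beta> n * c))"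
  using eventually_ge_at_top[of 2] eventually_M_gt eventually_\<beta>_gt
proof eventually_elim
  case (elim n)
  have "low n \<le> (1 - 1 / real n) ^ (M n - 1)"
    using elim M_le[of n] by (intro low_le_power) auto
  also have "\<dots> \<le> V n" unfolding V_def using elim by (intro lone_ge) auto
  finally have l: "low n \<le> V n" .
  have \<beta>: "\<beta> n \<le> real (Suc (M n - 1)) / real n * (1 - 1 / real n)"
    unfolding \<beta>_def using elim M_ge[of n]
    by (intro mult_right_mono divide_right_mono) (auto simp: field_simps)
  have nM: "1 \<le> n" "n \<le> M n - 1" using elim by auto
  show ?case
    using l lone_le_exp[OF nM elim(3) \<beta>] unfolding V_def up_def by blast
qed

lemma low_asymp: "(\<lambda>n. real n powr \<alpha> * low n) \<longlonglongrightarrow> 1"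
  unfolding low_def using \<alpha> by real_asymp

lemma up_asymp: "(\<lambda>n. real n powr \<alpha> * up n) \<longlonglongrightarrow> 1"
  unfolding up_def \<beta>_def using \<alpha> by real_asymp

lemma V_asymp: "(\<lambda>n. real n powr \<alpha> * V n) \<longlonglongrightarrow> 1"
proof (rule tendsto_sandwich[OF _ _ low_asymp up_asymp])
  show "\<forall>\<^sub>F n in sequentially. real n powr \<alpha> * low n \<le> real n powr \<alpha> * V n"
    by (rule eventually_mono[OF eventually_V_bounds]) (rule mult_left_mono, blast, simp)
  show "\<forall>\<^sub>F n in sequentially. real n powr \<alpha> * V n \<le> real n powr \<alpha> * up n"
    by (rule eventually_mono[OF eventually_V_bounds]) (rule mult_left_mono, blast, simp)
qed

lemma V_tendsto_0: "V \<longlonglongrightarrow> 0"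
proof -
  have "(\<lambda>n. real n powr (- \<alpha>) * (real n powr \<alpha> * V n)) \<longlonglongrightarrow> 0 * 1"
    by (intro tendsto_mult V_asymp) (use \<alpha> in real_asymp)
  moreover have "\<forall>\<^sub>F n in sequentially. real n powr (- \<alpha>) * (real n powr \<alpha> * V n) = V n"
    using eventually_gt_at_top[of 0] by eventually_elim (simp add: powr_minus)
  ultimately show ?thesis unfolding mult_zero_left by (rule Lim_transform_eventually)
qed

lemma eventually_V_le_up2: "\<forall>\<^sub>F n in sequentially. V n \<le> up2 n"
proof -
  have "\<forall>\<^sub>F n in sequentially. real n powr \<alpha> * V n < 2"
    using order_tendstoD(2)[OF V_asymp, of 2] by simp
  then show ?thesis
    using eventually_V_bounds eventually_gt_at_top[of 0]
  proof eventually_elim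
    case (elim n)
    have "V n \<le> 2 * real n powr (- \<alpha>)"
      using elim(1,3) by (simp add: powr_minus field_simps)
    then have "V n \<le> exp (- \<beta> n + \<beta> n * (2 * real n powr (- \<alpha>)))" using elim by blast
    then show ?case by (simp add: up2_def mult_ac)
  qed
qed

lemma eventually_ln_cover_bounds:
  "\<forall>\<^sub>F n in sequentially. - (real n * (V n / (1 - V n))) \<le> ln (cover (M n) n) \<and>
     ln (cover (M n) n) \<le> - (real n * low n) \<and> 0 < cover (M n) n"
proof (rule eventually_mono[OF eventually_conj[OF eventually_ge_at_top[of "2 :: nat"] eventually_M_gt]])
  fix n assume elim: "2 \<le> n \<and> n < M n"
  have pos: "0 < cover (M n) n" using elim by (intro cover_pos) auto
  \<comment> \<open>The bound \<open>cover_ge\<close> involves the odds at length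
    \<open>M n\<close>, whereas \<open>V\<close> is taken at \<open>M n - 1\<close>; the odds
    decrease with the length.\<close>
  have "fail_ratio (Suc (M n - 1)) n \<le> (1 - 1 / real n) * fail_ratio (M n - 1) n"
    using elim by (intro fail_ratio_Suc_le) auto
  also have "\<dots> \<le> fail_ratio (M n - 1) n" by (rule mult_left_le_one_le) (use elim in auto)
  also have "\<dots> = V n / (1 - V n)" unfolding V_def using elim by (intro fail_ratio_conv_lone) auto
  finally have "fail_ratio (M n) n \<le> V n / (1 - V n)" using elim by simp
  then have "exp (- (real n * (V n / (1 - V n)))) \<le> exp (- (real n * fail_ratio (M n) n))"
    by (simp only: exp_le_cancel_iff neg_le_iff_le) (rule mult_left_mono, auto)
  also have "\<dots> \<le> cover (M n) n" using elim by (intro cover_ge) auto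
  finally have 1: "- (real n * (V n / (1 - V n))) \<le> ln (cover (M n) n)"
    using pos by (simp add: ln_ge_iff)
  have "cover (M n) n \<le> exp (- (real n * (1 - 1 / real n) ^ M n))"
    using elim by (intro cover_le) auto
  also have "\<dots> \<le> exp (- (real n * low n))"
    using elim low_le_power[of n "M n"] M_le[of n] by (auto intro!: mult_left_mono)
  finally have "ln (cover (M n) n) \<le> ln (exp (- (real n * low n)))"
    using pos by (subst ln_le_cancel_iff) auto
  then have 2: "ln (cover (M n) n) \<le> - (real n * low n)" by simp
  show "- (real n * (V n / (1 - V n))) \<le> ln (cover (M n) n) \<and>
     ln (cover (M n) n) \<le> - (real n * low n) \<and> 0 < cover (M n) n"
    using 1 2 pos by blast
qed

abbreviation C :: "nat \<Rightarrow> real" where "C n \<equiv> cover (M n) n"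
abbreviation R :: "nat \<Rightarrow> real" where "R n \<equiv> coupon_rate n (M n)"

lemma eventually_R_eq: "\<forall>\<^sub>F n in sequentially. R n = (1 - 1 / real n) * V n * C n \<and> rate n (M n) = R n"
  using eventually_ge_at_top[of 1] eventually_M_gt
proof eventually_elim
  case (elim n)
  then obtain m where m: "M n = Suc m" by (cases "M n") auto
  show ?case
    using coupon_rate_eq[of n m] freq_leave[of n m] elim m by (simp add: V_def)
qed

lemma eventually_V_ge: "\<forall>\<^sub>F n in sequentially. real n powr (- \<alpha>) / 2 \<le> V n"
proof -
  have "\<forall>\<^sub>F n in sequentially. 1 / 2 < real n powr \<alpha> * V n"
    using order_tendstoD(1)[OF V_asymp, of "1 / 2"] by simp
  then show ?thesis
    using eventually_gt_at_top[of 0] by eventually_elim (simp add: powr_minus field_simps)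
qed

lemma eventually_pos:
  "\<forall>\<^sub>F n in sequentially. 0 < V n \<and> 0 < C n \<and> 0 < R n"
  using eventually_V_ge eventually_ln_cover_bounds eventually_R_eq eventually_ge_at_top[of 2]
proof eventually_elim
  case (elim n)
  have "0 < real n powr (- \<alpha>)" using elim by simp
  then have V: "0 < V n" using elim(1) by linarith
  have "0 < 1 - 1 / real n" using elim by (simp add: field_simps)
  then show ?case using V elim by simp
qed

lemma ln_cover_asymp: "(\<lambda>n. ln (C n) / real n powr (1 - \<alpha>)) \<longlonglongrightarrow> - 1"
proof (rule tendsto_sandwich)
  have n: "real n / real n powr (1 - \<alpha>) = real n powr \<alpha>" if "0 < n" for n
    using that by (simp add: powr_diff)
  show "\<forall>\<^sub>F n in sequentially. - (real n powr \<alpha> * V n / (1 - V n)) \<le> ln (C n) / real n powr (1 - \<alpha>)"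
    using eventually_ln_cover_bounds eventually_gt_at_top[of 0]
  proof eventually_elim
    case (elim n)
    have "- (real n powr \<alpha> * V n / (1 - V n)) = - (real n * (V n / (1 - V n))) / real n powr (1 - \<alpha>)"
      unfolding n[OF elim(2), symmetric] by simp
    also have "\<dots> \<le> ln (C n) / real n powr (1 - \<alpha>)"
      using elim by (intro divide_right_mono) auto
    finally show ?case .
  qed
  show "\<forall>\<^sub>F n in sequentially. ln (C n) / real n powr (1 - \<alpha>) \<le> - (real n powr \<alpha> * low n)"
    using eventually_ln_cover_bounds eventually_gt_at_top[of 0]
  proof eventually_elim
    case (elim n)
    have "ln (C n) / real n powr (1 - \<alpha>) \<le> - (real n * low n) / real n powr (1 - \<alpha>)"
      using elim by (intro divide_right_mono) auto
    also have "\<dots> = - (real n powr \<alpha> * low n)"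
      unfolding n[OF elim(2), symmetric] by simp
    finally show ?case .
  qed
  have "(\<lambda>n. - (real n powr \<alpha> * V n / (1 - V n))) \<longlonglongrightarrow> - (1 / (1 - 0))"
    by (intro tendsto_intros V_asymp V_tendsto_0) simp
  then show "(\<lambda>n. - (real n powr \<alpha> * V n / (1 - V n))) \<longlonglongrightarrow> - 1" by simp
  show "(\<lambda>n. - (real n powr \<alpha> * low n)) \<longlonglongrightarrow> - 1"
    by (intro tendsto_intros low_asymp)
qed

text \<open>The factors of \<open>R n\<close> other than \<open>C n\<close> are of polynomial size
  and contribute only O(ln n).\<close>

lemma ln_rate_asymp: "(\<lambda>n. ln (R n) / real n powr (1 - \<alpha>)) \<longlonglongrightarrow> - 1"
proof -
  have "(\<lambda>n. ln (real n powr \<alpha> * V n) * (real n powr (1 - \<alpha>)) powr (- 1)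
        + (ln (1 - 1 / real n) - \<alpha> * ln (real n)) / real n powr (1 - \<alpha>) + ln (C n) / real n powr (1 - \<alpha>))
      \<longlonglongrightarrow> ln 1 * 0 + 0 + - 1"
  proof (intro tendsto_add tendsto_mult ln_cover_asymp tendsto_ln V_asymp)
    show "(\<lambda>n. (real n powr (1 - \<alpha>)) powr (- 1)) \<longlonglongrightarrow> 0" using \<alpha> by real_asymp
    show "(\<lambda>n. (ln (1 - 1 / real n) - \<alpha> * ln (real n)) / real n powr (1 - \<alpha>)) \<longlonglongrightarrow> 0"
      using \<alpha> by real_asymp
  qed simp
  moreover have "\<forall>\<^sub>F n in sequentially. ln (real n powr \<alpha> * V n) * (real n powr (1 - \<alpha>)) powr (- 1)
        + (ln (1 - 1 / real n) - \<alpha> * ln (real n)) / real n powr (1 - \<alpha>) + ln (C n) / real n powr (1 - \<alpha>)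
      = ln (R n) / real n powr (1 - \<alpha>)"
    using eventually_R_eq eventually_pos eventually_ge_at_top[of 2]
  proof eventually_elim
    case (elim n)
    have "0 < 1 - 1 / real n" using elim by (simp add: field_simps)
    then have "ln (R n) = ln (1 - 1 / real n) + ln (V n) + ln (C n)"
      using elim by (simp add: ln_mult)
    moreover have "ln (real n powr \<alpha> * V n) = \<alpha> * ln (real n) + ln (V n)"
      using elim by (simp add: ln_mult ln_powr)
    moreover have "0 < real n powr (1 - \<alpha>)" using elim by simp
    ultimately show ?case by (simp add: powr_minus field_simps)
  qed
  ultimately show ?thesis by (simp add: tendsto_cong)
qed

text \<open>A ratio limit needs \<open>ln (C n)\<close> up to o(1), although it is of order n powr
  (1 - \<alpha>). The bounds from \<open>up2\<close> and \<open>low\<close> deviate by at most order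
  n powr (1 - 2 * \<alpha>) * ln n, which is where \<alpha> > 1/2 enters.\<close>

lemma rate_asymp:
  assumes "1 / 2 < \<alpha>"
  shows "(\<lambda>n. real n powr (- \<alpha>) * exp (- (real n powr (1 - \<alpha>))) / R n) \<longlonglongrightarrow> 1"
proof -
  have d: "(\<lambda>n. ln (C n) + real n powr (1 - \<alpha>)) \<longlonglongrightarrow> 0"
  proof (rule tendsto_sandwich)
    have up2_0: "up2 \<longlonglongrightarrow> 0"
      unfolding up2_def \<beta>_def using \<alpha> by real_asymp
    then have "\<forall>\<^sub>F n in sequentially. up2 n < 1" by (rule order_tendstoD) simp
    then show "\<forall>\<^sub>F n in sequentially. real n powr (1 - \<alpha>) - real n * (up2 n / (1 - up2 n)) \<le> ln (C n) + real n powr (1 - \<alpha>)"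
      using eventually_ln_cover_bounds eventually_V_le_up2 eventually_pos
    proof eventually_elim
      case (elim n)
      have "V n / (1 - V n) \<le> up2 n / (1 - up2 n)"
        using elim by (intro frac_le) auto
      then have "real n * (V n / (1 - V n)) \<le> real n * (up2 n / (1 - up2 n))"
        by (intro mult_left_mono) auto
      then show ?case using elim by linarith
    qed
    show "\<forall>\<^sub>F n in sequentially. ln (C n) + real n powr (1 - \<alpha>) \<le> real n powr (1 - \<alpha>) - real n * low n"
      using eventually_ln_cover_bounds by eventually_elim linarith
    show "(\<lambda>n. real n powr (1 - \<alpha>) - real n * (up2 n / (1 - up2 n))) \<longlonglongrightarrow> 0"
      unfolding up2_def \<beta>_def using \<alpha> assms by real_asymp
    show "(\<lambda>n. real n powr (1 - \<alpha>) - real n * low n) \<longlonglongrightarrow> 0"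
      unfolding low_def using \<alpha> assms by real_asymp
  qed
  have "(\<lambda>n. 1 / ((1 - 1 / real n) * (real n powr \<alpha> * V n) * exp (ln (C n) + real n powr (1 - \<alpha>)))) \<longlonglongrightarrow> 1 / (1 * 1 * exp 0)"
    by (intro tendsto_intros V_asymp d) (simp_all, real_asymp)
  then have "(\<lambda>n. 1 / ((1 - 1 / real n) * (real n powr \<alpha> * V n) * exp (ln (C n) + real n powr (1 - \<alpha>)))) \<longlonglongrightarrow> 1"
    by simp
  moreover have "\<forall>\<^sub>F n in sequentially. 1 / ((1 - 1 / real n) * (real n powr \<alpha> * V n) * exp (ln (C n) + real n powr (1 - \<alpha>)))
      = real n powr (- \<alpha>) * exp (- (real n powr (1 - \<alpha>))) / R n"
    using eventually_R_eq eventually_pos eventually_ge_at_top[of 2]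
    by eventually_elim (simp add: exp_add exp_minus powr_minus divide_inverse mult_ac)
  ultimately show ?thesis by (rule Lim_transform_eventually)
qed

text \<open>\<open>C n / R n\<close> is the mean number of full windows per clump, of true order n
  powr \<alpha>; a linear bound suffices for comparing single windows with clump ends.\<close>

lemma eventually_cover_le_rate: "\<forall>\<^sub>F n in sequentially. C n \<le> 4 * real n * R n"
  using eventually_R_eq eventually_pos eventually_V_ge eventually_ge_at_top[of 2]
proof eventually_elim
  case (elim n)
  have "1 / (2 * real n) \<le> real n powr (- \<alpha>) / 2"
  proof -
    have "real n powr (- 1) \<le> real n powr (- \<alpha>)" using elim \<alpha> by (intro powr_mono) auto
    then show ?thesis using elim by (simp add: powr_minus field_simps)
  qed
  then have "1 / (2 * real n) \<le> V n" using elim by linarith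
  moreover have "1 / 2 \<le> 1 - 1 / real n" using elim by (simp add: field_simps)
  ultimately have "1 / 2 * (1 / (2 * real n)) * C n \<le> (1 - 1 / real n) * V n * C n"
    using elim by (intro mult_right_mono mult_mono) auto
  then show ?case using elim by (simp add: field_simps)
qed

text \<open>The block length \<open>L\<close> has to dominate \<open>M * C / R\<close>, which is \<open>O(n\<^sup>3)\<close>, while \<open>L * C\<close> tends
  to \<open>0\<close>; \<open>lag\<close> is chosen such that \<open>(K n / n) ^ lag \<le> n powr (- 4)\<close>.\<close>

definition L :: "nat \<Rightarrow> nat" where "L n = n ^ 5"
definition K :: "nat \<Rightarrow> nat" where "K n = nat \<lfloor>real n powr ((1 + \<alpha>) / 2)\<rfloor>"
definition lag :: nat where "lag = nat \<lceil>8 / (1 - \<alpha>)\<rceil>"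
definition q :: "nat \<Rightarrow> real" where "q n = 1 - miss n (M n) (L n)"

section \<open>Probability of a full window in one block\<close>

lemma eventually_M_le_square: "\<forall>\<^sub>F n in sequentially. real (M n) \<le> real n ^ 2"
proof -
  have "\<forall>\<^sub>F n in sequentially. \<alpha> * real n * ln (real n) \<le> real n ^ 2"
    using \<alpha> by real_asymp
  then show ?thesis using eventually_ge_at_top[of 1]
    by eventually_elim (use M_le order_trans in blast)
qed

lemma L_cover_tendsto_0: "(\<lambda>n. real (L n) * C n) \<longlonglongrightarrow> 0"
proof (rule tendsto_sandwich[where f = "\<lambda>_. 0"])
  have "\<forall>\<^sub>F n in sequentially. 1 / 2 < real n powr \<alpha> * low n"
    using order_tendstoD(1)[OF low_asymp, of "1 / 2"] by simp
  then show "\<forall>\<^sub>F n in sequentially. real (L n) * C n \<le> real n ^ 5 * exp (- (real n powr (1 - \<alpha>)) / 2)"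
    using eventually_ln_cover_bounds eventually_gt_at_top[of 0]
  proof eventually_elim
    case (elim n)
    have "real n powr (1 - \<alpha>) / 2 \<le> real n powr (1 - \<alpha>) * (real n powr \<alpha> * low n)"
      using elim(1) mult_left_mono[of "1 / 2" "real n powr \<alpha> * low n" "real n powr (1 - \<alpha>)"] by simp
    also have "\<dots> = real n * low n"
      using elim by (simp add: mult.assoc[symmetric] powr_add[symmetric])
    finally have "ln (C n) \<le> - (real n powr (1 - \<alpha>)) / 2" using elim by linarith
    then have "C n \<le> exp (- (real n powr (1 - \<alpha>)) / 2)"
      using elim by (metis exp_le_cancel_iff exp_ln)
    then show ?case by (simp add: L_def mult_left_mono)
  qed
  show "(\<lambda>n. real n ^ 5 * exp (- (real n powr (1 - \<alpha>)) / 2)) \<longlonglongrightarrow> 0"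
    using \<alpha> by real_asymp
qed auto

text \<open>The cutoff \<open>n0 = n - lag\<close> is within a constant of n, so
  \<open>(1 - 1 / n0) ^ (M n - 1)\<close> keeps the order n powr (- \<alpha>), and its product with
  \<open>K n\<close> grows like a power of n. The power - 4 beats the later factor:
  \<open>M n * C n\<close> is at most \<open>4 * n ^ 3 * R n\<close>.\<close>

lemma eventually_both_full_le:
  "\<forall>\<^sub>F n in sequentially. both_full n (M n) (K n)
     \<le> C n * (exp (- (real n powr ((1 - \<alpha>) / 2)) / 8) + real n powr (- 4))"
proof -
  define c where "c = real lag"
  have 1: "\<forall>\<^sub>F n in sequentially. 1 / 2 < real n powr \<alpha> * exp (\<alpha> * real n * ln (real n) * ln (1 - 1 / (real n - c)))"
  proof -
    have "(\<lambda>n. real n powr \<alpha> * exp (\<alpha> * real n * ln (real n) * ln (1 - 1 / (real n - c)))) \<longlonglongrightarrow> 1"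
      using \<alpha> by real_asymp
    from order_tendstoD(1)[OF this, of "1 / 2"] show ?thesis by simp
  qed
  have 2: "\<forall>\<^sub>F n in sequentially. real n powr ((1 + \<alpha>) / 2) \<le> real n / 2" using \<alpha> by real_asymp
  have 3: "\<forall>\<^sub>F n in sequentially. real n powr ((1 + \<alpha>) / 2) / 2 \<le> real n powr ((1 + \<alpha>) / 2) - 1" using \<alpha> by real_asymp
  show ?thesis
    using 1 2 3 eventually_ge_at_top[of "lag + 2"] eventually_M_gt
  proof eventually_elim
    case (elim n)
    define n0 where "n0 = n - lag"
    have n0: "2 \<le> n0" "n0 \<le> n" "n - n0 = lag" "real n0 = real n - c" using elim by (auto simp: n0_def c_def)
    have n: "2 \<le> n" using elim by simp
    have Kle: "real (K n) \<le> real n powr ((1 + \<alpha>) / 2)" by (simp add: K_def of_nat_floor)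
    have Kge: "real n powr ((1 + \<alpha>) / 2) / 2 \<le> real (K n)" using elim(3) unfolding K_def by linarith
    have K2: "2 * K n \<le> n" using Kle elim(2) by linarith
    define s where "s = (1 - 1 / real n0) ^ (M n - 1) / 2"
    have b: "0 < 1 - 1 / real n0" "1 - 1 / real n0 \<le> 1" using n0(1) by (simp_all add: field_simps)
    have s1: "s \<le> 1" using power_le_one[of "1 - 1 / real n0" "M n - 1"] b by (simp add: s_def)
    have "real n powr (- \<alpha>) / 4 \<le> s"
    proof -
      have "ln (1 - 1 / real n0) \<le> 0" using b by simp
      then have "exp (\<alpha> * real n * ln (real n) * ln (1 - 1 / (real n - c))) \<le> exp (real (M n - 1) * ln (1 - 1 / real n0))"
        unfolding n0(4)[symmetric] using M_le[of n] n by (auto intro!: mult_right_mono_neg)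
      also have "\<dots> = (1 - 1 / real n0) ^ (M n - 1)"
        using b by (simp add: exp_of_nat_mult)
      finally have "real n powr \<alpha> * exp (\<alpha> * real n * ln (real n) * ln (1 - 1 / (real n - c)))
          \<le> real n powr \<alpha> * (1 - 1 / real n0) ^ (M n - 1)"
        by (intro mult_left_mono) auto
      with elim(1) have "1 / 2 \<le> real n powr \<alpha> * (1 - 1 / real n0) ^ (M n - 1)" by linarith
      then show ?thesis using n by (simp add: s_def powr_minus field_simps)
    qed
    moreover have "0 \<le> s" using b by (simp add: s_def)
    ultimately have "real n powr (- \<alpha>) / 4 * (real n powr ((1 + \<alpha>) / 2) / 2) \<le> s * real (K n)"
      using Kge by (intro mult_mono) auto
    moreover have "real n powr (- \<alpha>) * real n powr ((1 + \<alpha>) / 2) = real n powr ((1 - \<alpha>) / 2)"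
      unfolding powr_add[symmetric] by (rule arg_cong[where f = "(powr) (real n)"]) (simp add: field_simps)
    ultimately have sK: "real n powr ((1 - \<alpha>) / 2) / 8 \<le> s * real (K n)" by simp
    have "(1 - s) ^ K n \<le> exp (- s) ^ K n"
      using s1 exp_ge_add_one_self[of "- s"] by (intro power_mono) auto
    also have "\<dots> = exp (- (s * real (K n)))"
      by (simp add: exp_of_nat_mult[symmetric] mult.commute)
    also have "\<dots> \<le> exp (- (real n powr ((1 - \<alpha>) / 2)) / 8)" using sK by simp
    finally have t1: "(1 - s) ^ K n \<le> exp (- (real n powr ((1 - \<alpha>) / 2)) / 8)" .
    have "(real (K n) / real n) ^ lag \<le> (real n powr (- (1 - \<alpha>) / 2)) ^ lag"
    proof (intro power_mono)
      have "real n powr (- (1 - \<alpha>) / 2) = real n powr ((1 + \<alpha>) / 2 - 1)"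
        by (rule arg_cong[where f = "(powr) (real n)"]) (simp add: field_simps)
      also have "\<dots> = real n powr ((1 + \<alpha>) / 2) / real n" by (subst powr_diff) (use n in simp)
      finally show "real (K n) / real n \<le> real n powr (- (1 - \<alpha>) / 2)"
        using Kle by (simp add: divide_right_mono)
    qed auto
    also have "\<dots> = real n powr (- (1 - \<alpha>) / 2 * c)"
      using n by (simp add: c_def powr_realpow[symmetric] powr_powr)
    also have "\<dots> \<le> real n powr (- 4)"
    proof (intro powr_mono)
      have "8 / (1 - \<alpha>) \<le> c" unfolding c_def lag_def by linarith
      then show "- (1 - \<alpha>) / 2 * c \<le> - 4" using \<alpha> by (simp add: field_simps)
    qed (use n in auto)
    finally have t2: "(real (K n) / real n) ^ lag \<le> real n powr (- 4)" .
    have "both_full n (M n) (K n) \<le> C n * ((1 - s) ^ K n + (real (K n) / real n) ^ (n - n0))"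
      unfolding s_def using n K2 n0 elim by (intro both_full_le) auto
    also have "\<dots> \<le> C n * (exp (- (real n powr ((1 - \<alpha>) / 2)) / 8) + real n powr (- 4))"
      unfolding n0(3) using t1 t2 by (intro mult_left_mono add_mono) auto
    finally show ?case .
  qed
qed

lemma q_asymp: "(\<lambda>n. q n / (real (L n) * R n)) \<longlonglongrightarrow> 1"
proof (rule tendsto_sandwich)
  define \<eta> where "\<eta> = (\<lambda>n. exp (- (real n powr ((1 - \<alpha>) / 2)) / 8) + real n powr (- 4))"
  \<comment> \<open>The terms subtracted from 1 are, relative to \<open>R n\<close>, the chance of a
    return within \<open>K n\<close> steps, of one within \<open>M n\<close> steps, and of a later
    disjoint full window in the same block.\<close>
  define B where "B = (\<lambda>n. 1 - real n powr ((1 + \<alpha>) / 2) / real n - 4 * real n ^ 3 * \<eta> n - real (L n) * C n)"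
  have pos: "\<forall>\<^sub>F n in sequentially. 0 < real (L n) * R n"
    using eventually_pos eventually_gt_at_top[of 0] by eventually_elim (simp add: L_def)
  show "\<forall>\<^sub>F n in sequentially. q n / (real (L n) * R n) \<le> 1 + 4 * real n / real n ^ 5"
    using eventually_cover_le_rate eventually_R_eq eventually_pos eventually_M_le_square eventually_ge_at_top[of 1]
  proof eventually_elim
    case (elim n)
    have "M n \<le> L n"
    proof -
      have "real n ^ 2 \<le> real n ^ 5" using elim by (intro power_increasing) auto
      then have "real (M n) \<le> real (L n)" unfolding L_def of_nat_power using elim by linarith
      then show ?thesis by simp
    qed
    then have "q n \<le> C n + real (L n) * R n"
      using one_minus_miss_le[of n "M n" "L n"] elim by (simp add: q_def)
    also have "\<dots> \<le> 4 * real n * R n + real (L n) * R n" using elim by simp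
    finally have "q n / (real (L n) * R n) \<le> (4 * real n * R n + real (L n) * R n) / (real (L n) * R n)"
      using elim by (intro divide_right_mono) auto
    also have "\<dots> = 1 + 4 * real n / real n ^ 5" using elim by (simp add: L_def field_simps)
    finally show ?case .
  qed
  show "\<forall>\<^sub>F n in sequentially. real (L n - 2 * M n) / real (L n) * B n \<le> q n / (real (L n) * R n)"
    using eventually_cover_le_rate eventually_R_eq eventually_pos eventually_M_le_square eventually_ge_at_top[of 1]
      eventually_both_full_le eventually_M_gt
  proof eventually_elim
    case (elim n)
    have Kle: "real (K n) \<le> real n powr ((1 + \<alpha>) / 2)" by (simp add: K_def of_nat_floor)
    also have "\<dots> \<le> real n powr 1" using elim \<alpha> by (intro powr_mono) auto
    finally have KM: "K n \<le> M n" using elim by simp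
    have e: "0 \<le> \<eta> n" by (simp add: \<eta>_def)
    have "real (M n) * both_full n (M n) (K n) \<le> real n ^ 2 * (C n * \<eta> n)"
      using elim by (intro mult_mono) (auto simp: both_full_def \<eta>_def)
    also have "\<dots> \<le> real n ^ 2 * (4 * real n * R n * \<eta> n)"
      using elim e by (intro mult_left_mono mult_right_mono) auto
    also have "\<dots> = R n * (4 * real n ^ 3 * \<eta> n)" by (simp add: power2_eq_square power3_eq_cube)
    finally have 1: "real (M n) * both_full n (M n) (K n) \<le> R n * (4 * real n ^ 3 * \<eta> n)" .
    have 2: "R n * (real (K n) / real n) \<le> R n * (real n powr ((1 + \<alpha>) / 2) / real n)"
      using elim Kle by (intro mult_left_mono divide_right_mono) auto
    have "R n * B n \<le> R n - (R n * (real (K n) / real n) + real (M n) * both_full n (M n) (K n) + real (L n) * (R n * C n))"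
      using 1 2 by (simp add: B_def right_diff_distrib mult_ac)
    then have "real (L n - 2 * M n) * (R n * B n) \<le> real (L n - 2 * M n) *
        (R n - (R n * (real (K n) / real n) + real (M n) * both_full n (M n) (K n) + real (L n) * (R n * C n)))"
      by (intro mult_left_mono) auto
    also have "\<dots> \<le> q n"
      using one_minus_miss_ge[of n "M n" "K n" "L n"] elim KM by (simp add: q_def)
    finally have "real (L n - 2 * M n) * (R n * B n) / (real (L n) * R n) \<le> q n / (real (L n) * R n)"
      using elim by (intro divide_right_mono) auto
    moreover have "a * (r * b) / (l * r) = a / l * b" if "r \<noteq> 0" for a b l r :: real
      using that by simp
    ultimately show ?case using elim(3) by (metis less_irrefl)
  qed
  show "(\<lambda>n. 1 + 4 * real n / real n ^ 5) \<longlonglongrightarrow> 1" by real_asymp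
  have "(\<lambda>n. real (L n - 2 * M n) / real (L n)) \<longlonglongrightarrow> 1"
  proof (rule tendsto_sandwich)
    show "\<forall>\<^sub>F n in sequentially. 1 - 2 * real n ^ 2 / real n ^ 5 \<le> real (L n - 2 * M n) / real (L n)"
      using eventually_M_le_square eventually_ge_at_top[of 1]
    proof eventually_elim
      case (elim n)
      have "real (L n) - 2 * real n ^ 2 \<le> real (L n - 2 * M n)" using elim by linarith
      then have "(real (L n) - 2 * real n ^ 2) / real (L n) \<le> real (L n - 2 * M n) / real (L n)"
        by (intro divide_right_mono) auto
      then show ?case using elim by (simp add: L_def diff_divide_distrib)
    qed
    show "\<forall>\<^sub>F n in sequentially. real (L n - 2 * M n) / real (L n) \<le> 1"
      using eventually_ge_at_top[of 1] by eventually_elim (simp add: L_def divide_le_eq)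
    show "(\<lambda>n. 1 - 2 * real n ^ 2 / real n ^ 5) \<longlonglongrightarrow> 1" by real_asymp
  qed simp
  moreover have "B \<longlonglongrightarrow> 1 - 0 - 0 - 0"
    unfolding B_def \<eta>_def
    by (intro tendsto_diff L_cover_tendsto_0) (use \<alpha> in real_asymp)+
  ultimately have "(\<lambda>n. real (L n - 2 * M n) / real (L n) * B n) \<longlonglongrightarrow> 1 * (1 - 0 - 0 - 0)"
    by (rule tendsto_mult)
  then show "(\<lambda>n. real (L n - 2 * M n) / real (L n) * B n) \<longlonglongrightarrow> 1" by simp
qed

lemma q_tendsto_0: "q \<longlonglongrightarrow> 0"
proof -
  have "(\<lambda>n. real (L n) * R n) \<longlonglongrightarrow> 0"
  proof (rule tendsto_sandwich[where f = "\<lambda>_. 0"])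
    have "\<forall>\<^sub>F n in sequentially. V n < 1"
      using order_tendstoD(2)[OF V_tendsto_0, of 1] by simp
    then show "\<forall>\<^sub>F n in sequentially. real (L n) * R n \<le> real (L n) * C n"
      using eventually_R_eq eventually_pos eventually_ge_at_top[of 1]
    proof eventually_elim
      case (elim n)
      have "(1 - 1 / real n) * V n * C n \<le> 1 * 1 * C n"
        using elim by (intro mult_right_mono mult_mono) auto
      then show ?case using elim by (auto intro: mult_left_mono)
    qed
    show "\<forall>\<^sub>F n in sequentially. 0 \<le> real (L n) * R n"
      using eventually_pos by eventually_elim auto
  qed (auto intro: L_cover_tendsto_0)
  then have "(\<lambda>n. q n / (real (L n) * R n) * (real (L n) * R n)) \<longlonglongrightarrow> 1 * 0"
    by (intro tendsto_mult q_asymp)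
  moreover have "\<forall>\<^sub>F n in sequentially. q n / (real (L n) * R n) * (real (L n) * R n) = q n"
    using eventually_pos eventually_gt_at_top[of 0] by eventually_elim (simp add: L_def)
  ultimately show ?thesis by (simp add: tendsto_cong)
qed

lemma q_bounds: "1 \<le> n \<Longrightarrow> 0 \<le> q n" "q n \<le> 1"
  using miss_le_1[of n "M n" "L n"] miss_nonneg[of n "M n" "L n"] by (simp_all add: q_def)

section \<open>Exponential bounds and limit for \<open>miss\<close>\<close>

text \<open>Valid for each n and uniformly in z, as the tail domination requires. The floor and the
  incomplete last block cost at most two blocks, whence the term \<open>2 * q n\<close>.\<close>

lemma miss_le_exp:
  assumes n: "1 \<le> n" and z: "0 \<le> z"
  shows "miss n (M n) (nat \<lfloor>z\<rfloor>) \<le> exp (- (q n * z / real (L n)) + 2 * q n)"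
proof -
  define k where "k = nat \<lfloor>z\<rfloor> div L n"
  have L: "1 \<le> real (L n)" using n by (simp add: L_def)
  have k: "z / real (L n) - 2 \<le> real k"
  proof -
    have "nat \<lfloor>z\<rfloor> < (k + 1) * L n"
      using L dividend_less_div_times[of "L n" "nat \<lfloor>z\<rfloor>"] by (simp add: k_def)
    then have "real (nat \<lfloor>z\<rfloor>) \<le> (real k + 1) * real (L n)"
      by (metis of_nat_1 of_nat_add of_nat_le_iff of_nat_mult less_imp_le)
    moreover have "z \<le> real (nat \<lfloor>z\<rfloor>) + 1" using z by linarith
    ultimately have "z \<le> (real k + 2) * real (L n)" using L by (simp add: algebra_simps)
    then show ?thesis using L by (simp add: field_simps)
  qed
  have "miss n (M n) (nat \<lfloor>z\<rfloor>) \<le> miss n (M n) (k * L n)"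
    by (rule miss_antimono[OF n]) (simp add: k_def)
  also have "\<dots> \<le> (1 - q n) ^ k" using miss_mult_le[OF n] by (simp add: q_def)
  also have "\<dots> \<le> exp (- q n) ^ k"
    using exp_ge_add_one_self[of "- q n"] q_bounds[of n] n by (intro power_mono) auto
  also have "\<dots> = exp (- (q n * real k))" by (simp add: exp_of_nat_mult[symmetric] mult.commute)
  also have "\<dots> \<le> exp (- (q n * z / real (L n)) + 2 * q n)"
    using mult_left_mono[OF k, of "q n"] q_bounds(1)[OF n] by (simp add: algebra_simps)
  finally show ?thesis .
qed

text \<open>Here the number of blocks is rounded up. The power \<open>(1 - q n) ^ k\<close> is
  bounded below through \<open>ln (1 - q) \<ge> - q - 2 * q\<^sup>2\<close>, and every block
  boundary costs \<open>M n * C n\<close>.\<close>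

lemma miss_ge_exp:
  assumes n: "1 \<le> n" and z: "0 \<le> z" and q: "q n \<le> 1 / 2"
  shows "exp (- ((z / real (L n) + 1) * (q n + 2 * (q n)\<^sup>2))) - (z / real (L n) + 1) * (real (M n) * C n)
    \<le> miss n (M n) (nat \<lfloor>z\<rfloor>)"
proof -
  define k where "k = Suc (nat \<lfloor>z\<rfloor> div L n)"
  have L: "1 \<le> real (L n)" using n by (simp add: L_def)
  have k: "real k \<le> z / real (L n) + 1"
  proof -
    have "real (nat \<lfloor>z\<rfloor> div L n) \<le> real (nat \<lfloor>z\<rfloor>) / real (L n)" by (rule of_nat_div_le_of_nat)
    also have "\<dots> \<le> z / real (L n)" using z L by (intro divide_right_mono) (auto simp: of_nat_floor)
    finally show ?thesis by (simp add: k_def)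
  qed
  have q0: "0 \<le> q n" using q_bounds n by simp
  have "exp (- ((z / real (L n) + 1) * (q n + 2 * (q n)\<^sup>2))) \<le> exp (real k * ln (1 - q n))"
  proof -
    have "- ((z / real (L n) + 1) * (q n + 2 * (q n)\<^sup>2)) \<le> - (real k * (q n + 2 * (q n)\<^sup>2))"
      using mult_right_mono[OF k, of "q n + 2 * (q n)\<^sup>2"] q0 by simp
    also have "\<dots> \<le> real k * ln (1 - q n)"
      using mult_left_mono[OF ln_one_minus_pos_lower_bound[OF q0 q], of "real k"] by (simp add: algebra_simps)
    finally show ?thesis by simp
  qed
  also have "\<dots> = (1 - q n) ^ k" using q by (simp add: exp_of_nat_mult)
  finally have 1: "exp (- ((z / real (L n) + 1) * (q n + 2 * (q n)\<^sup>2))) \<le> (1 - q n) ^ k" .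
  have "real k * (real (M n) * C n) \<le> (z / real (L n) + 1) * (real (M n) * C n)"
    by (intro mult_right_mono k) auto
  then have "exp (- ((z / real (L n) + 1) * (q n + 2 * (q n)\<^sup>2))) - (z / real (L n) + 1) * (real (M n) * C n)
      \<le> (1 - q n) ^ k - real k * (real (M n) * C n)" using 1 by linarith
  also have "\<dots> \<le> miss n (M n) (k * L n)"
    using miss_mult_ge[OF n, of "M n" "L n" k] by (simp add: q_def)
  also have "\<dots> \<le> miss n (M n) (nat \<lfloor>z\<rfloor>)"
    using L dividend_less_div_times[of "L n" "nat \<lfloor>z\<rfloor>"]
    by (intro miss_antimono[OF n]) (simp add: k_def)
  finally show ?thesis .
qed

text \<open>The scale \<nu> is only required to be equivalent to \<open>R\<close>, so that the
  result covers both \<mu> and the explicit scale for \<alpha> > 1/2.\<close>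

lemma miss_tendsto:
  assumes \<nu>: "(\<lambda>n. \<nu> n / R n) \<longlonglongrightarrow> 1" and x: "0 \<le> x"
  shows "(\<lambda>n. miss n (M n) (nat \<lfloor>x / \<nu> n\<rfloor>)) \<longlonglongrightarrow> exp (- x)"
proof (rule tendsto_sandwich[where f = "\<lambda>n. exp (- ((q n * (x / \<nu> n) / real (L n)) + q n + 2 * ((q n * (x / \<nu> n) / real (L n)) * q n) + 2 * (q n)\<^sup>2))
        - (x / \<nu> n / real (L n) * (real (M n) * C n) + real (M n) * C n)" and h = "\<lambda>n. exp (- (q n * (x / \<nu> n) / real (L n)) + 2 * q n)"])
  have \<nu>_pos: "\<forall>\<^sub>F n in sequentially. 0 < \<nu> n"
  proof -
    have "\<forall>\<^sub>F n in sequentially. 0 < \<nu> n / R n" using order_tendstoD(1)[OF \<nu>, of 0] by simp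
    then show ?thesis using eventually_pos by eventually_elim (simp add: zero_less_divide_iff)
  qed
  have inv: "(\<lambda>n. x * (1 / (\<nu> n / R n))) \<longlonglongrightarrow> x * (1 / 1)" by (intro tendsto_intros \<nu>) simp
  have zq: "(\<lambda>n. q n * (x / \<nu> n) / real (L n)) \<longlonglongrightarrow> x"
  proof -
    have "(\<lambda>n. x * (1 / (\<nu> n / R n)) * (q n / (real (L n) * R n))) \<longlonglongrightarrow> x * (1 / 1) * 1"
      by (intro tendsto_mult[OF inv q_asymp])
    moreover have "\<forall>\<^sub>F n in sequentially. x * (1 / (\<nu> n / R n)) * (q n / (real (L n) * R n)) = q n * (x / \<nu> n) / real (L n)"
      using eventually_pos \<nu>_pos by eventually_elim simp
    ultimately show ?thesis by (simp add: tendsto_cong)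
  qed
  \<comment> \<open>About x / (\<open>R n\<close> * \<open>L n\<close>) boundaries cost
    \<open>M n * C n\<close> each; the total is of order \<open>n ^ 3 / n ^ 5\<close>, thanks to the
    fifth power in \<open>L\<close>.\<close>
  have "(\<lambda>n. real (M n) * C n / (real (L n) * R n)) \<longlonglongrightarrow> 0"
  proof (rule tendsto_sandwich[where f = "\<lambda>_. 0"])
    show "\<forall>\<^sub>F n in sequentially. real (M n) * C n / (real (L n) * R n) \<le> real n ^ 2 * (4 * real n) / real n ^ 5"
      using eventually_pos eventually_M_le_square eventually_cover_le_rate
    proof eventually_elim
      case (elim n)
      have "real (M n) * C n \<le> real n ^ 2 * (4 * real n * R n)"
        using elim by (intro mult_mono) auto
      then have "real (M n) * C n / (real (L n) * R n) \<le> real n ^ 2 * (4 * real n * R n) / (real (L n) * R n)"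
        using elim by (intro divide_right_mono) auto
      moreover have "real n ^ 2 * (4 * real n * r) / (l * r) = real n ^ 2 * (4 * real n) / l" if "r \<noteq> 0" for l r :: real
        using that by simp
      ultimately show ?case using elim(1) by (metis L_def less_irrefl of_nat_power)
    qed
    show "\<forall>\<^sub>F n in sequentially. 0 \<le> real (M n) * C n / (real (L n) * R n)"
      using eventually_pos by eventually_elim auto
    show "(\<lambda>n. real n ^ 2 * (4 * real n) / real n ^ 5) \<longlonglongrightarrow> 0" by real_asymp
  qed simp
  then have zM0: "(\<lambda>n. x * (1 / (\<nu> n / R n)) * (real (M n) * C n / (real (L n) * R n))) \<longlonglongrightarrow> x * (1 / 1) * 0"
    by (intro tendsto_mult[OF inv])
  moreover have "\<forall>\<^sub>F n in sequentially. x * (1 / (\<nu> n / R n)) * (real (M n) * C n / (real (L n) * R n))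
      = x / \<nu> n / real (L n) * (real (M n) * C n)"
    using eventually_pos \<nu>_pos by eventually_elim simp
  ultimately have zM: "(\<lambda>n. x / \<nu> n / real (L n) * (real (M n) * C n)) \<longlonglongrightarrow> 0"
    by (simp add: tendsto_cong)
  have MC: "(\<lambda>n. real (M n) * C n) \<longlonglongrightarrow> 0"
  proof (rule tendsto_sandwich[where f = "\<lambda>_. 0"])
    show "\<forall>\<^sub>F n in sequentially. real (M n) * C n \<le> real (L n) * C n"
      using eventually_M_le_square eventually_ge_at_top[of 1]
    proof eventually_elim
      case (elim n)
      have "real n ^ 2 \<le> real n ^ 5" using elim by (intro power_increasing) auto
      then have "real (M n) \<le> real (L n)" unfolding L_def of_nat_power using elim by linarith
      then show ?case by (rule mult_right_mono) simp
    qed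
  qed (auto intro: L_cover_tendsto_0)
  show "\<forall>\<^sub>F n in sequentially. miss n (M n) (nat \<lfloor>x / \<nu> n\<rfloor>)
      \<le> exp (- (q n * (x / \<nu> n) / real (L n)) + 2 * q n)"
    using \<nu>_pos eventually_ge_at_top[of 1]
  proof eventually_elim
    case (elim n)
    then show ?case using x by (intro miss_le_exp) auto
  qed
  have "(\<lambda>n. exp (- (q n * (x / \<nu> n) / real (L n)) + 2 * q n)) \<longlonglongrightarrow> exp (- x + 2 * 0)"
    by (intro tendsto_intros zq q_tendsto_0)
  then show "(\<lambda>n. exp (- (q n * (x / \<nu> n) / real (L n)) + 2 * q n)) \<longlonglongrightarrow> exp (- x)" by simp
  have "\<forall>\<^sub>F n in sequentially. q n < 1 / 2" using order_tendstoD(2)[OF q_tendsto_0, of "1 / 2"] by simp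
  then show "\<forall>\<^sub>F n in sequentially.
      exp (- ((q n * (x / \<nu> n) / real (L n)) + q n + 2 * ((q n * (x / \<nu> n) / real (L n)) * q n) + 2 * (q n)\<^sup>2))
        - (x / \<nu> n / real (L n) * (real (M n) * C n) + real (M n) * C n)
      \<le> miss n (M n) (nat \<lfloor>x / \<nu> n\<rfloor>)"
    using \<nu>_pos eventually_ge_at_top[of 1]
  proof eventually_elim
    case (elim n)
    have e: "(a / l + 1) * (b + 2 * b\<^sup>2) = b * a / l + b + 2 * ((b * a / l) * b) + 2 * b\<^sup>2" for a b l :: real
      by (simp add: power2_eq_square algebra_simps add_divide_distrib)
    show ?case
      using miss_ge_exp[of n "x / \<nu> n"] elim x unfolding e by (simp add: distrib_right)
  qed
  have "(\<lambda>n. exp (- ((q n * (x / \<nu> n) / real (L n)) + q n + 2 * ((q n * (x / \<nu> n) / real (L n)) * q n) + 2 * (q n)\<^sup>2))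
        - (x / \<nu> n / real (L n) * (real (M n) * C n) + real (M n) * C n))
      \<longlonglongrightarrow> exp (- (x + 0 + 2 * (x * 0) + 2 * 0\<^sup>2)) - (0 + 0)"
    by (intro tendsto_intros zq q_tendsto_0 zM MC)
  then show "(\<lambda>n. exp (- ((q n * (x / \<nu> n) / real (L n)) + q n + 2 * ((q n * (x / \<nu> n) / real (L n)) * q n) + 2 * (q n)\<^sup>2))
        - (x / \<nu> n / real (L n) * (real (M n) * C n) + real (M n) * C n)) \<longlonglongrightarrow> exp (- x)" by simp
qed

text \<open>The integrable tail bound for dominated convergence: \<open>q n < 1 / 2\<close> makes
  \<open>2 * q n\<close> at most 1, and a ratio \<open>q n / (L n * R n)\<close> above 1/2 gives the
  decay rate 1/2.\<close>

lemma eventually_miss_le: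
  "\<forall>\<^sub>F n in sequentially. 0 < R n \<and> (\<forall>x\<ge>0. miss n (M n) (nat \<lfloor>x / R n\<rfloor>) \<le> exp (1 - x / 2))"
proof -
  have "\<forall>\<^sub>F n in sequentially. q n < 1 / 2" using order_tendstoD(2)[OF q_tendsto_0, of "1 / 2"] by simp
  moreover have "\<forall>\<^sub>F n in sequentially. 1 / 2 < q n / (real (L n) * R n)"
    using order_tendstoD(1)[OF q_asymp, of "1 / 2"] by simp
  ultimately show ?thesis
    using eventually_pos eventually_ge_at_top[of 1]
  proof eventually_elim
    case (elim n)
    have "miss n (M n) (nat \<lfloor>x / R n\<rfloor>) \<le> exp (1 - x / 2)" if x: "0 \<le> x" for x
    proof -
      have "miss n (M n) (nat \<lfloor>x / R n\<rfloor>) \<le> exp (- (q n * (x / R n) / real (L n)) + 2 * q n)"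
        using elim x by (intro miss_le_exp) auto
      also have "q n * (x / R n) / real (L n) = q n / (real (L n) * R n) * x" by simp
      also have "- (q n / (real (L n) * R n) * x) + 2 * q n \<le> 1 - x / 2"
        using mult_right_mono[of "1 / 2" "q n / (real (L n) * R n)" x] elim x by linarith
      then have "exp (- (q n / (real (L n) * R n) * x) + 2 * q n) \<le> exp (1 - x / 2)" by simp
      finally show ?thesis .
    qed
    then show ?case using elim by blast
  qed
qed

text \<open>On the scale 1 / \<open>R n\<close> the times before \<open>M n\<close> vanish, where
  completion is not yet described by windows of full length.\<close>

lemma M_rate_tendsto_0: "(\<lambda>n. real (M n) * R n) \<longlonglongrightarrow> 0"
proof (rule tendsto_sandwich[where f = "\<lambda>_. 0"])
  have "\<forall>\<^sub>F n in sequentially. V n < 1"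
    using order_tendstoD(2)[OF V_tendsto_0, of 1] by simp
  then show "\<forall>\<^sub>F n in sequentially. real (M n) * R n \<le> real (L n) * C n"
    using eventually_R_eq eventually_pos eventually_M_le_square eventually_ge_at_top[of 1]
  proof eventually_elim
    case (elim n)
    have "real n ^ 2 \<le> real n ^ 5" using elim by (intro power_increasing) auto
    then have "real (M n) \<le> real (L n)" unfolding L_def of_nat_power using elim by linarith
    moreover have "(1 - 1 / real n) * V n * C n \<le> 1 * 1 * C n"
      using elim by (intro mult_right_mono mult_mono) auto
    then have "R n \<le> C n" using elim by simp
    ultimately show ?case using elim by (intro mult_mono) auto
  qed
  show "\<forall>\<^sub>F n in sequentially. 0 \<le> real (M n) * R n"
    using eventually_pos by eventually_elim auto
qed (auto intro: L_cover_tendsto_0)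

end

section \<open>The coupon process\<close>

locale coupon_process = prob_space P for P :: "'a measure" +
  fixes n :: nat and X :: "nat \<Rightarrow> 'a \<Rightarrow> nat"
  assumes n: "1 \<le> n"
    and indep: "indep_vars (\<lambda>_. count_space UNIV) X {1..}"
    and unif: "\<And>i. 1 \<le> i \<Longrightarrow> distr P (count_space UNIV) (X i) = measure_pmf (pmf_of_set {1..n})"
begin

definition word :: "nat \<Rightarrow> 'a \<Rightarrow> nat list" where
  "word N \<omega> = map (\<lambda>i. X i \<omega>) [1..<Suc N]"

lemma measurable_X [measurable]: "1 \<le> i \<Longrightarrow> X i \<in> measurable P (count_space UNIV)"
  using indep by (simp add: indep_vars_def2)

lemma word_Suc: "word (Suc N) \<omega> = word N \<omega> @ [X (Suc N) \<omega>]"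
  by (simp add: word_def)

lemma length_word [simp]: "length (word N \<omega>) = N"
  by (simp add: word_def)

lemma word_nth: "i < N \<Longrightarrow> word N \<omega> ! i = X (Suc i) \<omega>"
  by (simp add: word_def del: upt_Suc)

lemma measurable_word [measurable]: "word N \<in> measurable P (count_space UNIV)"
proof (induction N)
  case 0
  then show ?case by (simp add: word_def)
next
  case (Suc N)
  have "(\<lambda>\<omega>. w @ [X (Suc N) \<omega>]) \<in> measurable P (count_space UNIV)" for w
    by (rule measurable_compose[OF measurable_X]) auto
  from measurable_compose_countable[OF this Suc] show ?case
    by (simp add: word_Suc[abs_def])
qed

lemma prob_X:
  assumes "1 \<le> i" "c \<in> {1..n}"
  shows "prob (X i -` {c} \<inter> space P) = 1 / real n"
proof -
  have "prob (X i -` {c} \<inter> space P) = measure (distr P (count_space UNIV) (X i)) {c}"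
    using assms by (subst measure_distr) auto
  also have "\<dots> = 1 / real n"
    using assms n by (simp add: unif measure_pmf_single)
  finally show ?thesis .
qed

lemma prob_word_eq:
  assumes "w \<in> words n N"
  shows "prob {\<omega> \<in> space P. word N \<omega> = w} = 1 / real n ^ N"
proof (cases "N = 0")
  case True
  then have "{\<omega> \<in> space P. word N \<omega> = w} = space P" using assms by (auto simp: word_def words_def)
  then show ?thesis using True by (simp add: prob_space)
next
  case False
  have w: "length w = N" "set w \<subseteq> {1..n}" using assms by (auto simp: words_def)
  have "{\<omega> \<in> space P. word N \<omega> = w} = (\<Inter>i\<in>{1..N}. X i -` {w ! (i - 1)} \<inter> space P)"
  proof (intro set_eqI iffI)
    fix \<omega> assume "\<omega> \<in> {\<omega> \<in> space P. word N \<omega> = w}"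
    then have o: "\<omega> \<in> space P" "word N \<omega> = w" by auto
    show "\<omega> \<in> (\<Inter>i\<in>{1..N}. X i -` {w ! (i - 1)} \<inter> space P)"
      using o word_nth[of "i - 1" N \<omega> for i] by (auto simp: o(2)[symmetric] word_nth)
  next
    fix \<omega> assume o: "\<omega> \<in> (\<Inter>i\<in>{1..N}. X i -` {w ! (i - 1)} \<inter> space P)"
    have X: "X (Suc i) \<omega> = w ! i" if "i < N" for i
      using INT_D[OF o, of "Suc i"] that by auto
    have "\<omega> \<in> space P" using INT_D[OF o, of 1] False by auto
    then show "\<omega> \<in> {\<omega> \<in> space P. word N \<omega> = w}"
      using w by (auto intro!: nth_equalityI simp: word_nth X)
  qed
  also have "prob \<dots> = (\<Prod>i\<in>{1..N}. prob (X i -` {w ! (i - 1)} \<inter> space P))"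
    using False by (intro indep_varsD[OF indep]) auto
  also have "\<dots> = (\<Prod>i\<in>{1..N}. 1 / real n)"
  proof (intro prod.cong refl prob_X)
    fix i assume "i \<in> {1..N}"
    then have "w ! (i - 1) \<in> set w" using w by auto
    then show "w ! (i - 1) \<in> {1..n}" using w by blast
  qed auto
  finally show ?thesis by (simp add: power_one_over)
qed

lemma sets_word [measurable]: "{\<omega> \<in> space P. Q (word N \<omega>)} \<in> events"
proof -
  have "word N -` {w. Q w} \<inter> space P \<in> events" by (rule measurable_sets[OF measurable_word]) simp
  moreover have "word N -` {w. Q w} \<inter> space P = {\<omega> \<in> space P. Q (word N \<omega>)}" by auto
  ultimately show ?thesis by simp
qed

lemma prob_word_in:
  assumes "A \<subseteq> words n N"
  shows "prob {\<omega> \<in> space P. word N \<omega> \<in> A} = real (card A) / real n ^ N"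
proof -
  have fin: "finite A" by (rule finite_subset[OF assms]) simp
  have "{\<omega> \<in> space P. word N \<omega> \<in> A} = (\<Union>w\<in>A. {\<omega> \<in> space P. word N \<omega> = w})" by auto
  also have "prob \<dots> = (\<Sum>w\<in>A. prob {\<omega> \<in> space P. word N \<omega> = w})"
    by (rule finite_measure_finite_Union[OF fin]) (auto simp: disjoint_family_on_def)
  also have "\<dots> = (\<Sum>w\<in>A. 1 / real n ^ N)" using assms by (intro sum.cong prob_word_eq) auto
  finally show ?thesis by simp
qed

lemma AE_word: "AE \<omega> in P. word N \<omega> \<in> words n N"
proof -
  have "prob {\<omega> \<in> space P. word N \<omega> \<in> words n N} = 1"
    using n by (simp add: prob_word_in card_words)
  then show ?thesis by (rule AE_prob_1[THEN AE_mp]) auto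
qed

text \<open>The bridge to the process: every average over words computed so far becomes a
  probability.\<close>

lemma prob_word: "prob {\<omega> \<in> space P. Q (word N \<omega>)} = freq n N Q"
proof -
  have "prob {\<omega> \<in> space P. Q (word N \<omega>)} = prob {\<omega> \<in> space P. word N \<omega> \<in> {w \<in> words n N. Q w}}"
  proof (rule finite_measure_eq_AE)
    show "AE \<omega> in P. (\<omega> \<in> {\<omega> \<in> space P. Q (word N \<omega>)}) = (\<omega> \<in> {\<omega> \<in> space P. word N \<omega> \<in> {w \<in> words n N. Q w}})"
      using AE_word[of N] by eventually_elim auto
  qed auto
  also have "\<dots> = real (card {w \<in> words n N. Q w}) / real n ^ N"
    by (rule prob_word_in) auto
  also have "\<dots> = freq n N Q"
    using sum_of_bool_words[where n = n and N = N and Q = Q and f = "\<lambda>_. 1"] by (simp add: freq_def mean_def)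
  finally show ?thesis .
qed

definition complete :: "nat \<Rightarrow> nat \<Rightarrow> 'a \<Rightarrow> bool" where
  "complete M t \<omega> \<longleftrightarrow> n \<le> t \<and> (\<lambda>i. X i \<omega>) ` {max 1 (t + 1 - M)..t} = {1..n}"

lemma set_window_word:
  assumes "i + M \<le> t"
  shows "set (window M i (word t \<omega>)) = (\<lambda>j. X j \<omega>) ` {i + 1..i + M}"
proof -
  have "window M i (word t \<omega>) = map (\<lambda>j. X j \<omega>) [i + 1..<Suc (i + M)]"
    using assms by (intro nth_equalityI) (auto simp: window_def word_nth simp del: upt_Suc)
  then show ?thesis by (simp only: set_map set_upt) (simp add: atLeastLessThanSuc_atLeastAtMost)
qed

text \<open>\<open>complete\<close> admits truncated windows at times s < M, \<open>unfilled\<close>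
  does not. From time M on this makes no difference: a truncated window is contained in the first
  window of length M, and \<open>s - M\<close> is then 0 by natural subtraction.\<close>

lemma unfilled_word_iff:
  assumes M: "n \<le> M" "M \<le> t" and w: "word t \<omega> \<in> words n t"
  shows "unfilled n M (word t \<omega>) \<longleftrightarrow> (\<forall>s\<le>t. \<not> complete M s \<omega>)"
proof
  assume u: "unfilled n M (word t \<omega>)"
  show "\<forall>s\<le>t. \<not> complete M s \<omega>"
  proof (intro allI impI notI)
    fix s assume s: "s \<le> t" "complete M s \<omega>"
    define i where "i = s - M"
    have i: "i + M \<le> t" using M s by (simp add: i_def)
    have "{max 1 (s + 1 - M)..s} \<subseteq> {i + 1..i + M}" by (auto simp: i_def)
    then have "{1..n} \<subseteq> (\<lambda>j. X j \<omega>) ` {i + 1..i + M}"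
      using s(2) unfolding complete_def by (metis image_mono)
    then have "full n (window M i (word t \<omega>))" by (simp add: full_def set_window_word[OF i])
    then show False using u i by (auto simp: unfilled_def)
  qed
next
  assume c: "\<forall>s\<le>t. \<not> complete M s \<omega>"
  show "unfilled n M (word t \<omega>)"
    unfolding unfilled_def
  proof (intro allI impI notI)
    fix i assume i: "i + M \<le> length (word t \<omega>)" and f: "full n (window M i (word t \<omega>))"
    have i': "i + M \<le> t" using i by simp
    have eq: "{max 1 (i + M + 1 - M)..i + M} = {i + 1..i + M}" by auto
    have "set (window M i (word t \<omega>)) \<subseteq> set (word t \<omega>)"
      unfolding window_def by (meson set_drop_subset set_take_subset subset_trans)
    also have "\<dots> \<subseteq> {1..n}" using w by (rule words_set)
    finally have "(\<lambda>j. X j \<omega>) ` {max 1 (i + M + 1 - M)..i + M} = {1..n}"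
      using f unfolding full_def set_window_word[OF i'] eq by blast
    then have "complete M (i + M) \<omega>" using M by (simp add: complete_def)
    then show False using c i' by blast
  qed
qed

lemma sets_complete [measurable]: "Measurable.pred P (complete M t)"
proof -
  have "complete M t \<omega> \<longleftrightarrow> n \<le> t \<and> (\<lambda>i. word t \<omega> ! (i - 1)) ` {max 1 (t + 1 - M)..t} = {1..n}" for \<omega>
  proof -
    have "(\<lambda>i. word t \<omega> ! (i - 1)) ` {max 1 (t + 1 - M)..t} = (\<lambda>i. X i \<omega>) ` {max 1 (t + 1 - M)..t}"
      by (intro image_cong refl) (auto simp: word_nth)
    then show ?thesis by (simp add: complete_def)
  qed
  then show ?thesis
    unfolding pred_def using sets_word[of "\<lambda>w. n \<le> t \<and> (\<lambda>i. w ! (i - 1)) ` {max 1 (t + 1 - M)..t} = {1..n}" t] by simp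
qed

lemma prob_incomplete:
  assumes M: "n \<le> M" "M \<le> t"
  shows "prob {\<omega> \<in> space P. \<forall>s\<le>t. \<not> complete M s \<omega>} = miss n M t"
proof -
  have "prob {\<omega> \<in> space P. \<forall>s\<le>t. \<not> complete M s \<omega>} = prob {\<omega> \<in> space P. unfilled n M (word t \<omega>)}"
  proof (rule finite_measure_eq_AE)
    show "AE \<omega> in P. (\<omega> \<in> {\<omega> \<in> space P. \<forall>s\<le>t. \<not> complete M s \<omega>}) = (\<omega> \<in> {\<omega> \<in> space P. unfilled n M (word t \<omega>)})"
      using AE_word[of t] by eventually_elim (simp add: unfilled_word_iff[OF M])
  qed auto
  then show ?thesis by (simp add: prob_word miss_def)
qed

lemma completion_time_eq:
  "completion_time n M X \<omega> = (if \<exists>t. complete M t \<omega> then enat (LEAST t. complete M t \<omega>) else \<infinity>)"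
proof -
  have S: "{t. n \<le> t \<and> (\<lambda>i. X i \<omega>) ` {max 1 (t + 1 - M)..t} = {1..n}} = {t. complete M t \<omega>}"
    by (simp add: complete_def)
  show ?thesis
  proof (cases "\<exists>t. complete M t \<omega>")
    case True
    then have "complete M (LEAST t. complete M t \<omega>) \<omega>" by (rule LeastI_ex)
    then have "Inf (enat ` {t. complete M t \<omega>}) = enat (LEAST t. complete M t \<omega>)"
      by (intro antisym Inf_lower Inf_greatest) (auto intro: Least_le)
    then show ?thesis using True unfolding completion_time_def S by simp
  next
    case False
    then show ?thesis unfolding completion_time_def S by (simp add: Inf_enat_def)
  qed
qed

text \<open>Disjoint blocks of M draws are full independently, each with the positive probability
  \<open>cover M n\<close>.\<close>

lemma AE_complete:
  assumes M: "n \<le> M"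
  shows "AE \<omega> in P. \<exists>t. complete M t \<omega>"
proof -
  have "prob {\<omega> \<in> space P. \<forall>t. \<not> complete M t \<omega>} \<le> (1 - cover M n) ^ Suc k" for k
  proof -
    have "prob {\<omega> \<in> space P. \<forall>t. \<not> complete M t \<omega>} \<le> prob {\<omega> \<in> space P. \<forall>s\<le>Suc k * M. \<not> complete M s \<omega>}"
      by (rule finite_measure_mono) auto
    also have "\<dots> = miss n M (Suc k * M)" using M by (intro prob_incomplete) auto
    also have "\<dots> \<le> miss n M M ^ Suc k" by (rule miss_mult_le[OF n])
    also have "miss n M M = freq n M (\<lambda>w. \<not> full n w)"
      unfolding miss_def by (intro freq_cong) (auto simp: unfilled_def window_def words_def)
    also have "\<dots> = 1 - cover M n" by (simp add: freq_compl[OF n] freq_full)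
    finally show ?thesis .
  qed
  moreover have "(\<lambda>k. (1 - cover M n) ^ Suc k) \<longlonglongrightarrow> 0"
    using cover_pos[OF n M] cover_le_1[OF n, of M] by (intro LIMSEQ_Suc LIMSEQ_realpow_zero) auto
  ultimately have "prob {\<omega> \<in> space P. \<forall>t. \<not> complete M t \<omega>} \<le> 0"
    by (intro LIMSEQ_le_const) auto
  then have "prob {\<omega> \<in> space P. \<forall>t. \<not> complete M t \<omega>} = 0" by (simp add: measure_le_0_iff)
  then have "AE \<omega> in P. \<not> (\<forall>t. \<not> complete M t \<omega>)"
    by (subst (asm) prob_eq_0) auto
  then show ?thesis by simp
qed

lemma AE_completion_time_finite:
  assumes M: "n \<le> M"
  shows "AE \<omega> in P. completion_time n M X \<omega> \<noteq> \<infinity>"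
  using AE_complete[OF M] by eventually_elim (auto simp: completion_time_eq)

lemma measurable_completion_time [measurable]:
  "completion_time_real n M X \<in> borel_measurable P"
proof -
  have [measurable]: "(\<lambda>\<omega>. LEAST t. complete M t \<omega>) \<in> measurable P (count_space UNIV)"
    by (rule measurable_Least) (use sets_complete in \<open>simp add: pred_def\<close>)
  \<comment> \<open>The unspecified value of \<open>the_enat \<infinity>\<close> is one constant, so
    it does no harm to measurability.\<close>
  have "completion_time_real n M X = (\<lambda>\<omega>. if \<exists>t. complete M t \<omega> then real (LEAST t. complete M t \<omega>) else real (the_enat \<infinity>))"
    by (auto simp: completion_time_real_def completion_time_eq)
  also have "\<dots> \<in> borel_measurable P" by measurable
  finally show ?thesis .
qed

lemma AE_completion_time_ge:
  assumes M: "n \<le> M"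
  shows "AE \<omega> in P. 1 \<le> completion_time_real n M X \<omega>"
  using AE_complete[OF M]
proof eventually_elim
  case (elim \<omega>)
  then have "complete M (LEAST t. complete M t \<omega>) \<omega>" by (rule LeastI_ex)
  then have "n \<le> (LEAST t. complete M t \<omega>)" by (simp add: complete_def)
  then show ?case using elim n by (simp add: completion_time_real_def completion_time_eq)
qed

lemma prob_completion_time_gt:
  assumes M: "n \<le> M" and x: "real M \<le> x"
  shows "prob {\<omega> \<in> space P. x < completion_time_real n M X \<omega>} = miss n M (nat \<lfloor>x\<rfloor>)"
proof -
  have "prob {\<omega> \<in> space P. x < completion_time_real n M X \<omega>} = prob {\<omega> \<in> space P. \<forall>s\<le>nat \<lfloor>x\<rfloor>. \<not> complete M s \<omega>}"
  proof (rule finite_measure_eq_AE)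
    show "AE \<omega> in P. (\<omega> \<in> {\<omega> \<in> space P. x < completion_time_real n M X \<omega>})
        = (\<omega> \<in> {\<omega> \<in> space P. \<forall>s\<le>nat \<lfloor>x\<rfloor>. \<not> complete M s \<omega>})"
      using AE_complete[OF M]
    proof eventually_elim
      case (elim \<omega>)
      define l where "l = (LEAST t. complete M t \<omega>)"
      have l: "complete M l \<omega>" "\<And>s. complete M s \<omega> \<Longrightarrow> l \<le> s"
        using LeastI_ex[OF elim] unfolding l_def by (auto intro: Least_le)
      have T: "completion_time_real n M X \<omega> = real l"
        using elim by (simp add: completion_time_real_def completion_time_eq l_def)
      have "x < real l \<longleftrightarrow> nat \<lfloor>x\<rfloor> < l" using x by linarith
      also have "\<dots> \<longleftrightarrow> (\<forall>s\<le>nat \<lfloor>x\<rfloor>. \<not> complete M s \<omega>)"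
        using l by (meson le_less_trans linorder_not_le order_trans)
      finally show ?case by (simp add: T)
    qed
  qed auto
  also have "\<dots> = miss n M (nat \<lfloor>x\<rfloor>)" using M x by (intro prob_incomplete) linarith+
  finally show ?thesis .
qed

end

lemma coupon_process_iff: "coupon_process P n X \<longleftrightarrow> 1 \<le> n \<and> iid_uniform_coupons P n X"
  by (auto simp: coupon_process_def coupon_process_axioms_def iid_uniform_coupons_def)

section \<open>Convergence of moments and the main theorem\<close>

text \<open>Write \<open>Y ^ Suc k\<close> as the integral of its derivative over [0, Y) and apply
  Tonelli. Working with values in [0, \<infinity>] postpones the question of integrability.\<close>

lemma (in prob_space) nn_integral_power_eq_tail:
  assumes [measurable]: "Y \<in> borel_measurable M" and Y0: "\<And>\<omega>. 0 \<le> Y \<omega>"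
  shows "(\<integral>\<^sup>+\<omega>. ennreal (Y \<omega> ^ Suc k) \<partial>M)
    = (\<integral>\<^sup>+x. ennreal (indicator {0..} x * (real (Suc k) * x ^ k * prob {\<omega> \<in> space M. x < Y \<omega>})) \<partial>lborel)"
proof -
  define h where "h = (\<lambda>x :: real. indicator {0..} x * (real (Suc k) * x ^ k))"
  have [measurable]: "h \<in> borel_measurable borel" by (simp add: h_def)
  have h0: "0 \<le> h x" for x by (simp add: h_def indicator_def)
  interpret pair_sigma_finite M lborel
    by (intro pair_sigma_finite.intro sigma_finite_measure_axioms lborel.sigma_finite_measure_axioms)
  have "(\<integral>\<^sup>+\<omega>. ennreal (Y \<omega> ^ Suc k) \<partial>M) = (\<integral>\<^sup>+\<omega>. (\<integral>\<^sup>+x. ennreal (h x) * indicator {..<Y \<omega>} x \<partial>lborel) \<partial>M)"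
  proof (intro nn_integral_cong)
    fix \<omega>
    have "(\<integral>\<^sup>+x. ennreal (h x) * indicator {..<Y \<omega>} x \<partial>lborel)
        = (\<integral>\<^sup>+x. ennreal (real (Suc k) * x ^ k) * indicator {0..Y \<omega>} x \<partial>lborel)"
    proof (rule nn_integral_cong_AE)
      show "AE x in lborel. ennreal (h x) * indicator {..<Y \<omega>} x
          = ennreal (real (Suc k) * x ^ k) * indicator {0..Y \<omega>} x"
        using AE_lborel_singleton[of "Y \<omega>"] by eventually_elim (auto simp: h_def indicator_def)
    qed
    also have "\<dots> = ennreal (Y \<omega> ^ Suc k - 0 ^ Suc k)"
    proof (rule nn_integral_FTC_Icc)
      fix x :: real assume "x \<in> {0..Y \<omega>}"
      then show "0 \<le> real (Suc k) * x ^ k" by simp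
      show "DERIV (\<lambda>x. x ^ Suc k) x :> real (Suc k) * x ^ k"
        by (rule DERIV_cong[OF DERIV_pow]) simp
    qed (use Y0 in auto)
    finally show "ennreal (Y \<omega> ^ Suc k) = (\<integral>\<^sup>+x. ennreal (h x) * indicator {..<Y \<omega>} x \<partial>lborel)" by simp
  qed
  also have "\<dots> = (\<integral>\<^sup>+x. (\<integral>\<^sup>+\<omega>. ennreal (h x) * indicator {..<Y \<omega>} x \<partial>M) \<partial>lborel)"
  proof (rule Fubini'[symmetric])
    have "case_prod (\<lambda>\<omega> x. ennreal (h x) * indicator {..<Y \<omega>} x)
        = (\<lambda>p. if snd p < Y (fst p) then ennreal (h (snd p)) else 0)"
      by (auto simp: fun_eq_iff indicator_def)
    also have "\<dots> \<in> borel_measurable (M \<Otimes>\<^sub>M lborel)" by measurable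
    finally show "case_prod (\<lambda>\<omega> x. ennreal (h x) * indicator {..<Y \<omega>} x) \<in> borel_measurable (M \<Otimes>\<^sub>M lborel)" .
  qed
  also have "\<dots> = (\<integral>\<^sup>+x. ennreal (h x * prob {\<omega> \<in> space M. x < Y \<omega>}) \<partial>lborel)"
  proof (intro nn_integral_cong)
    fix x :: real
    have "(\<integral>\<^sup>+\<omega>. ennreal (h x) * indicator {..<Y \<omega>} x \<partial>M)
        = (\<integral>\<^sup>+\<omega>. ennreal (h x) * indicator {\<omega> \<in> space M. x < Y \<omega>} \<omega> \<partial>M)"
      by (intro nn_integral_cong) (auto simp: indicator_def)
    also have "\<dots> = ennreal (h x) * emeasure M {\<omega> \<in> space M. x < Y \<omega>}"
      by (rule nn_integral_cmult_indicator) simp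
    also have "\<dots> = ennreal (h x * prob {\<omega> \<in> space M. x < Y \<omega>})"
      by (simp add: emeasure_eq_measure ennreal_mult h0)
    finally show "(\<integral>\<^sup>+\<omega>. ennreal (h x) * indicator {..<Y \<omega>} x \<partial>M) = ennreal (h x * prob {\<omega> \<in> space M. x < Y \<omega>})" .
  qed
  finally show ?thesis by (simp add: h_def mult.assoc)
qed

lemma erlang_density_integral:
  assumes "0 < l"
  shows "integrable lborel (erlang_density k l)" "(\<integral>x. erlang_density k l x \<partial>lborel) = 1"
proof -
  have nn: "0 \<le> erlang_density k l x" for x using assms by simp
  have 1: "(\<integral>\<^sup>+x. ennreal (erlang_density k l x) \<partial>lborel) = 1"
    using nn_integral_erlang_ith_moment[OF assms, of k 0] by simp
  show "integrable lborel (erlang_density k l)"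
    by (rule integrableI_nn_integral_finite[where x = 1]) (use 1 nn in auto)
  show "(\<integral>x. erlang_density k l x \<partial>lborel) = 1"
    by (subst integral_eq_nn_integral) (use 1 nn in auto)
qed

text \<open>Dominated convergence in the tail formula. The limit of the integrands and the
  dominating function are multiples of Erlang densities of rates 1 and 1/2, whose total mass is
  1.\<close>

lemma moments_tendsto:
  fixes P :: "nat \<Rightarrow> 'a measure" and Y :: "nat \<Rightarrow> 'a \<Rightarrow> real"
  assumes ev: "\<forall>\<^sub>F n in sequentially. prob_space (P n) \<and> Y n \<in> borel_measurable (P n) \<and> (\<forall>\<omega>. 0 \<le> Y n \<omega>) \<and>
      (\<forall>x\<ge>0. measure (P n) {\<omega> \<in> space (P n). x < Y n \<omega>} \<le> exp (1 - x / 2))"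
    and lim: "\<And>x. 0 < x \<Longrightarrow> (\<lambda>n. measure (P n) {\<omega> \<in> space (P n). x < Y n \<omega>}) \<longlonglongrightarrow> exp (- x)"
  shows "(\<lambda>n. integral\<^sup>L (P n) (\<lambda>\<omega>. Y n \<omega> ^ Suc k)) \<longlonglongrightarrow> fact (Suc k)"
proof -
  define G where "G = (\<lambda>n x. measure (P n) {\<omega> \<in> space (P n). x < Y n \<omega>})"
  define s where "s = (\<lambda>n x. indicator {0..} x * (real (Suc k) * x ^ k * G n x))"
  obtain N where N0: "\<And>n. N \<le> n \<Longrightarrow> prob_space (P n) \<and> Y n \<in> borel_measurable (P n) \<and> (\<forall>\<omega>. 0 \<le> Y n \<omega>) \<and>
      (\<forall>x\<ge>0. measure (P n) {\<omega> \<in> space (P n). x < Y n \<omega>} \<le> exp (1 - x / 2))"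
    using ev unfolding eventually_sequentially by blast
  have N: "prob_space (P n)" "Y n \<in> borel_measurable (P n)" "0 \<le> Y n \<omega>" "0 \<le> x \<Longrightarrow> G n x \<le> exp (1 - x / 2)"
    if "N \<le> n" for n \<omega> x
    using N0[OF that] unfolding G_def by blast+
  have G_meas: "G n \<in> borel_measurable borel" if n: "N \<le> n" for n
  proof -
    interpret prob_space "P n" by (rule N(1)[OF n])
    have [measurable]: "Y n \<in> borel_measurable (P n)" by (rule N(2)[OF n])
    \<comment> \<open>Tail functions are decreasing, hence Borel measurable.\<close>
    have "mono (\<lambda>x. - G n x)"
      unfolding mono_def G_def by (auto intro!: finite_measure_mono)
    then have "(\<lambda>x. - G n x) \<in> borel_measurable borel" by (rule borel_measurable_mono)
    then have "(\<lambda>x. - (- G n x)) \<in> borel_measurable borel" by (rule borel_measurable_uminus)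
    then show ?thesis by simp
  qed
  have s_meas: "s n \<in> borel_measurable lborel" if "N \<le> n" for n
  proof -
    have [measurable]: "G n \<in> borel_measurable borel" by (rule G_meas[OF that])
    show ?thesis unfolding s_def by measurable
  qed
  have s0: "0 \<le> s n x" for n x by (simp add: s_def G_def indicator_def)
  have eq: "integral\<^sup>L (P n) (\<lambda>\<omega>. Y n \<omega> ^ Suc k) = (\<integral>x. s n x \<partial>lborel)" if n: "N \<le> n" for n
  proof -
    interpret prob_space "P n" by (rule N(1)[OF n])
    have [measurable]: "Y n \<in> borel_measurable (P n)" by (rule N(2)[OF n])
    have "integral\<^sup>L (P n) (\<lambda>\<omega>. Y n \<omega> ^ Suc k) = enn2real (\<integral>\<^sup>+\<omega>. ennreal (Y n \<omega> ^ Suc k) \<partial>P n)"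
      by (rule integral_eq_nn_integral) (auto intro!: AE_I2 mult_nonneg_nonneg zero_le_power simp: N(3)[OF n])
    also have "\<dots> = enn2real (\<integral>\<^sup>+x. ennreal (s n x) \<partial>lborel)"
      by (subst nn_integral_power_eq_tail) (auto simp: N(3)[OF n] s_def G_def)
    also have "\<dots> = (\<integral>x. s n x \<partial>lborel)"
      by (rule integral_eq_nn_integral[symmetric]) (use s_meas[OF n] s0 in auto)
    finally show ?thesis .
  qed
  \<comment> \<open>Domination has to hold at every index but is known only from N on, so the
    sequence is shifted.\<close>
  have "(\<lambda>n. \<integral>x. s (n + N) x \<partial>lborel) \<longlonglongrightarrow> (\<integral>x. fact (Suc k) * erlang_density k 1 x \<partial>lborel)"
  proof (rule integral_dominated_convergence)
    show "integrable lborel (\<lambda>x. (real (Suc k) * exp 1 * fact k * 2 ^ Suc k) * erlang_density k (1 / 2) x)"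
      by (intro integrable_mult_right erlang_density_integral) simp
    show "AE x in lborel. norm (s (n + N) x) \<le> (real (Suc k) * exp 1 * fact k * 2 ^ Suc k) * erlang_density k (1 / 2) x" for n
    proof (intro AE_I2)
      fix x :: real
      show "norm (s (n + N) x) \<le> (real (Suc k) * exp 1 * fact k * 2 ^ Suc k) * erlang_density k (1 / 2) x"
      proof (cases "0 \<le> x")
        case True
        have "norm (s (n + N) x) = real (Suc k) * x ^ k * G (n + N) x"
          using True s0[of "n + N" x] by (simp add: s_def)
        also have "\<dots> \<le> real (Suc k) * x ^ k * exp (1 - x / 2)"
          using True N(4)[of "n + N" x] by (intro mult_left_mono) auto
        also have "\<dots> = (real (Suc k) * exp 1 * fact k * 2 ^ Suc k) * erlang_density k (1 / 2) x"
        proof -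
          define E where "E = exp (- (1 / 2) * x)"
          have "exp (1 - x / 2) = exp 1 * E" by (simp add: E_def exp_add[symmetric])
          moreover have "erlang_density k (1 / 2) x = (1 / 2) ^ Suc k * x ^ k * E / fact k"
            using True by (simp add: erlang_density_def E_def)
          ultimately show ?thesis by (simp only:) (simp add: power_one_over field_simps)
        qed
        finally show ?thesis .
      qed (simp add: s_def erlang_density_def)
    qed
    show "AE x in lborel. (\<lambda>n. s (n + N) x) \<longlonglongrightarrow> fact (Suc k) * erlang_density k 1 x"
      using AE_lborel_singleton[of 0]
    proof eventually_elim
      case (elim x)
      show ?case
      proof (cases "0 < x")
        case True
        have "(\<lambda>n. real (Suc k) * x ^ k * G (n + N) x) \<longlonglongrightarrow> real (Suc k) * x ^ k * exp (- x)"
          unfolding G_def by (intro tendsto_mult tendsto_const LIMSEQ_ignore_initial_segment lim True)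
        moreover have "fact (Suc k) * erlang_density k 1 x = real (Suc k) * x ^ k * exp (- x)"
          using True by (simp add: erlang_density_def)
        moreover have "s (n + N) x = real (Suc k) * x ^ k * G (n + N) x" for n
          using True by (simp add: s_def)
        ultimately show ?thesis by (simp only:)
      qed (use elim in \<open>simp add: s_def erlang_density_def\<close>)
    qed
  qed (use s_meas in auto)
  also have "(\<integral>x. fact (Suc k) * erlang_density k 1 x \<partial>lborel) = fact (Suc k)"
    by (simp add: erlang_density_integral del: fact_Suc)
  finally have "(\<lambda>n. integral\<^sup>L (P (n + N)) (\<lambda>\<omega>. Y (n + N) \<omega> ^ Suc k)) \<longlonglongrightarrow> fact (Suc k)"
    by (simp only: eq le_add2)
  then show ?thesis by (rule LIMSEQ_offset)
qed

lemma cdf_Exp1: "cdf Exp1 x = (if 0 \<le> x then 1 - exp (- x) else 0)"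
  unfolding cdf_def2 Exp1_def measure_def
  by (subst emeasure_erlang_density) (auto simp: erlang_CDF_0)

section \<open>Limit theorems for the completion time\<close>

locale expiring_coupons = subcritical_window +
  fixes P :: "nat \<Rightarrow> 'a measure" and X :: "nat \<Rightarrow> nat \<Rightarrow> 'a \<Rightarrow> nat"
  assumes coupons: "\<And>n. 1 \<le> n \<Longrightarrow> iid_uniform_coupons (P n) n (X n)"
begin

definition T :: "nat \<Rightarrow> 'a \<Rightarrow> real" where
  "T n = completion_time_real n (M n) (X n)"

lemma process: "1 \<le> n \<Longrightarrow> coupon_process (P n) n (X n)"
  using coupons by (simp add: coupon_process_iff)

lemma T_nonneg: "0 \<le> T n \<omega>"
  by (simp add: T_def completion_time_real_def)

lemma T_measurable: "1 \<le> n \<Longrightarrow> T n \<in> borel_measurable (P n)"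
  unfolding T_def by (rule coupon_process.measurable_completion_time[OF process])

lemma prob_space_P: "1 \<le> n \<Longrightarrow> prob_space (P n)"
  using coupons by (simp add: iid_uniform_coupons_def)

lemma tail_eq: "1 \<le> n \<Longrightarrow> n \<le> M n \<Longrightarrow> real (M n) \<le> x \<Longrightarrow>
    measure (P n) {\<omega> \<in> space (P n). x < T n \<omega>} = miss n (M n) (nat \<lfloor>x\<rfloor>)"
  unfolding T_def by (rule coupon_process.prob_completion_time_gt[OF process])

lemma eventually_pos_of_ratio:
  assumes \<nu>: "(\<lambda>n. \<nu> n / R n) \<longlonglongrightarrow> 1"
  shows "\<forall>\<^sub>F n in sequentially. 0 < \<nu> n"
proof -
  have "\<forall>\<^sub>F n in sequentially. 0 < \<nu> n / R n" using order_tendstoD(1)[OF \<nu>, of 0] by simp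
  then show ?thesis using eventually_pos by eventually_elim (simp add: zero_less_divide_iff)
qed

text \<open>As \<open>\<nu> n * M n\<close> tends to 0, a fixed x > 0 eventually satisfies
  \<open>M n \<le> x / \<nu> n\<close>, and in that range the tail of \<open>T n\<close> is exactly
  \<open>miss\<close>.\<close>

lemma tail_tendsto:
  assumes \<nu>: "(\<lambda>n. \<nu> n / R n) \<longlonglongrightarrow> 1" and x: "0 < x"
  shows "(\<lambda>n. measure (P n) {\<omega> \<in> space (P n). x < \<nu> n * T n \<omega>}) \<longlonglongrightarrow> exp (- x)"
proof -
  have "(\<lambda>n. \<nu> n / R n * (real (M n) * R n)) \<longlonglongrightarrow> 1 * 0"
    by (intro tendsto_mult \<nu> M_rate_tendsto_0)
  then have "\<forall>\<^sub>F n in sequentially. \<nu> n / R n * (real (M n) * R n) < x"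
    using x by (intro order_tendstoD(2)) auto
  then have "\<forall>\<^sub>F n in sequentially. miss n (M n) (nat \<lfloor>x / \<nu> n\<rfloor>) = measure (P n) {\<omega> \<in> space (P n). x < \<nu> n * T n \<omega>}"
    using eventually_pos_of_ratio[OF \<nu>] eventually_pos eventually_M_gt eventually_ge_at_top[of 1]
  proof eventually_elim
    case (elim n)
    then have "real (M n) \<le> x / \<nu> n" by (simp add: field_simps)
    then have "miss n (M n) (nat \<lfloor>x / \<nu> n\<rfloor>) = measure (P n) {\<omega> \<in> space (P n). x / \<nu> n < T n \<omega>}"
      using elim by (intro tail_eq[symmetric]) auto
    also have "{\<omega> \<in> space (P n). x / \<nu> n < T n \<omega>} = {\<omega> \<in> space (P n). x < \<nu> n * T n \<omega>}"
      using elim by (simp add: divide_less_eq mult.commute)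
    finally show ?case .
  qed
  with miss_tendsto[OF \<nu> less_imp_le[OF x]] show ?thesis by (rule Lim_transform_eventually)
qed

lemma AE_T_ge: "1 \<le> n \<Longrightarrow> n \<le> M n \<Longrightarrow> AE \<omega> in P n. 1 \<le> T n \<omega>"
  unfolding T_def by (rule coupon_process.AE_completion_time_ge[OF process])

lemma prob_le_eq:
  assumes "1 \<le> n"
  shows "measure (P n) {\<omega> \<in> space (P n). c * T n \<omega> \<le> x} = 1 - measure (P n) {\<omega> \<in> space (P n). x < c * T n \<omega>}"
proof -
  interpret prob_space "P n" by (rule prob_space_P[OF assms])
  have [measurable]: "T n \<in> borel_measurable (P n)" by (rule T_measurable[OF assms])
  have "prob {\<omega> \<in> space (P n). \<not> x < c * T n \<omega>} = 1 - prob {\<omega> \<in> space (P n). x < c * T n \<omega>}"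
    by (rule prob_neg) measurable
  then show ?thesis by (simp add: not_less)
qed

lemma scaled_conv_in_distr:
  assumes \<nu>: "(\<lambda>n. \<nu> n / R n) \<longlonglongrightarrow> 1"
  shows "conv_in_distr P (\<lambda>n \<omega>. \<nu> n * T n \<omega>) Exp1"
  unfolding conv_in_distr_def weak_conv_m_def weak_conv_def
proof (intro allI impI)
  fix x :: real
  have cdf: "cdf (distr (P n) borel (\<lambda>\<omega>. \<nu> n * T n \<omega>)) x = measure (P n) {\<omega> \<in> space (P n). \<nu> n * T n \<omega> \<le> x}"
    if "1 \<le> n" for n
  proof -
    have [measurable]: "T n \<in> borel_measurable (P n)" by (rule T_measurable[OF that])
    show ?thesis unfolding cdf_def2
      by (subst measure_distr) (auto intro!: arg_cong[where f = "measure (P n)"])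
  qed
  show "(\<lambda>n. cdf (distr (P n) borel (\<lambda>\<omega>. \<nu> n * T n \<omega>)) x) \<longlonglongrightarrow> cdf Exp1 x"
  proof (cases "0 < x")
    case True
    have "(\<lambda>n. 1 - measure (P n) {\<omega> \<in> space (P n). x < \<nu> n * T n \<omega>}) \<longlonglongrightarrow> 1 - exp (- x)"
      by (intro tendsto_intros tail_tendsto[OF \<nu> True])
    moreover have "\<forall>\<^sub>F n in sequentially. 1 - measure (P n) {\<omega> \<in> space (P n). x < \<nu> n * T n \<omega>}
        = cdf (distr (P n) borel (\<lambda>\<omega>. \<nu> n * T n \<omega>)) x"
      using eventually_ge_at_top[of 1] by eventually_elim (simp add: cdf prob_le_eq)
    ultimately have "(\<lambda>n. cdf (distr (P n) borel (\<lambda>\<omega>. \<nu> n * T n \<omega>)) x) \<longlonglongrightarrow> 1 - exp (- x)"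
      by (rule Lim_transform_eventually)
    then show ?thesis using True by (simp add: cdf_Exp1)
  next
    case False
    \<comment> \<open>The limit distribution function is continuous at 0, so x = 0 must be covered
      as well; \<open>1 \<le> T n\<close> almost surely rules out mass at or below 0.\<close>
    have "\<forall>\<^sub>F n in sequentially. 0 = cdf (distr (P n) borel (\<lambda>\<omega>. \<nu> n * T n \<omega>)) x"
      using eventually_pos_of_ratio[OF \<nu>] eventually_M_gt eventually_ge_at_top[of 1]
    proof eventually_elim
      case (elim n)
      have "measure (P n) {\<omega> \<in> space (P n). \<nu> n * T n \<omega> \<le> x} = measure (P n) {}"
      proof (rule finite_measure.finite_measure_eq_AE)
        show "finite_measure (P n)" using prob_space_P[OF elim(3)] by (rule prob_space.axioms)
        have "AE \<omega> in P n. 1 \<le> T n \<omega>" using elim by (intro AE_T_ge) auto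
        then show "AE \<omega> in P n. (\<omega> \<in> {\<omega> \<in> space (P n). \<nu> n * T n \<omega> \<le> x}) = (\<omega> \<in> {})"
        proof eventually_elim
          case (elim \<omega>)
          then have "0 < \<nu> n * T n \<omega>" using \<open>0 < \<nu> n\<close> by simp
          then show ?case using False by auto
        qed
        have [measurable]: "T n \<in> borel_measurable (P n)" by (rule T_measurable[OF elim(3)])
        show "{\<omega> \<in> space (P n). \<nu> n * T n \<omega> \<le> x} \<in> sets (P n)" by measurable
      qed simp
      then show ?case using elim by (simp add: cdf)
    qed
    then have "(\<lambda>n. cdf (distr (P n) borel (\<lambda>\<omega>. \<nu> n * T n \<omega>)) x) \<longlonglongrightarrow> 0"
      by (rule Lim_transform_eventually[OF tendsto_const])
    moreover have "cdf Exp1 x = 0" using False by (simp add: cdf_Exp1)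
    ultimately show ?thesis by simp
  qed
qed

lemma R_ratio: "(\<lambda>n. R n / R n) \<longlonglongrightarrow> 1"
proof (rule Lim_transform_eventually[OF tendsto_const])
  show "\<forall>\<^sub>F n in sequentially. 1 = R n / R n" using eventually_pos by eventually_elim simp
qed

lemma scaled_moments:
  assumes "1 \<le> r"
  shows "(\<lambda>n. integral\<^sup>L (P n) (\<lambda>\<omega>. (R n * T n \<omega>) ^ r)) \<longlonglongrightarrow> fact r"
proof -
  obtain k where r: "r = Suc k" using assms by (cases r) auto
  have "\<forall>\<^sub>F n in sequentially. real (M n) * R n < 2"
    using order_tendstoD(2)[OF M_rate_tendsto_0, of 2] by simp
  then have "\<forall>\<^sub>F n in sequentially. prob_space (P n) \<and> (\<lambda>\<omega>. R n * T n \<omega>) \<in> borel_measurable (P n) \<and>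
      (\<forall>\<omega>. 0 \<le> R n * T n \<omega>) \<and>
      (\<forall>x\<ge>0. measure (P n) {\<omega> \<in> space (P n). x < R n * T n \<omega>} \<le> exp (1 - x / 2))"
    using eventually_miss_le eventually_M_gt eventually_ge_at_top[of 1]
  proof eventually_elim
    case (elim n)
    have R: "0 < R n" using elim by simp
    interpret prob_space "P n" by (rule prob_space_P[OF elim(4)])
    have [measurable]: "T n \<in> borel_measurable (P n)" by (rule T_measurable[OF elim(4)])
    have "prob {\<omega> \<in> space (P n). x < R n * T n \<omega>} \<le> exp (1 - x / 2)" if x: "0 \<le> x" for x
    proof (cases "real (M n) \<le> x / R n")
      case True
      have "{\<omega> \<in> space (P n). x < R n * T n \<omega>} = {\<omega> \<in> space (P n). x / R n < T n \<omega>}"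
        using R by (simp add: divide_less_eq mult.commute)
      then have "prob {\<omega> \<in> space (P n). x < R n * T n \<omega>} = miss n (M n) (nat \<lfloor>x / R n\<rfloor>)"
        using elim True by (simp add: tail_eq)
      also have "\<dots> \<le> exp (1 - x / 2)" using elim x by blast
      finally show ?thesis .
    next
      case False
      \<comment> \<open>Eventually \<open>M n * R n < 2\<close>, so here x < 2 and the claimed bound
        is at least 1.\<close>
      then have "x < real (M n) * R n" using R by (simp add: field_simps)
      then have "1 \<le> exp (1 - x / 2)" using elim by simp
      then show ?thesis using prob_le_1 order_trans by blast
    qed
    moreover have "(\<lambda>\<omega>. R n * T n \<omega>) \<in> borel_measurable (P n)" by measurable
    ultimately show ?case using R T_nonneg prob_space_axioms by (auto intro!: mult_nonneg_nonneg)
  qed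
  from moments_tendsto[OF this tail_tendsto[OF R_ratio], of k] show ?thesis by (simp only: r)
qed

lemma scaled_mean: "(\<lambda>n. R n * integral\<^sup>L (P n) (T n)) \<longlonglongrightarrow> 1"
  using scaled_moments[of 1] by simp

lemma scaled_second_moment: "(\<lambda>n. (R n)\<^sup>2 * integral\<^sup>L (P n) (\<lambda>\<omega>. (T n \<omega>)\<^sup>2)) \<longlonglongrightarrow> 2"
  using scaled_moments[of 2] by (simp add: power_mult_distrib fact_2)

lemma scaled_variance:
  "(\<lambda>n. (R n)\<^sup>2 * prob_space.variance (P n) (T n)) \<longlonglongrightarrow> 1"
proof -
  have lim: "(\<lambda>n. (R n)\<^sup>2 * integral\<^sup>L (P n) (\<lambda>\<omega>. (T n \<omega>)\<^sup>2) - (R n * integral\<^sup>L (P n) (T n))\<^sup>2) \<longlonglongrightarrow> 2 - 1\<^sup>2"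
    by (intro tendsto_intros scaled_mean scaled_second_moment)
  have "\<forall>\<^sub>F n in sequentially. 0 < R n * integral\<^sup>L (P n) (T n)"
    using order_tendstoD(1)[OF scaled_mean, of 0] by simp
  moreover have "\<forall>\<^sub>F n in sequentially. 0 < (R n)\<^sup>2 * integral\<^sup>L (P n) (\<lambda>\<omega>. (T n \<omega>)\<^sup>2)"
    using order_tendstoD(1)[OF scaled_second_moment, of 0] by simp
  ultimately have "\<forall>\<^sub>F n in sequentially.
      (R n)\<^sup>2 * integral\<^sup>L (P n) (\<lambda>\<omega>. (T n \<omega>)\<^sup>2) - (R n * integral\<^sup>L (P n) (T n))\<^sup>2
        = (R n)\<^sup>2 * prob_space.variance (P n) (T n)"
    using eventually_ge_at_top[of 1]
  proof eventually_elim
    case (elim n)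
    interpret prob_space "P n" by (rule prob_space_P[OF elim(3)])
    \<comment> \<open>the Bochner integral of a non-integrable function is \<open>0\<close>\<close>
    have "integrable (P n) (T n)" "integrable (P n) (\<lambda>\<omega>. (T n \<omega>)\<^sup>2)"
      using elim not_integrable_integral_eq by fastforce+
    then have "variance (T n) = expectation (\<lambda>\<omega>. (T n \<omega>)\<^sup>2) - (expectation (T n))\<^sup>2"
      by (rule variance_eq)
    then show ?case by (simp add: power_mult_distrib right_diff_distrib)
  qed
  with lim show ?thesis by (simp add: tendsto_cong)
qed

text \<open>Split ln T = ln (R * T) - ln R. The second part is known from
  \<open>ln_rate_asymp\<close>; by the limit law R * T lies with high probability in a compact
  subset of the positive reals, so its logarithm stays bounded.\<close>

lemma log_T_smallo:
  "smallo_prob P (\<lambda>n \<omega>. ln (T n \<omega>) - real n powr (1 - \<alpha>)) (\<lambda>n. real n powr (1 - \<alpha>))"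
  unfolding smallo_prob_def conv_in_prob_0_def
proof (intro allI impI)
  fix \<epsilon> :: real assume \<epsilon>: "0 < \<epsilon>"
  define N where "N = (\<lambda>n. real n powr (1 - \<alpha>))"
  define bad where "bad = (\<lambda>n. measure (P n) {\<omega> \<in> space (P n). \<bar>(ln (T n \<omega>) - N n) / N n\<bar> > \<epsilon>})"
  have "bad \<longlonglongrightarrow> 0"
  proof (rule order_tendstoI)
    fix a :: real assume "a < 0"
    then show "\<forall>\<^sub>F n in sequentially. a < bad n"
      by (intro always_eventually allI) (simp add: bad_def less_le_trans)
  next
    fix a :: real assume a: "0 < a"
    \<comment> \<open>The exponential law has mass at most \<delta> below \<delta> and at most
      \<delta> above 1 / \<delta>; together this is at most a / 2, strictly below a.\<close>
    define \<delta> where "\<delta> = a / 4"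
    have \<delta>: "0 < \<delta>" using a by (simp add: \<delta>_def)
    have lim: "(\<lambda>n. measure (P n) {\<omega> \<in> space (P n). 1 / \<delta> < R n * T n \<omega>}
        + (1 - measure (P n) {\<omega> \<in> space (P n). \<delta> < R n * T n \<omega>})) \<longlonglongrightarrow> exp (- (1 / \<delta>)) + (1 - exp (- \<delta>))"
      using \<delta> by (intro tendsto_intros tail_tendsto[OF R_ratio]) auto
    have "exp (- (1 / \<delta>)) \<le> \<delta>"
      using exp_ge_add_one_self[of "1 / \<delta>"] \<delta> by (simp add: exp_minus field_simps)
    moreover have "1 - exp (- \<delta>) \<le> \<delta>" using exp_ge_add_one_self[of "- \<delta>"] by linarith
    ultimately have "exp (- (1 / \<delta>)) + (1 - exp (- \<delta>)) < a" using a by (simp add: \<delta>_def)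
    from order_tendstoD(2)[OF lim this]
    have 1: "\<forall>\<^sub>F n in sequentially. measure (P n) {\<omega> \<in> space (P n). 1 / \<delta> < R n * T n \<omega>}
        + (1 - measure (P n) {\<omega> \<in> space (P n). \<delta> < R n * T n \<omega>}) < a" .
    \<comment> \<open>One half of \<epsilon> is spent on \<open>ln (R n)\<close>, the other on the
      bounded logarithm of \<open>R n * T n\<close>.\<close>
    have 2: "\<forall>\<^sub>F n in sequentially. - 1 - \<epsilon> / 2 < ln (R n) / N n" "\<forall>\<^sub>F n in sequentially. ln (R n) / N n < - 1 + \<epsilon> / 2"
      using order_tendstoD[OF ln_rate_asymp] \<epsilon> by (auto simp: N_def)
    have 3: "\<forall>\<^sub>F n in sequentially. - ln \<delta> / (\<epsilon> / 2) < N n" "\<forall>\<^sub>F n in sequentially. ln \<delta> / (\<epsilon> / 2) < N n"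
    proof -
      have "filterlim N at_top sequentially" unfolding N_def using \<alpha> by real_asymp
      then show "\<forall>\<^sub>F n in sequentially. - ln \<delta> / (\<epsilon> / 2) < N n" "\<forall>\<^sub>F n in sequentially. ln \<delta> / (\<epsilon> / 2) < N n"
        unfolding filterlim_at_top_dense by blast+
    qed
    show "\<forall>\<^sub>F n in sequentially. bad n < a"
      using 1 2 3 eventually_pos eventually_M_gt eventually_ge_at_top[of 1]
    proof eventually_elim
      case (elim n)
      have n: "1 \<le> n" using elim by simp
      interpret prob_space "P n" by (rule prob_space_P[OF n])
      have [measurable]: "T n \<in> borel_measurable (P n)" by (rule T_measurable[OF n])
      have N: "0 < N n" using n by (simp add: N_def)
      have "AE \<omega> in P n. 1 \<le> T n \<omega>" using elim by (intro AE_T_ge) auto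
      then have "bad n \<le> prob ({\<omega> \<in> space (P n). 1 / \<delta> < R n * T n \<omega>} \<union> {\<omega> \<in> space (P n). R n * T n \<omega> \<le> \<delta>})"
        unfolding bad_def
      proof (intro finite_measure_mono_AE, eventually_elim)
        case (elim \<omega>)
        note E = \<open>- 1 - \<epsilon> / 2 < ln (R n) / N n\<close> \<open>ln (R n) / N n < - 1 + \<epsilon> / 2\<close>
          \<open>- ln \<delta> / (\<epsilon> / 2) < N n\<close> \<open>ln \<delta> / (\<epsilon> / 2) < N n\<close>
        have R: "0 < R n" and T: "0 < T n \<omega>" using \<open>0 < V n \<and> 0 < C n \<and> 0 < R n\<close> elim by auto
        show ?case
        proof (rule impI, rule ccontr)
          assume b: "\<omega> \<in> {\<omega> \<in> space (P n). \<epsilon> < \<bar>(ln (T n \<omega>) - N n) / N n\<bar>}"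
            and nb: "\<omega> \<notin> {\<omega> \<in> space (P n). 1 / \<delta> < R n * T n \<omega>} \<union> {\<omega> \<in> space (P n). R n * T n \<omega> \<le> \<delta>}"
          have Y: "\<delta> < R n * T n \<omega>" "R n * T n \<omega> \<le> 1 / \<delta>" using b nb by auto
          have l: "ln (R n * T n \<omega>) = ln (R n) + ln (T n \<omega>)" using R T by (simp add: ln_mult)
          have "ln \<delta> < ln (R n * T n \<omega>)" using Y \<delta> R T by (subst ln_less_cancel_iff) auto
          moreover have "ln (R n * T n \<omega>) \<le> ln (1 / \<delta>)" using Y \<delta> R T by (subst ln_le_cancel_iff) auto
          then have "ln (R n * T n \<omega>) \<le> - ln \<delta>" using \<delta> by (simp add: ln_div)
          moreover have "- ln \<delta> < \<epsilon> / 2 * N n" "ln \<delta> < \<epsilon> / 2 * N n"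
            using E(3,4) \<epsilon> by (simp_all add: field_simps)
          moreover have "(- 1 - \<epsilon> / 2) * N n < ln (R n)" "ln (R n) < (- 1 + \<epsilon> / 2) * N n"
            using E(1,2) N by (simp_all only: pos_less_divide_eq pos_divide_less_eq)
          ultimately have "\<bar>ln (T n \<omega>) - N n\<bar> < \<epsilon> * N n"
            unfolding l by (simp add: algebra_simps abs_less_iff)
          then have "\<bar>(ln (T n \<omega>) - N n) / N n\<bar> < \<epsilon>" using N by (simp add: divide_less_eq)
          then show False using b by simp
        qed
      qed measurable
      also have "\<dots> \<le> prob {\<omega> \<in> space (P n). 1 / \<delta> < R n * T n \<omega>} + prob {\<omega> \<in> space (P n). R n * T n \<omega> \<le> \<delta>}"
        by (rule measure_Un_le) measurable
      also have "\<dots> < a" using elim(1) by (simp add: prob_le_eq[OF n])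
      finally show ?case .
    qed
  qed
  then show "(\<lambda>n. measure (P n) {\<omega> \<in> space (P n). \<epsilon> < \<bar>(ln (T n \<omega>) - real n powr (1 - \<alpha>)) / real n powr (1 - \<alpha>)\<bar>}) \<longlonglongrightarrow> 0"
    by (simp add: bad_def N_def)
qed

text \<open>The same splitting of the logarithm, now with \<open>scaled_mean\<close>, by which R
  times the mean tends to 1.\<close>

lemma log_mean_smallo:
  "(\<lambda>n. ln (integral\<^sup>L (P n) (T n)) - real n powr (1 - \<alpha>)) \<in> o(\<lambda>n. real n powr (1 - \<alpha>))"
proof (rule smalloI_tendsto)
  define N where "N = (\<lambda>n :: nat. real n powr (1 - \<alpha>))"
  have "(\<lambda>n. ln (R n * integral\<^sup>L (P n) (T n)) * inverse (N n) - (ln (R n) / N n + 1)) \<longlonglongrightarrow> ln 1 * 0 - (- 1 + 1)"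
  proof (intro tendsto_intros scaled_mean)
    show "(\<lambda>n. ln (R n) / N n) \<longlonglongrightarrow> - 1" unfolding N_def by (rule ln_rate_asymp)
    show "(\<lambda>n. inverse (N n)) \<longlonglongrightarrow> 0" unfolding N_def using \<alpha> by real_asymp
  qed simp
  moreover have "\<forall>\<^sub>F n in sequentially. 0 < R n * integral\<^sup>L (P n) (T n)"
    using order_tendstoD(1)[OF scaled_mean, of 0] by simp
  then have "\<forall>\<^sub>F n in sequentially. ln (R n * integral\<^sup>L (P n) (T n)) * inverse (N n) - (ln (R n) / N n + 1)
      = (ln (integral\<^sup>L (P n) (T n)) - N n) / N n"
    using eventually_pos eventually_ge_at_top[of 1]
  proof eventually_elim
    case (elim n)
    then have "0 < integral\<^sup>L (P n) (T n)" "0 < N n" by (auto simp: zero_less_mult_iff N_def)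
    then show ?case using elim by (simp add: ln_mult field_simps)
  qed
  ultimately show "(\<lambda>n. (ln (integral\<^sup>L (P n) (T n)) - real n powr (1 - \<alpha>)) / real n powr (1 - \<alpha>)) \<longlonglongrightarrow> 0"
    by (simp add: tendsto_cong N_def)
  show "\<forall>\<^sub>F n in sequentially. real n powr (1 - \<alpha>) \<noteq> 0"
    using eventually_gt_at_top[of 0] by eventually_elim simp
qed

lemma mean_asymp:
  assumes "1 / 2 < \<alpha>"
  shows "(\<lambda>n. integral\<^sup>L (P n) (T n)) \<sim>[at_top] (\<lambda>n. real n powr \<alpha> * exp (real n powr (1 - \<alpha>)))"
proof (rule asymp_equivI')
  have "(\<lambda>n. real n powr (- \<alpha>) * exp (- (real n powr (1 - \<alpha>))) / R n * (R n * integral\<^sup>L (P n) (T n))) \<longlonglongrightarrow> 1 * 1"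
    by (intro tendsto_mult rate_asymp assms scaled_mean)
  moreover have "\<forall>\<^sub>F n in sequentially. real n powr (- \<alpha>) * exp (- (real n powr (1 - \<alpha>))) / R n * (R n * integral\<^sup>L (P n) (T n))
      = integral\<^sup>L (P n) (T n) / (real n powr \<alpha> * exp (real n powr (1 - \<alpha>)))"
    using eventually_pos by eventually_elim (simp add: powr_minus exp_minus divide_inverse)
  ultimately show "(\<lambda>n. integral\<^sup>L (P n) (T n) / (real n powr \<alpha> * exp (real n powr (1 - \<alpha>)))) \<longlonglongrightarrow> 1"
    by (simp add: tendsto_cong)
qed

lemma variance_asymp:
  assumes "1 / 2 < \<alpha>"
  shows "(\<lambda>n. prob_space.variance (P n) (T n)) \<sim>[at_top] (\<lambda>n. real n powr (2 * \<alpha>) * exp (2 * real n powr (1 - \<alpha>)))"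
proof (rule asymp_equivI')
  define c where "c = (\<lambda>n :: nat. real n powr (- \<alpha>) * exp (- (real n powr (1 - \<alpha>))))"
  have "(\<lambda>n. (c n / R n)\<^sup>2 * ((R n)\<^sup>2 * prob_space.variance (P n) (T n))) \<longlonglongrightarrow> 1\<^sup>2 * 1"
    unfolding c_def by (intro tendsto_mult tendsto_power rate_asymp assms scaled_variance)
  moreover have "\<forall>\<^sub>F n in sequentially. (c n / R n)\<^sup>2 * ((R n)\<^sup>2 * prob_space.variance (P n) (T n))
      = prob_space.variance (P n) (T n) / (real n powr (2 * \<alpha>) * exp (2 * real n powr (1 - \<alpha>)))"
    using eventually_pos eventually_gt_at_top[of 0]
  proof eventually_elim
    case (elim n)
    have "real n powr (2 * \<alpha>) = (real n powr \<alpha>)\<^sup>2" by (simp add: power2_eq_square powr_add[symmetric])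
    moreover have "exp (2 * real n powr (1 - \<alpha>)) = (exp (real n powr (1 - \<alpha>)))\<^sup>2" by (simp add: exp_double)
    moreover have "c n = 1 / (real n powr \<alpha> * exp (real n powr (1 - \<alpha>)))"
      by (simp add: c_def powr_minus exp_minus field_simps)
    ultimately show ?case using elim by (simp add: power_divide power_mult_distrib)
  qed
  ultimately show "(\<lambda>n. prob_space.variance (P n) (T n) / (real n powr (2 * \<alpha>) * exp (2 * real n powr (1 - \<alpha>)))) \<longlonglongrightarrow> 1"
    by (simp add: tendsto_cong)
qed

lemma eventually_AE_finite:
  "\<forall>\<^sub>F n in sequentially. AE \<omega> in P n. completion_time n (M n) (X n) \<omega> \<noteq> \<infinity>"
  using eventually_M_gt eventually_ge_at_top[of 1]
proof eventually_elim
  case (elim n)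
  then show ?case by (intro coupon_process.AE_completion_time_finite[OF process]) auto
qed

end

theorem corollary7p2:
  fixes \<alpha> :: real
    and P :: "nat \<Rightarrow> 'a measure"
    and X :: "nat \<Rightarrow> nat \<Rightarrow> 'a \<Rightarrow> nat"
    and M :: "nat \<Rightarrow> nat"
    and \<mu> :: "nat \<Rightarrow> real"
    and T :: "nat \<Rightarrow> 'a \<Rightarrow> real"
  assumes "0 < \<alpha>" and "\<alpha> < 1"
    and coupons: "\<And>n. 1 \<le> n \<Longrightarrow> iid_uniform_coupons (P n) n (X n)"
  defines "M \<equiv> \<lambda>n. nat \<lfloor>\<alpha> * real n * ln (real n)\<rfloor>"
    and "\<mu> \<equiv> \<lambda>n. coupon_rate n (M n)"
    and "T \<equiv> \<lambda>n. completion_time_real n (M n) (X n)"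
  shows
    "(\<forall>\<^sub>F n in sequentially. AE \<omega> in P n. completion_time n (M n) (X n) \<omega> \<noteq> \<infinity>)
     \<and> conv_in_distr P (\<lambda>n \<omega>. \<mu> n * T n \<omega>) Exp1
     \<and> (\<forall>r::nat. 1 \<le> r \<longrightarrow>
          (\<lambda>n. prob_space.expectation (P n) (\<lambda>\<omega>. (\<mu> n * T n \<omega>) ^ r)) \<longlonglongrightarrow> fact r)
     \<and> smallo_prob P (\<lambda>n \<omega>. ln (T n \<omega>) - real n powr (1 - \<alpha>)) (\<lambda>n. real n powr (1 - \<alpha>))
     \<and> (\<lambda>n. ln (prob_space.expectation (P n) (T n)) - real n powr (1 - \<alpha>))
          \<in> o(\<lambda>n. real n powr (1 - \<alpha>))
     \<and> (1 / 2 < \<alpha> \<longrightarrow>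
          conv_in_distr P
            (\<lambda>n \<omega>. real n powr (- \<alpha>) * exp (- (real n powr (1 - \<alpha>))) * T n \<omega>) Exp1
          \<and> (\<lambda>n. prob_space.expectation (P n) (T n))
               \<sim>[at_top] (\<lambda>n. real n powr \<alpha> * exp (real n powr (1 - \<alpha>)))
          \<and> (\<lambda>n. prob_space.variance (P n) (T n))
               \<sim>[at_top] (\<lambda>n. real n powr (2 * \<alpha>) * exp (2 * real n powr (1 - \<alpha>))))"
proof -
  interpret E: expiring_coupons \<alpha> M P X
    by unfold_locales (use assms(1,2) coupons in \<open>auto simp: M_def\<close>)
  have \<mu>: "\<mu> = E.R" and T: "T = E.T"
    by (auto simp: \<mu>_def T_def E.T_def)
  show ?thesis
    unfolding \<mu> T
    using E.eventually_AE_finite E.scaled_conv_in_distr[OF E.R_ratio] E.scaled_moments E.log_T_smallo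
      E.log_mean_smallo E.scaled_conv_in_distr[OF E.rate_asymp] E.mean_asymp E.variance_asymp
    by blast
qed

end
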